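(* Assume that there is $K>0$ such that for all $t,s\in[0,T]$, $x,y\in\mathbb R^d$, $u\in M$, $$|b(t,x,u)-b(s,y,u)|+|\sigma(t,x,u)-\sigma(s,y,u)|\le K(|t-s|+|x-y|),$$ and that $f(t,x,u)$ is uniformly continuous in $(t,x)$, uniformly in $u\in M$. Let $u$ (resp. $v$) be an upper semicontinuous viscosity subsolution (resp. a lower semicontinuous viscosity supersolution), with polynomial growth in $x$, to $$\max\Big\{c(t,x)w-\frac{\partial w}{\partial t}+H(t,x,D_xw,D^2_xw),\ w-g(x)\Big\}=0\quad\text{on }[0,T)\times\mathbb R^d,$$ and suppose $u(T,x)\le v(T,x)$ for all $x\in\mathbb R^d$. Then $u\le v$ on $[0,T)\times\mathbb R^d$.
   Context: Fix $T>0$, $d\in\mathbb N$; $M$ is a separable metric space and $\mathbb M^d$ is the set of $d\times d$ real matrices. Standing assumptions: $b:[0,T]\times\mathbb R^d\times M\to\mathbb R^d$ and $\sigma:[0,T]\times\mathbb R^d\times M\to\mathbb M^d$ are Borel, continuous in $(x,u)$, and $|b(t,x,u)|+|\sigma(t,x,u)|\le K(1+|x|)$ for some $K>0$; $f:[0,T]\times\mathbb R^d\times M\to\mathbb R_+$ is Borel, continuous in $(x,u)$, and continuous in $x$ uniformly in $u\in M$ for each $t$; $g:\mathbb R^d\to\mathbb R_+$ is continuous; $c:[0,T]\times\mathbb R^d\to\mathbb R_+$ is continuous and bounded above by some $\bar c>0$; $|f(t,x,u)|+|g(x)|\le K(1+|x|^{\bar p})$ for some $\bar p\ge1$. For $(t,x,p,A)\in[0,T]\times\mathbb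 R^d\times\mathbb R^d\times\mathbb M^d$: $H(t,x,p,A):=\inf_{a\in M}\{-b(t,x,a)\cdot p-\frac12\mathrm{Tr}[\sigma\sigma'(t,x,a)A]-f(t,x,a)\}$ ($\sigma'$ is the transpose). $u,v$ are real-valued functions on $[0,T]\times\mathbb R^d$; polynomial growth in $x$ means $\sup_{(t,x)\in[0,T]\times\mathbb R^d}|w(t,x)|/(1+|x|^p)<\infty$ for some $p>0$. An upper (resp. lower) semicontinuous $w$ is a viscosity subsolution (resp. supersolution) if for every $h\in C^{1,2}([0,T)\times\mathbb R^d)$ and $(t_0,x_0)\in[0,T)\times\mathbb R^d$ with $(w-h)(t_0,x_0)=0$ a maximum (resp. minimum) of $w-h$ over $[0,T)\times\mathbb R^d$, one has $\max\{ch-\partial_th+H(\cdot,D_xh,D_x^2h),\,h-g\}(t_0,x_0)\le0$ (resp. $\ge0$). *)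

theory Defs
  imports "HOL-Analysis.Analysis"
begin

text \<open>
  Functions on \<open>[0,T] \<times> \<real>\<^sup>d\<close> are curried and total; only their values for \<open>t \<in> [0,T]\<close> (or
  \<open>t \<in> [0,T)\<close>) are ever constrained. The index type \<open>'n\<close> plays the role of \<open>d\<close>, and the norm of
  \<open>real^'n^'n\<close> is the Frobenius norm.
\<close>

text \<open>
  The infimum is the conditionally complete one of \<open>real\<close>. It is the true infimum whenever the set
  is bounded below, which the growth conditions on \<open>b\<close>, \<open>\<sigma>\<close>, \<open>f\<close> (uniform in the control) ensure.
\<close>
definition hamiltonian ::
  "(real \<Rightarrow> real^'n \<Rightarrow> 'm \<Rightarrow> real^'n) \<Rightarrow> (real \<Rightarrow> real^'n \<Rightarrow> 'm \<Rightarrow> real^'n^'n) \<Rightarrow>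
   (real \<Rightarrow> real^'n \<Rightarrow> 'm \<Rightarrow> real) \<Rightarrow> real \<Rightarrow> real^'n \<Rightarrow> real^'n \<Rightarrow> real^'n^'n \<Rightarrow> real" where
  "hamiltonian b \<sigma> f t x p A =
     (INF a. - (b t x a \<bullet> p) - 1/2 * trace (\<sigma> t x a ** transpose (\<sigma> t x a) ** A) - f t x a)"

definition upper_semicont_on :: "'a::topological_space set \<Rightarrow> ('a \<Rightarrow> real) \<Rightarrow> bool" where
  "upper_semicont_on S w \<longleftrightarrow>
     (\<forall>z\<in>S. \<forall>r. w z < r \<longrightarrow> eventually (\<lambda>y. w y < r) (at z within S))"

definition lower_semicont_on :: "'a::topological_space set \<Rightarrow> ('a \<Rightarrow> real) \<Rightarrow> bool" where
  "lower_semicont_on S w \<longleftrightarrow>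
     (\<forall>z\<in>S. \<forall>r. r < w z \<longrightarrow> eventually (\<lambda>y. r < w y) (at z within S))"

definition polynomial_growth :: "real \<Rightarrow> (real \<Rightarrow> real^'n \<Rightarrow> real) \<Rightarrow> bool" where
  "polynomial_growth T w \<longleftrightarrow>
     (\<exists>p>0. bdd_above ((\<lambda>(t, x). \<bar>w t x\<bar> / (1 + norm x powr p)) ` ({0..T} \<times> UNIV)))"

text \<open>
  \<open>h \<in> C\<^sup>1\<^sup>,\<^sup>2([0,T) \<times> \<real>\<^sup>d)\<close> with time derivative \<open>ht\<close>, spatial gradient \<open>Dh\<close> and spatial Hessian
  \<open>D2h\<close>, which are uniquely determined on \<open>[0,T) \<times> \<real>\<^sup>d\<close>. The time derivative at \<open>0\<close> is one-sided.
\<close>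
definition C12_with_derivs ::
  "real \<Rightarrow> (real \<Rightarrow> real^'n \<Rightarrow> real) \<Rightarrow> (real \<Rightarrow> real^'n \<Rightarrow> real) \<Rightarrow>
   (real \<Rightarrow> real^'n \<Rightarrow> real^'n) \<Rightarrow> (real \<Rightarrow> real^'n \<Rightarrow> real^'n^'n) \<Rightarrow> bool" where
  "C12_with_derivs T h ht Dh D2h \<longleftrightarrow>
     (\<forall>t\<in>{0..<T}. \<forall>x.
        ((\<lambda>s. h s x) has_real_derivative ht t x) (at t within {0..<T}) \<and>
        GDERIV (h t) x :> Dh t x \<and>
        (Dh t has_derivative (\<lambda>y. D2h t x *v y)) (at x)) \<and>
     continuous_on ({0..<T} \<times> UNIV) (\<lambda>(t, x). h t x) \<and>
     continuous_on ({0..<T} \<times> UNIV) (\<lambda>(t, x). ht t x) \<and>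
     continuous_on ({0..<T} \<times> UNIV) (\<lambda>(t, x). Dh t x) \<and>
     continuous_on ({0..<T} \<times> UNIV) (\<lambda>(t, x). D2h t x)"

text \<open>
  Viscosity sub- and supersolutions of
  \<open>max {c w - \<partial>\<^sub>t w + H(t,x,Dw,D\<^sup>2w), w - g} = 0\<close> on \<open>[0,T) \<times> \<real>\<^sup>d\<close>.
  Semicontinuity is required on the whole of \<open>[0,T] \<times> \<real>\<^sup>d\<close>.
\<close>
definition viscosity_subsolution ::
  "real \<Rightarrow> (real \<Rightarrow> real^'n \<Rightarrow> real) \<Rightarrow> (real \<Rightarrow> real^'n \<Rightarrow> real^'n \<Rightarrow> real^'n^'n \<Rightarrow> real) \<Rightarrow>
   (real^'n \<Rightarrow> real) \<Rightarrow> (real \<Rightarrow> real^'n \<Rightarrow> real) \<Rightarrow> bool" where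
  "viscosity_subsolution T c H g w \<longleftrightarrow>
     upper_semicont_on ({0..T} \<times> UNIV) (\<lambda>(t, x). w t x) \<and>
     (\<forall>h ht Dh D2h. C12_with_derivs T h ht Dh D2h \<longrightarrow>
        (\<forall>t\<^sub>0\<in>{0..<T}. \<forall>x\<^sub>0.
           w t\<^sub>0 x\<^sub>0 - h t\<^sub>0 x\<^sub>0 = 0 \<and>
           (\<forall>t\<in>{0..<T}. \<forall>x. w t x - h t x \<le> w t\<^sub>0 x\<^sub>0 - h t\<^sub>0 x\<^sub>0) \<longrightarrow>
           max (c t\<^sub>0 x\<^sub>0 * h t\<^sub>0 x\<^sub>0 - ht t\<^sub>0 x\<^sub>0 + H t\<^sub>0 x\<^sub>0 (Dh t\<^sub>0 x\<^sub>0) (D2h t\<^sub>0 x\<^sub>0))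
               (h t\<^sub>0 x\<^sub>0 - g x\<^sub>0) \<le> 0))"

definition viscosity_supersolution ::
  "real \<Rightarrow> (real \<Rightarrow> real^'n \<Rightarrow> real) \<Rightarrow> (real \<Rightarrow> real^'n \<Rightarrow> real^'n \<Rightarrow> real^'n^'n \<Rightarrow> real) \<Rightarrow>
   (real^'n \<Rightarrow> real) \<Rightarrow> (real \<Rightarrow> real^'n \<Rightarrow> real) \<Rightarrow> bool" where
  "viscosity_supersolution T c H g w \<longleftrightarrow>
     lower_semicont_on ({0..T} \<times> UNIV) (\<lambda>(t, x). w t x) \<and>
     (\<forall>h ht Dh D2h. C12_with_derivs T h ht Dh D2h \<longrightarrow>
        (\<forall>t\<^sub>0\<in>{0..<T}. \<forall>x\<^sub>0.
           w t\<^sub>0 x\<^sub>0 - h t\<^sub>0 x\<^sub>0 = 0 \<and>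
           (\<forall>t\<in>{0..<T}. \<forall>x. w t x - h t x \<ge> w t\<^sub>0 x\<^sub>0 - h t\<^sub>0 x\<^sub>0) \<longrightarrow>
           max (c t\<^sub>0 x\<^sub>0 * h t\<^sub>0 x\<^sub>0 - ht t\<^sub>0 x\<^sub>0 + H t\<^sub>0 x\<^sub>0 (Dh t\<^sub>0 x\<^sub>0) (D2h t\<^sub>0 x\<^sub>0))
               (h t\<^sub>0 x\<^sub>0 - g x\<^sub>0) \<ge> 0))"

end

theory Submission
  imports Defs
begin

text \<open>
  Suppose \<open>u > v\<close> somewhere. Subtracting from \<open>u\<close> and adding to \<open>v\<close> a small multiple of
  \<open>exp (\<lambda> (T - t)) (1 + \<bar>x\<bar>\<^sup>2)\<^sup>m\<close>, which is a strict supersolution of the linear part for every control when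
  \<open>\<lambda>\<close> is large, makes the equations strict and the functions coercive. Doubling both \<open>t\<close> and \<open>x\<close> is
  carried out by regularization: the penalized maximum of \<open>u(z) - v(\<zeta>) - \<bar>z - \<zeta>\<bar>\<^sup>2 / 4\<kappa>\<close> is the maximum of
  the sum \<open>W\<close> of the sup-convolutions of \<open>u\<close> and \<open>- v\<close> with parameter \<open>\<kappa>\<close>, a function of one variable.
  Both sup-convolutions are semiconvex, so near the maximum there is a point where a linear
  perturbation of \<open>W\<close> is maximal and both are twice differentiable; the Hessians have nonpositive sum.
  Transporting the jets to the points where the sup-convolutions are attained turns this sign into
  the matrix inequality of Ishii's lemma. It bounds the difference of the second-order terms by
  \<open>\<bar>\<sigma>(z) - \<sigma>(\<zeta>)\<bar>\<^sup>2 / 4\<kappa>\<close> up to a vanishing error and tends to \<open>0\<close> since \<open>\<sigma>\<close> is Lipschitz in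
  \<open>(t, x)\<close>. Jets are taken relative to \<open>[0, T] \<times> \<real>\<^sup>d\<close>, so \<open>t = 0\<close> needs no separate treatment.

  Second derivatives exist by Rademacher's theorem for the nonexpansive resolvent
  \<open>(id + \<partial>U)\<^sup>-\<^sup>1\<close> of a convex function \<open>U\<close>. That theorem is reduced to the line by
  Tonelli's theorem; linearity of the directional derivative holds because its integrals over
  boxes are additive in the direction.
\<close>

section \<open>Rademacher's theorem\<close>

text \<open>The coefficient \<open>c\<close> may vanish, so the zeroth-order term gives no
  strictness: the contribution -\<alpha> of the penalty on each side has to pay for every error. The
  two penalized points differ in time as well as in position. Putting \<open>t\<close> and
  \<open>x\<close> into one vector makes the theorem on sums a statement about functions of a single
  variable, and no bound on time derivatives has to be known beforehand; the price is drift errors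
  of size |t1 - t2| times a slope of size |z1 - y| / \<kappa>, which Lipschitz continuity in time
  controls. Twice differentiability is needed only where the convex function is touched from above
  by a paraboloid. There the subgradients are Lipschitz relative to the contact point, which forces
  the derivative of the resolvent to be invertible; at a general point it may be singular. The
  linear perturbation makes the slopes at the two points opposite only up to a small error, which
  multiplies drifts that may grow with \<open>x\<close>; this is harmless because the points
  converge and so stay bounded.\<close>

text \<open>A steep linear summand makes \<open>f\<close> increasing and bi-Lipschitz. The Stieltjes
  measure of the sum is absolutely continuous, and Lebesgue differentiation of its density gives the
  derivative. The cubes used there have their lower corner at the point, hence right derivatives
  only.\<close>

lemma lipschitz_right_derivative_ae:
  fixes f :: "real \<Rightarrow> real"
  assumes lip: "\<And>x y. \<bar>f x - f y\<bar> \<le> M * \<bar>x - y\<bar>"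
  obtains N where "negligible N"
    "\<And>x. x \<notin> N \<Longrightarrow> \<exists>l. ((\<lambda>t. (f (x + t) - f x) / t) \<longlongrightarrow> l) (at_right 0)"
proof -
  \<comment> \<open>The summand 1 keeps \<open>B\<close> positive even for
    \<open>M = 0\<close>.\<close>
  define B where "B = \<bar>M\<bar> + 1"
  have B: "B > 0" by (simp add: B_def)
  have lipB: "\<bar>f x - f y\<bar> \<le> B * \<bar>x - y\<bar>" for x y
    by (rule order_trans[OF lip mult_right_mono]) (auto simp: B_def)
  \<comment> \<open>Slope \<open>2 * B\<close> against a Lipschitz constant \<open>B\<close> leaves
    slopes between \<open>B\<close> and \<open>3 * B\<close>: the lower bound makes the inverse
    Lipschitz, the upper one preserves null sets.\<close>
  define F where "F = (\<lambda>x. f x + 2 * B * x)"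
  have F_lower: "B * (y - x) \<le> F y - F x" and F_upper: "F y - F x \<le> 3 * B * (y - x)"
    if "x \<le> y" for x y
    using lipB[of y x] that by (auto simp: F_def abs_le_iff algebra_simps)
  have F_lip: "\<bar>F x - F y\<bar> \<le> 3 * B * \<bar>x - y\<bar>" for x y
  proof (cases "x \<le> y")
    case True
    then have "B * (y - x) \<ge> 0" "\<bar>x - y\<bar> = y - x" using B by auto
    then show ?thesis
      using F_lower[OF True] F_upper[OF True] by (simp only: abs_of_nonneg)
  next
    case False
    then have "y \<le> x" by simp
    then have "B * (x - y) \<ge> 0" "\<bar>x - y\<bar> = x - y" using B by auto
    then show ?thesis
      using F_lower[OF \<open>y \<le> x\<close>] F_upper[OF \<open>y \<le> x\<close>] by (simp only: abs_of_nonneg)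
  qed
  have F_less: "F x < F y" if "x < y" for x y
    using F_lower[of x y] that B by (smt (verit) mult_pos_pos)
  have F_inj: "inj F"
    by (rule injI) (metis F_less less_irrefl linorder_neqE_linordered_idom)
  have F_lipon: "(3 * B)-lipschitz_on UNIV F"
    using F_lip B by (intro lipschitz_onI) (auto simp: dist_real_def)
  have F_cont: "continuous_on UNIV F"
    by (rule lipschitz_on_continuous_on[OF F_lipon])
  have F_surj: "surj F"
  proof (unfold surj_def, intro allI)
    fix y
    define r where "r = \<bar>y - F 0\<bar> / B"
    have r: "r \<ge> 0" "B * r = \<bar>y - F 0\<bar>" using B by (auto simp: r_def)
    have "F (-r) \<le> y" using F_lower[of "-r" 0] r by simp
    moreover have "y \<le> F r" using F_lower[of 0 r] r by simp
    ultimately have "\<exists>x. -r \<le> x \<and> x \<le> r \<and> F x = y"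
      using r F_cont by (intro IVT') (auto intro: continuous_on_subset)
    then show "\<exists>x. y = F x" by blast
  qed
  define G where "G = inv F"
  have FG: "F (G y) = y" for y
    unfolding G_def by (rule surj_f_inv_f[OF F_surj])
  have GF: "G (F x) = x" for x
    unfolding G_def by (rule inv_f_f[OF F_inj])
  have F_le: "F x \<le> F y \<longleftrightarrow> x \<le> y" for x y
    using F_less[of x y] F_less[of y x] by (cases x y rule: linorder_cases) auto
  have G_lip: "\<bar>G a - G b\<bar> \<le> (1 / B) * \<bar>a - b\<bar>" for a b
  proof -
    have "B * \<bar>G a - G b\<bar> \<le> \<bar>a - b\<bar>"
    proof (cases "G a \<le> G b")
      case True
      then show ?thesis using F_lower[OF True] FG by (simp add: abs_if algebra_simps)
    next
      case False
      then have "G b \<le> G a" by simp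
      then show ?thesis using F_lower[of "G b" "G a"] FG by (simp add: abs_if algebra_simps)
    qed
    then show ?thesis using B by (simp add: field_simps)
  qed
  have "(1 / B)-lipschitz_on UNIV G"
    using G_lip B by (intro lipschitz_onI) (auto simp: dist_real_def)
  then have "continuous_on UNIV G" by (rule lipschitz_on_continuous_on)
  then have G_meas[measurable]: "G \<in> borel_measurable borel"
    by (rule borel_measurable_continuous_onI)
  \<comment> \<open>The measure of a set is the Lebesgue measure of its image under
    \<open>F\<close>: the Stieltjes measure of \<open>F\<close>.\<close>
  define \<mu> where "\<mu> = distr lborel borel G"
  have sets_\<mu>: "sets \<mu> = sets lborel" by (simp add: \<mu>_def)
  have G_vimage: "G -` A = F ` A" for A
    using FG GF by (auto simp: image_iff) metis
  have ac: "absolutely_continuous lborel \<mu>"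
    unfolding absolutely_continuous_def
  proof
    fix A assume A: "A \<in> null_sets (lborel :: real measure)"
    then have A_borel: "A \<in> sets borel" by auto
    have "negligible A"
      using A by (simp add: negligible_iff_null_sets null_sets_completionI)
    then have "negligible (F ` A)"
    proof (rule negligible_locally_Lipschitz_image[rotated])
      show "\<exists>T B. open T \<and> x \<in> T \<and> (\<forall>y\<in>A \<inter> T. norm (F y - F x) \<le> B * norm (y - x))" for x
        using F_lip by (intro exI[of _ UNIV] exI[of _ "3 * B"]) auto
    qed simp
    moreover have "F ` A \<in> sets borel"
      using measurable_sets[OF G_meas A_borel] by (simp add: G_vimage)
    ultimately have "F ` A \<in> null_sets lborel"
      by (simp add: negligible_iff_null_sets null_sets_completion_iff)
    then have "emeasure \<mu> A = 0"
      using A_borel by (simp add: \<mu>_def emeasure_distr G_vimage null_setsD1)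
    then show "A \<in> null_sets \<mu>"
      using A_borel by (auto simp: null_sets_def sets_\<mu>)
  qed
  obtain g where g[measurable]: "g \<in> borel_measurable lborel" and dens: "density lborel g = \<mu>"
    using sigma_finite_measure.Radon_Nikodym[OF sigma_finite_lborel ac sets_\<mu>] by blast
  \<comment> \<open>The density is finite almost everywhere on each interval, since the interval has
    finite mass; passing to \<open>enn2real\<close> changes no integral.\<close>
  define k where "k = (\<lambda>x. enn2real (g x))"
  have k_meas[measurable]: "k \<in> borel_measurable borel"
    unfolding k_def using g by simp
  have k_int: "(k has_integral (F b - F a)) {a..b}" if "a \<le> b" for a b
  proof -
    have "emeasure \<mu> {a..b} = emeasure lborel {F a..F b}"
    proof -
      have "G -` {a..b} = {F a..F b}"
        using F_le FG by (auto simp: vimage_def) (metis FG F_le)+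
      then show ?thesis by (simp add: \<mu>_def emeasure_distr)
    qed
    also have "\<dots> = ennreal (F b - F a)"
      using F_le that by simp
    finally have eq: "(\<integral>\<^sup>+x. g x * indicator {a..b} x \<partial>lborel) = ennreal (F b - F a)"
      by (simp add: dens[symmetric] emeasure_density)
    have "AE x in lborel. g x * indicator {a..b} x \<noteq> \<infinity>"
      by (rule nn_integral_PInf_AE) (use eq in auto)
    then have "(\<integral>\<^sup>+x. ennreal (k x * indicator {a..b} x) \<partial>lborel) = (\<integral>\<^sup>+x. g x * indicator {a..b} x \<partial>lborel)"
      by (intro nn_integral_cong_AE) (auto elim!: eventually_mono simp: k_def indicator_def less_top)
    then have "((\<lambda>x. k x * indicator {a..b} x) has_integral (F b - F a)) UNIV"
      using eq F_le[of a b] that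
      by (intro nn_integral_has_integral) (auto simp: k_def)
    moreover have "(\<lambda>x. k x * indicator {a..b} x) = (\<lambda>x. if x \<in> {a..b} then k x else 0)"
      by auto
    ultimately show ?thesis by (simp only: has_integral_restrict_UNIV)
  qed
  have "k integrable_on cbox a b" for a b
    using k_int[of a b] by (cases "a \<le> b") (auto simp: integrable_on_def)
  then obtain N where N: "negligible N"
    and lim: "\<And>x e. \<lbrakk>x \<notin> N; 0 < e\<rbrakk> \<Longrightarrow> \<exists>d>0. \<forall>h. 0 < h \<and> h < d \<longrightarrow>
       norm (integral (cbox x (x + h *\<^sub>R One)) k /\<^sub>R h ^ DIM(real) - k x) < e"
    by (rule integrable_ccontinuous_explicit) blast
  show thesis
  proof (rule that[OF N])
    fix x assume x: "x \<notin> N"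
    have "((\<lambda>t. (F (x + t) - F x) / t) \<longlongrightarrow> k x) (at_right 0)"
    proof (rule tendstoI)
      fix e :: real assume "e > 0"
      from lim[OF x this] obtain d where d: "d > 0" "\<And>h. 0 < h \<Longrightarrow> h < d \<Longrightarrow>
          norm (integral (cbox x (x + h *\<^sub>R One)) k /\<^sub>R h ^ DIM(real) - k x) < e" by blast
      have "dist ((F (x + h) - F x) / h) (k x) < e" if "0 < h" "h < d" for h
        using d(2)[OF that] integral_unique[OF k_int[of x "x + h"]] that
        by (simp add: dist_real_def divide_inverse mult.commute)
      then show "\<forall>\<^sub>F h in at_right 0. dist ((F (x + h) - F x) / h) (k x) < e"
        unfolding eventually_at_right_field using d(1) by (intro exI[of _ d]) auto
    qed
    then have "((\<lambda>t. (F (x + t) - F x) / t - 2 * B) \<longlongrightarrow> k x - 2 * B) (at_right 0)"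
      by (intro tendsto_intros)
    then have "((\<lambda>t. (f (x + t) - f x) / t) \<longlongrightarrow> k x - 2 * B) (at_right 0)"
      by (rule Lim_transform_eventually)
        (auto simp: eventually_at_right_field F_def field_simps intro!: exI[of _ 1])
    then show "\<exists>l. ((\<lambda>t. (f (x + t) - f x) / t) \<longlongrightarrow> l) (at_right 0)" by blast
  qed
qed

text \<open>Averaging the translates of \<open>A\<close> by \<open>t v\<close> over \<open>t \<in> [0, 1]\<close> avoids rotating \<open>v\<close> to a coordinate axis.\<close>

lemma null_set_if_null_on_lines:
  fixes v :: "'a::euclidean_space"
  assumes A[measurable]: "A \<in> sets borel"
    and lines: "\<And>x. AE t in lborel. x + t *\<^sub>R v \<notin> A"
  shows "A \<in> null_sets lborel"
proof -
  let ?F = "\<lambda>(t::real, x::'a). indicator {0..1} t * (indicator A (x + t *\<^sub>R v) :: ennreal)"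
  have meas: "?F \<in> borel_measurable (lborel \<Otimes>\<^sub>M lborel)"
    by measurable
  have shift: "(\<integral>\<^sup>+x. indicator A (x + t *\<^sub>R v) \<partial>lborel) = emeasure lborel A" for t
  proof -
    have "emeasure lborel A = (\<integral>\<^sup>+y. indicator A y \<partial>distr lborel borel ((+) (t *\<^sub>R v)))"
      by (simp add: lborel_distr_plus)
    also have "\<dots> = (\<integral>\<^sup>+x. indicator A (t *\<^sub>R v + x) \<partial>lborel)"
      by (subst nn_integral_distr) auto
    finally show ?thesis by (simp add: add.commute)
  qed
  have "emeasure lborel A = (\<integral>\<^sup>+t. indicator {0..1::real} t * emeasure lborel A \<partial>lborel)"
    by (subst nn_integral_multc) auto
  also have "\<dots> = (\<integral>\<^sup>+t. \<integral>\<^sup>+x. ?F (t, x) \<partial>lborel \<partial>lborel)"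
    by (simp add: shift nn_integral_cmult)
  also have "\<dots> = (\<integral>\<^sup>+x. \<integral>\<^sup>+t. ?F (t, x) \<partial>lborel \<partial>lborel)"
    using lborel_pair.Fubini'[OF meas] by simp
  also have "\<dots> = (\<integral>\<^sup>+x. 0 \<partial>(lborel :: 'a measure))"
  proof (intro nn_integral_cong)
    fix x :: 'a
    have "(\<integral>\<^sup>+t. ?F (t, x) \<partial>lborel) = (\<integral>\<^sup>+t. 0 \<partial>(lborel :: real measure))"
      by (rule nn_integral_cong_AE) (use lines[of x] in \<open>auto elim!: eventually_mono\<close>)
    then show "(\<integral>\<^sup>+t. ?F (t, x) \<partial>lborel) = 0" by simp
  qed
  finally show ?thesis using A by (auto simp: null_sets_def)
qed

text \<open>The averages over small cubes vanish and, by Lebesgue differentiation, converge to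
  \<open>h x\<close> outside a null set.\<close>

lemma negligible_nonzero_if_integrals_zero:
  fixes h :: "'a::euclidean_space \<Rightarrow> real"
  assumes "\<And>a b. (h has_integral 0) (cbox a b)"
  obtains N where "negligible N" "\<And>x. x \<notin> N \<Longrightarrow> h x = 0"
proof -
  have "h integrable_on cbox a b" for a b using assms by blast
  then obtain N where N: "negligible N"
    and lim: "\<And>x e. \<lbrakk>x \<notin> N; 0 < e\<rbrakk> \<Longrightarrow> \<exists>d>0. \<forall>r. 0 < r \<and> r < d \<longrightarrow>
       norm (integral (cbox x (x + r *\<^sub>R One)) h /\<^sub>R r ^ DIM('a) - h x) < e"
    by (rule integrable_ccontinuous_explicit) blast
  have "h x = 0" if x: "x \<notin> N" for x
  proof (rule ccontr)
    assume "h x \<noteq> 0"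
    with lim[OF x, of "\<bar>h x\<bar>"] obtain d where "d > 0"
      and d: "\<And>r. 0 < r \<Longrightarrow> r < d \<Longrightarrow>
        norm (integral (cbox x (x + r *\<^sub>R One)) h /\<^sub>R r ^ DIM('a) - h x) < \<bar>h x\<bar>" by auto
    from d[of "d / 2"] \<open>d > 0\<close> show False
      by (simp add: integral_unique[OF assms])
  qed
  with N show thesis by (rule that)
qed

section \<open>Directional difference quotients and their almost everywhere limits\<close>

definition dquot :: "('a::real_normed_vector \<Rightarrow> real) \<Rightarrow> 'a \<Rightarrow> real \<Rightarrow> 'a \<Rightarrow> real" where
  "dquot f v t x = (f (x + t *\<^sub>R v) - f x) / t"

text \<open>A limit along a sequence is measurable without knowing where it exists. Off the set of
  convergence the value is whatever \<open>lim\<close> yields; that set will have a null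
  complement.\<close>

definition dderiv :: "('a::real_normed_vector \<Rightarrow> real) \<Rightarrow> 'a \<Rightarrow> 'a \<Rightarrow> real" where
  "dderiv f v x = lim (\<lambda>n. dquot f v (1 / Suc n) x)"

text \<open>Existence of the one-sided directional derivative, as a Cauchy criterion: for continuous \<open>f\<close> each
  inner set is closed, so the whole set is Borel.\<close>

definition dcauchy :: "('a::real_normed_vector \<Rightarrow> real) \<Rightarrow> 'a \<Rightarrow> 'a set" where
  "dcauchy f v = (\<Inter>k. \<Union>j. {x. \<forall>s\<in>{0<..<1 / Suc j}. \<forall>t\<in>{0<..<1 / Suc j}.
     \<bar>dquot f v s x - dquot f v t x\<bar> \<le> 1 / Suc k})"

lemma inverse_Suc_at_right: "filterlim (\<lambda>n. 1 / real (Suc n)) (at_right 0) sequentially"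
proof -
  have "(\<lambda>n. 1 / real (Suc n)) \<longlonglongrightarrow> 0"
    using LIMSEQ_Suc[OF lim_1_over_n[where 'a=real]] by simp
  then show ?thesis by (auto simp: filterlim_at)
qed

lemma dcauchyI:
  assumes "((\<lambda>t. dquot f v t x) \<longlongrightarrow> l) (at_right 0)"
  shows "x \<in> dcauchy f v"
  unfolding dcauchy_def
proof safe
  fix k :: nat
  have "\<forall>\<^sub>F t in at_right 0. dist (dquot f v t x) l < 1 / (2 * Suc k)"
    using assms by (rule tendstoD) simp
  then obtain r where "r > 0" and r: "\<And>t. 0 < t \<Longrightarrow> t < r \<Longrightarrow> \<bar>dquot f v t x - l\<bar> < 1 / (2 * Suc k)"
    unfolding eventually_at_right_field dist_real_def by blast
  obtain j where j: "1 / real (Suc j) < r"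
    using reals_Archimedean[OF \<open>r > 0\<close>] by (auto simp: inverse_eq_divide)
  have "\<bar>dquot f v s x - dquot f v t x\<bar> \<le> 1 / Suc k"
    if "s \<in> {0<..<1 / Suc j}" "t \<in> {0<..<1 / Suc j}" for s t
  proof -
    have "1 / (2 * real (Suc k)) + 1 / (2 * real (Suc k)) = 1 / real (Suc k)" by (simp add: field_simps)
    then show ?thesis using r[of s] r[of t] that j by simp
  qed
  then show "x \<in> (\<Union>j. {x. \<forall>s\<in>{0<..<1 / Suc j}. \<forall>t\<in>{0<..<1 / Suc j}.
     \<bar>dquot f v s x - dquot f v t x\<bar> \<le> 1 / Suc k})" by blast
qed

lemma dcauchyD:
  assumes "x \<in> dcauchy f v"
  shows "((\<lambda>t. dquot f v t x) \<longlongrightarrow> dderiv f v x) (at_right 0)"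
proof -
  let ?a = "\<lambda>n. dquot f v (1 / Suc n) x"
  have cau: "\<exists>j. \<forall>s\<in>{0<..<1 / Suc j}. \<forall>t\<in>{0<..<1 / Suc j}.
     \<bar>dquot f v s x - dquot f v t x\<bar> \<le> 1 / Suc k" for k
    using assms by (auto simp: dcauchy_def)
  have ev: "\<exists>r>0. \<forall>s\<in>{0<..<r}. \<forall>t\<in>{0<..<r}. \<bar>dquot f v s x - dquot f v t x\<bar> < e" if "e > 0" for e :: real
  proof -
    obtain k where k: "1 / real (Suc k) < e"
      using reals_Archimedean[OF \<open>e > 0\<close>] by (auto simp: inverse_eq_divide)
    obtain j where "\<forall>s\<in>{0<..<1 / real (Suc j)}. \<forall>t\<in>{0<..<1 / Suc j}.
        \<bar>dquot f v s x - dquot f v t x\<bar> \<le> 1 / Suc k" using cau by blast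
    then show ?thesis using k by (intro exI[of _ "1 / real (Suc j)"]) fastforce
  qed
  have small: "\<forall>\<^sub>F n in sequentially. 1 / real (Suc n) < r" if "r > 0" for r
    using order_tendstoD(2)[OF LIMSEQ_Suc[OF lim_1_over_n[where 'a=real]], of r] that by simp
  have "Cauchy ?a"
  proof (rule CauchyI)
    fix e :: real assume "e > 0"
    from ev[OF this] obtain r where "r > 0"
      and r: "\<And>s t. 0 < s \<Longrightarrow> s < r \<Longrightarrow> 0 < t \<Longrightarrow> t < r \<Longrightarrow> \<bar>dquot f v s x - dquot f v t x\<bar> < e" by auto
    from small[OF \<open>r > 0\<close>] obtain M where "\<And>n. n \<ge> M \<Longrightarrow> 1 / real (Suc n) < r"
      by (auto simp: eventually_sequentially)
    then show "\<exists>M. \<forall>m\<ge>M. \<forall>n\<ge>M. norm (?a m - ?a n) < e"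
      by (intro exI[of _ M]) (auto intro!: r)
  qed
  then have lim: "?a \<longlonglongrightarrow> dderiv f v x"
    unfolding dderiv_def using Cauchy_convergent_iff convergent_LIMSEQ_iff by blast
  show ?thesis
  proof (rule tendstoI)
    fix e :: real assume "e > 0"
    then have "e / 2 > 0" by simp
    from ev[OF this] obtain r where "r > 0"
      and r: "\<And>s t. 0 < s \<Longrightarrow> s < r \<Longrightarrow> 0 < t \<Longrightarrow> t < r \<Longrightarrow> \<bar>dquot f v s x - dquot f v t x\<bar> < e / 2" by auto
    have "\<bar>dquot f v t x - dderiv f v x\<bar> \<le> e / 2" if t: "0 < t" "t < r" for t
    proof (rule tendsto_upperbound)
      show "(\<lambda>n. \<bar>dquot f v t x - ?a n\<bar>) \<longlonglongrightarrow> \<bar>dquot f v t x - dderiv f v x\<bar>"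
        by (intro tendsto_intros lim)
      show "\<forall>\<^sub>F n in sequentially. \<bar>dquot f v t x - ?a n\<bar> \<le> e / 2"
        using small[OF \<open>r > 0\<close>] by eventually_elim (use r t in \<open>auto intro!: less_imp_le\<close>)
    qed simp
    then show "\<forall>\<^sub>F t in at_right 0. dist (dquot f v t x) (dderiv f v x) < e"
      unfolding eventually_at_right_field dist_real_def using \<open>r > 0\<close> \<open>e > 0\<close>
      by (intro exI[of _ r]) fastforce
  qed
qed

context
  fixes f :: "'a::euclidean_space \<Rightarrow> real" and M :: real
  assumes lip: "\<And>x y. \<bar>f x - f y\<bar> \<le> M * norm (x - y)"
begin

lemma lipschitz_bound_continuous: "continuous_on UNIV f"
proof -
  have "M \<ge> 0" 
    using lip[of "SOME i. i \<in> Basis" 0] norm_some_Basis[where 'a='a] by (metis abs_ge_zero mult.right_neutral order_trans diff_zero)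
  then have "M-lipschitz_on UNIV f"
    using lip by (intro lipschitz_onI) (auto simp: dist_norm)
  then show ?thesis by (rule lipschitz_on_continuous_on)
qed

lemma dquot_bound: "t > 0 \<Longrightarrow> \<bar>dquot f v t x\<bar> \<le> M * norm v"
  using lip[of "x + t *\<^sub>R v" x] by (simp add: dquot_def field_simps)

lemma dquot_cont: "continuous_on UNIV (dquot f v t)"
  unfolding dquot_def divide_inverse
  by (intro continuous_intros continuous_on_compose2[OF lipschitz_bound_continuous]) auto

lemma dquot_meas[measurable]: "dquot f v t \<in> borel_measurable borel"
  by (rule borel_measurable_continuous_onI[OF dquot_cont])

lemma dderiv_meas[measurable]: "dderiv f v \<in> borel_measurable borel"
  unfolding dderiv_def by measurable

lemma dcauchy_borel: "dcauchy f v \<in> sets borel"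
proof -
  have "closed {x. \<forall>s\<in>{0<..<1 / real (Suc j)}. \<forall>t\<in>{0<..<1 / real (Suc j)}.
     \<bar>dquot f v s x - dquot f v t x\<bar> \<le> 1 / real (Suc k)}" (is "closed ?S") for j k
  proof -
    have "?S = (\<Inter>s\<in>{0<..<1 / real (Suc j)}. \<Inter>t\<in>{0<..<1 / real (Suc j)}.
        {x. \<bar>dquot f v s x - dquot f v t x\<bar> \<le> 1 / real (Suc k)})" by auto
    also have "closed \<dots>"
      by (intro closed_INT ballI closed_Collect_le continuous_intros dquot_cont)
    finally show ?thesis .
  qed
  then show ?thesis unfolding dcauchy_def by (intro sets.countable_INT sets.countable_UN) auto
qed

text \<open>Along a line in direction \<open>v\<close> the function is Lipschitz in one real
  variable, so the exceptional parameters are null on every line.\<close>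

lemma dcauchy_ae: "- dcauchy f v \<in> null_sets lborel"
proof (rule null_set_if_null_on_lines)
  show "- dcauchy f v \<in> sets borel" using dcauchy_borel[of v] by auto
  fix x
  have "\<bar>f (x + s *\<^sub>R v) - f (x + t *\<^sub>R v)\<bar> \<le> (M * norm v) * \<bar>s - t\<bar>" for s t
    using lip[of "x + s *\<^sub>R v" "x + t *\<^sub>R v"]
    by (simp add: algebra_simps flip: scaleR_left_diff_distrib)
  then obtain N where N: "negligible N"
    and lim: "\<And>t. t \<notin> N \<Longrightarrow> \<exists>l. ((\<lambda>s. (f (x + (t + s) *\<^sub>R v) - f (x + t *\<^sub>R v)) / s) \<longlongrightarrow> l) (at_right 0)"
    by (rule lipschitz_right_derivative_ae) blast
  have "x + t *\<^sub>R v \<in> dcauchy f v" if t: "t \<notin> N" for t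
  proof -
    obtain l where "((\<lambda>s. (f (x + (t + s) *\<^sub>R v) - f (x + t *\<^sub>R v)) / s) \<longlongrightarrow> l) (at_right 0)"
      using lim[OF t] by blast
    then show ?thesis
      by (intro dcauchyI[of _ _ _ l]) (simp add: dquot_def algebra_simps)
  qed
  then have "{t \<in> space lborel. \<not> x + t *\<^sub>R v \<notin> - dcauchy f v} \<subseteq> N" by auto
  \<comment> \<open>The exceptional set on the line is only known to be Lebesgue null, hence the
    detour through the completed measure.\<close>
  moreover have "N \<in> null_sets lebesgue" using N by (simp add: negligible_iff_null_sets)
  ultimately have "AE t in lebesgue. x + t *\<^sub>R v \<notin> - dcauchy f v" by (intro AE_I') auto
  then show "AE t in lborel. x + t *\<^sub>R v \<notin> - dcauchy f v"
    by (simp add: AE_completion_iff)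
qed

lemma dquot_tendsto_ae:
  "AE x in lborel. (\<lambda>n. dquot f v (1 / Suc n) x) \<longlonglongrightarrow> dderiv f v x"
proof -
  have "AE x in lborel. x \<in> dcauchy f v"
    using dcauchy_ae[of v] by (rule AE_I') auto
  then show ?thesis
    by eventually_elim (rule filterlim_compose[OF dcauchyD inverse_Suc_at_right])
qed

end

lemma integrable_bounded_indicator:
  fixes A :: "'a::euclidean_space set" and c :: real
  assumes "A \<in> sets borel" "bounded A"
  shows "integrable lborel (\<lambda>x. indicator A x * c)"
  using assms emeasure_bounded_finite[of A] by (intro integrable_mult_left integrable_real_indicator) auto

context
  fixes f :: "'a::euclidean_space \<Rightarrow> real" and M :: real
  assumes lip: "\<And>x y. \<bar>f x - f y\<bar> \<le> M * norm (x - y)"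
begin

lemma dderiv_bound_ae: "AE x in lborel. \<bar>dderiv f v x\<bar> \<le> M * norm v"
  using dquot_tendsto_ae[OF lip, of v]
proof eventually_elim
  case (elim x)
  show ?case
    by (rule tendsto_upperbound[OF tendsto_rabs[OF elim]])
      (auto intro!: always_eventually dquot_bound[OF lip])
qed

lemma integral_dquot_tendsto:
  "(\<lambda>n. \<integral>x. indicator (cbox a b) x * dquot f v (1 / Suc n) x \<partial>lborel)
     \<longlonglongrightarrow> (\<integral>x. indicator (cbox a b) x * dderiv f v x \<partial>lborel)"
proof (rule integral_dominated_convergence)
  note [measurable] = dquot_meas[OF lip] dderiv_meas[OF lip]
  show "(\<lambda>x. indicator (cbox a b) x * dderiv f v x) \<in> borel_measurable lborel"
    "(\<lambda>x. indicator (cbox a b) x * dquot f v (1 / Suc n) x) \<in> borel_measurable lborel" for n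
    by measurable
  show "integrable lborel (\<lambda>x. indicator (cbox a b) x * (M * norm v))"
    by (rule integrable_bounded_indicator) auto
  show "AE x in lborel. (\<lambda>n. indicator (cbox a b) x * dquot f v (1 / Suc n) x)
      \<longlonglongrightarrow> indicator (cbox a b) x * dderiv f v x"
    using dquot_tendsto_ae[OF lip, of v] by eventually_elim (intro tendsto_intros)
  show "AE x in lborel. norm (indicator (cbox a b) x * dquot f v (1 / Suc n) x)
      \<le> indicator (cbox a b) x * (M * norm v)" for n
    by (auto simp: indicator_def intro!: dquot_bound[OF lip])
qed

lemma integrable_indicator_dquot:
  assumes "t > 0"
  shows "integrable lborel (\<lambda>x. indicator (cbox a b) x * dquot f v t (x + c))"
proof (rule Bochner_Integration.integrable_bound)
  note [measurable] = dquot_meas[OF lip]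
  show "integrable lborel (\<lambda>x. indicator (cbox a b) x * (M * norm v) :: real)"
    by (rule integrable_bounded_indicator) auto
  show "(\<lambda>x. indicator (cbox a b) x * dquot f v t (x + c)) \<in> borel_measurable lborel"
    by measurable
  show "AE x in lborel. norm (indicator (cbox a b) x * dquot f v t (x + c))
      \<le> norm (indicator (cbox a b) x * (M * norm v) :: real)"
    by (auto simp: indicator_def intro!: AE_I2 order_trans[OF dquot_bound[OF lip assms]])
qed

text \<open>The translation is moved from the quotient, whose limit is not continuous, to the box.\<close>

lemma integral_dquot_shift_tendsto:
  "(\<lambda>n. (\<integral>x. indicator (cbox a b) x * dquot f w (1 / Suc n) (x + (1 / Suc n) *\<^sub>R v) \<partial>lborel)
     - (\<integral>x. indicator (cbox a b) x * dquot f w (1 / Suc n) x \<partial>lborel)) \<longlonglongrightarrow> 0"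
proof -
  note [measurable] = dquot_meas[OF lip]
  let ?B = "cbox a b"
  let ?c = "\<lambda>n. (1 / real (Suc n)) *\<^sub>R v"
  have c_lim: "?c \<longlonglongrightarrow> 0"
    using tendsto_scaleR[OF LIMSEQ_Suc[OF lim_1_over_n[where 'a=real]] tendsto_const, of v] by simp
  have norm_c: "norm (?c n) \<le> norm v" for n
    by (simp add: divide_simps) (metis mult.commute mult_left_mono norm_ge_zero le_add_same_cancel1 of_nat_0_le_iff mult_1_right)
  have shift: "(\<integral>x. indicator ?B x * dquot f w t (x + c) \<partial>lborel)
      = (\<integral>x. indicator ?B (x - c) * dquot f w t x \<partial>lborel)" for c t
  proof -
    have "(\<integral>x. indicator ?B (x - c) * dquot f w t x \<partial>lborel)
        = (\<integral>x. indicator ?B (x - c) * dquot f w t x \<partial>distr lborel borel ((+) c))"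
      by (simp add: lborel_distr_plus)
    also have "\<dots> = (\<integral>x. indicator ?B x * dquot f w t (c + x) \<partial>lborel)"
      by (subst integral_distr) auto
    finally show ?thesis by (simp add: add.commute)
  qed
  obtain R where R: "?B \<subseteq> cball 0 R"
    using bounded_cbox[of a b] unfolding bounded_iff by (metis mem_cball_0 subsetI)
  \<comment> \<open>A ball containing the box and all its translates by \<open>?c n\<close>, for the
    dominating function.\<close>
  let ?C = "cball (0::'a) (R + norm v)"
  let ?d = "\<lambda>n x. (indicator ?B (x - ?c n) - indicator ?B x) * dquot f w (1 / Suc n) x :: real"
  have "(\<lambda>n. \<integral>x. ?d n x \<partial>lborel) \<longlonglongrightarrow> (\<integral>x. 0 \<partial>(lborel :: 'a measure))"
  proof (rule integral_dominated_convergence)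
    show "?d n \<in> borel_measurable lborel" for n by measurable
    show "integrable lborel (\<lambda>x. indicator ?C x * (M * norm w))"
      by (rule integrable_bounded_indicator) auto
    \<comment> \<open>Off its boundary, which is null by convexity, the indicator of the box is
      locally constant.\<close>
    have "frontier ?B \<in> null_sets lborel"
      using negligible_convex_frontier[OF convex_box(1), of a b]
      by (simp add: negligible_iff_null_sets null_sets_completion_iff)
    then have "AE x in lborel. x \<notin> frontier ?B" by (rule AE_not_in)
    then show "AE x in lborel. (\<lambda>n. ?d n x) \<longlonglongrightarrow> 0"
    proof eventually_elim
      case (elim x)
      have lim: "(\<lambda>n. x - ?c n) \<longlonglongrightarrow> x"
        using tendsto_diff[OF tendsto_const c_lim, of x] by simp
      have "\<forall>\<^sub>F n in sequentially. indicator ?B (x - ?c n) = (indicator ?B x :: real)"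
      proof (cases "x \<in> ?B")
        case True
        then have "x \<in> interior ?B" using elim by (auto simp: frontier_def closure_closed)
        then have "\<forall>\<^sub>F n in sequentially. x - ?c n \<in> interior ?B"
          by (intro topological_tendstoD[OF lim]) auto
        then show ?thesis
          by eventually_elim (use True interior_subset[of ?B] in auto)
      next
        case False
        have "\<forall>\<^sub>F n in sequentially. x - ?c n \<in> - ?B"
          by (rule topological_tendstoD[OF lim]) (use False closed_cbox in \<open>auto simp: open_Compl\<close>)
        then show ?thesis by eventually_elim (use False in auto)
      qed
      then have "\<forall>\<^sub>F n in sequentially. ?d n x = 0" by eventually_elim auto
      then show ?case by (rule tendsto_eventually)
    qed
    show "AE x in lborel. norm (?d n x) \<le> indicator ?C x * (M * norm w)" for n
    proof (rule AE_I2)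
      fix x
      have "x \<in> ?C" if "x \<in> ?B \<or> x - ?c n \<in> ?B"
      proof -
        have "norm x \<le> R \<or> norm (x - ?c n) \<le> R" using that R by auto
        then show ?thesis using norm_c[of n] norm_triangle_sub[of x "?c n"] norm_ge_zero[of v]
          unfolding mem_cball_0 by linarith
      qed
      moreover have "\<bar>dquot f w (1 / Suc n) x\<bar> \<le> M * norm w" by (rule dquot_bound[OF lip]) simp
      ultimately show "norm (?d n x) \<le> indicator ?C x * (M * norm w)"
        by (auto simp: indicator_def)
    qed
  qed simp
  moreover have "(\<integral>x. ?d n x \<partial>lborel) = (\<integral>x. indicator ?B x * dquot f w (1 / Suc n) (x + ?c n) \<partial>lborel)
     - (\<integral>x. indicator ?B x * dquot f w (1 / Suc n) x \<partial>lborel)" for n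
  proof -
    have "integrable lborel (\<lambda>x. indicator ?B x * dquot f w (1 / Suc n) (x + 0))"
      by (rule integrable_indicator_dquot) simp
    moreover have "integrable lborel (\<lambda>x. indicator ?B (x - ?c n) * dquot f w (1 / Suc n) x)"
    proof -
      have "indicator (cbox (a + ?c n) (b + ?c n)) x = (indicator ?B (x - ?c n) :: real)" for x
        by (auto simp: indicator_def mem_box algebra_simps)
      then show ?thesis
        using integrable_indicator_dquot[of "1 / Suc n" "a + ?c n" "b + ?c n" w 0] by simp
    qed
    ultimately show ?thesis
      unfolding shift by (subst Bochner_Integration.integral_diff[symmetric]) (auto simp: left_diff_distrib)
  qed
  ultimately show ?thesis by simp
qed

lemma dderiv_has_integral:
  "(dderiv f v has_integral (\<integral>x. indicator (cbox a b) x * dderiv f v x \<partial>lborel)) (cbox a b)"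
proof -
  note [measurable] = dderiv_meas[OF lip]
  have "integrable lborel (\<lambda>x. indicator (cbox a b) x * dderiv f v x)"
  proof (rule Bochner_Integration.integrable_bound)
    show "integrable lborel (\<lambda>x. indicator (cbox a b) x * (M * norm v) :: real)"
      by (rule integrable_bounded_indicator) auto
    show "AE x in lborel. norm (indicator (cbox a b) x * dderiv f v x)
        \<le> norm (indicator (cbox a b) x * (M * norm v) :: real)"
      using dderiv_bound_ae[of v] by eventually_elim (auto simp: indicator_def)
  qed measurable
  from has_integral_integral_lborel[OF this]
  have "((\<lambda>x. if x \<in> cbox a b then dderiv f v x else 0)
      has_integral (\<integral>x. indicator (cbox a b) x * dderiv f v x \<partial>lborel)) UNIV"
    by (rule has_integral_eq[rotated]) auto
  then show ?thesis by (simp only: has_integral_restrict_UNIV)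
qed

text \<open>The quotient for \<open>v + w\<close> splits into the one for \<open>v\<close> at
  \<open>x\<close> and the one for \<open>w\<close> at a shifted point, and the shift disappears
  only after integration. Equality of all box integrals then gives equality almost
  everywhere.\<close>

lemma dderiv_add_ae:
  obtains N where "negligible N" "\<And>x. x \<notin> N \<Longrightarrow> dderiv f (v + w) x = dderiv f v x + dderiv f w x"
proof -
  let ?I = "\<lambda>v a b. \<integral>x. indicator (cbox a b) x * dderiv f v x \<partial>lborel"
  have add: "?I (v + w) a b = ?I v a b + ?I w a b" for a b
  proof (rule LIMSEQ_unique)
    let ?J = "\<lambda>v n. \<integral>x. indicator (cbox a b) x * dquot f v (1 / Suc n) x \<partial>lborel"
    show "?J (v + w) \<longlonglongrightarrow> ?I (v + w) a b" by (rule integral_dquot_tendsto)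
    let ?K = "\<lambda>n. \<integral>x. indicator (cbox a b) x * dquot f w (1 / Suc n) (x + (1 / Suc n) *\<^sub>R v) \<partial>lborel"
    have "?J (v + w) n = ?J v n + ?J w n + (?K n - ?J w n)" for n
    proof -
      have "indicator (cbox a b) x * dquot f (v + w) (1 / Suc n) x
          = indicator (cbox a b) x * dquot f v (1 / Suc n) (x + 0)
          + indicator (cbox a b) x * dquot f w (1 / Suc n) (x + (1 / Suc n) *\<^sub>R v)" for x
        by (simp add: dquot_def indicator_def algebra_simps)
      then have "?J (v + w) n = (\<integral>x. indicator (cbox a b) x * dquot f v (1 / Suc n) (x + 0) \<partial>lborel) + ?K n"
        by (simp only:) (intro Bochner_Integration.integral_add integrable_indicator_dquot, auto)
      then show ?thesis by simp
    qed
    moreover have "(\<lambda>n. ?J v n + ?J w n + (?K n - ?J w n)) \<longlonglongrightarrow> ?I v a b + ?I w a b + 0"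
      by (intro tendsto_add integral_dquot_tendsto integral_dquot_shift_tendsto)
    ultimately show "?J (v + w) \<longlonglongrightarrow> ?I v a b + ?I w a b" by simp
  qed
  have "((\<lambda>x. dderiv f (v + w) x - (dderiv f v x + dderiv f w x)) has_integral 0) (cbox a b)" for a b
    using has_integral_diff[OF dderiv_has_integral[of "v + w" a b]
        has_integral_add[OF dderiv_has_integral[of v a b] dderiv_has_integral[of w a b]]] by (simp add: add)
  then obtain N where "negligible N" "\<And>x. x \<notin> N \<Longrightarrow> dderiv f (v + w) x - (dderiv f v x + dderiv f w x) = 0"
    by (rule negligible_nonzero_if_integrals_zero) blast
  then show thesis by (intro that[of N]) auto
qed

end

context
  fixes f :: "'a::euclidean_space \<Rightarrow> real" and M :: real
  assumes lip: "\<And>x y. \<bar>f x - f y\<bar> \<le> M * norm (x - y)"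
begin

lemma dderiv_zero: "dderiv f 0 x = 0"
  by (simp add: dderiv_def dquot_def)

lemma dderiv_scale_pos:
  assumes "x \<in> dcauchy f v" "c > 0"
  shows "dderiv f (c *\<^sub>R v) x = c * dderiv f v x"
proof -
  have "filterlim (\<lambda>t. c * t) (at_right 0) (at_right 0)"
    using filterlim_times_pos[of "\<lambda>t. t" 0 "at_right 0" c] assms(2) by (simp add: filterlim_ident)
  then have "((\<lambda>t. dquot f v (c * t) x) \<longlongrightarrow> dderiv f v x) (at_right 0)"
    by (rule filterlim_compose[OF dcauchyD[OF assms(1)]])
  then have "((\<lambda>t. c * dquot f v (c * t) x) \<longlongrightarrow> c * dderiv f v x) (at_right 0)"
    by (intro tendsto_intros)
  then have lim: "((\<lambda>t. dquot f (c *\<^sub>R v) t x) \<longlongrightarrow> c * dderiv f v x) (at_right 0)"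
    using assms(2) by (simp add: dquot_def mult.commute)
  have "((\<lambda>t. dquot f (c *\<^sub>R v) t x) \<longlongrightarrow> dderiv f (c *\<^sub>R v) x) (at_right 0)"
    by (rule dcauchyD[OF dcauchyI[OF lim]])
  then show ?thesis using lim by (rule tendsto_unique[rotated]) simp
qed

text \<open>The derivatives are one-sided, so a negative scalar is not a change of variable.
  Additivity for two opposite vectors, whose sum has derivative 0, reduces it to a positive
  one.\<close>

lemma dderiv_scale_ae:
  obtains N where "negligible N" "\<And>x. x \<notin> N \<Longrightarrow> dderiv f (c *\<^sub>R v) x = c * dderiv f v x"
proof -
  have neg: "negligible (- dcauchy f v)"
    using dcauchy_ae[OF lip, of v] by (simp add: negligible_iff_null_sets null_sets_completionI)
  obtain N where N: "negligible N"
    "\<And>x. x \<notin> N \<Longrightarrow> dderiv f (c *\<^sub>R v + (-c) *\<^sub>R v) x = dderiv f (c *\<^sub>R v) x + dderiv f ((-c) *\<^sub>R v) x"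
    using dderiv_add_ae[OF lip] by blast
  have "dderiv f (c *\<^sub>R v) x = c * dderiv f v x" if "x \<notin> - dcauchy f v \<union> N" for x
  proof (cases c "0::real" rule: linorder_cases)
    case less
    then have "dderiv f ((-c) *\<^sub>R v) x = (-c) * dderiv f v x"
      using that by (intro dderiv_scale_pos) auto
    then show ?thesis using N(2)[of x] that by (simp add: dderiv_zero)
  next
    case greater
    then show ?thesis using that by (intro dderiv_scale_pos) auto
  qed (simp add: dderiv_zero)
  then show thesis by (rule that[OF negligible_Un[OF neg N(1)]])
qed

lemma dderiv_linear_ae:
  obtains N where "negligible N"
    "\<And>x. x \<notin> N \<Longrightarrow> dderiv f v x = (\<Sum>i\<in>Basis. (v \<bullet> i) * dderiv f i x)"
proof -
  have "\<exists>N. negligible N \<and> (\<forall>x. x \<notin> N \<longrightarrow>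
      dderiv f (\<Sum>i\<in>A. (v \<bullet> i) *\<^sub>R i) x = (\<Sum>i\<in>A. (v \<bullet> i) * dderiv f i x))"
    if "finite A" for A
    using that
  proof (induction A rule: finite_induct)
    case empty
    then show ?case by (intro exI[of _ "{}"]) (simp add: dderiv_zero)
  next
    case (insert j A)
    then obtain N where N: "negligible N" "\<And>x. x \<notin> N \<Longrightarrow>
      dderiv f (\<Sum>i\<in>A. (v \<bullet> i) *\<^sub>R i) x = (\<Sum>i\<in>A. (v \<bullet> i) * dderiv f i x)" by blast
    obtain N1 where N1: "negligible N1" "\<And>x. x \<notin> N1 \<Longrightarrow>
      dderiv f ((v \<bullet> j) *\<^sub>R j + (\<Sum>i\<in>A. (v \<bullet> i) *\<^sub>R i)) x
        = dderiv f ((v \<bullet> j) *\<^sub>R j) x + dderiv f (\<Sum>i\<in>A. (v \<bullet> i) *\<^sub>R i) x"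
      using dderiv_add_ae[OF lip] by blast
    obtain N2 where N2: "negligible N2" "\<And>x. x \<notin> N2 \<Longrightarrow>
      dderiv f ((v \<bullet> j) *\<^sub>R j) x = (v \<bullet> j) * dderiv f j x"
      using dderiv_scale_ae by blast
    show ?case
      using N N1 N2 insert by (intro exI[of _ "N \<union> N1 \<union> N2"]) (auto intro: negligible_Un)
  qed
  from this[OF finite_Basis] show thesis using that by (auto simp: euclidean_representation)
qed

text \<open>A total derivative needs uniformity over directions: finitely many directions of
  \<open>D\<close> form a net of the compact unit sphere, and the Lipschitz bound controls the
  passage from a direction to its neighbour in the net.\<close>

lemma has_derivative_if_dense_directions:
  assumes dense: "\<And>X. open X \<Longrightarrow> X \<noteq> {} \<Longrightarrow> \<exists>d\<in>D. d \<in> X"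
    and "bounded_linear L"
    and lim: "\<And>v. v \<in> D \<Longrightarrow> ((\<lambda>t. dquot f v t x) \<longlongrightarrow> L v) (at_right 0)"
  shows "(f has_derivative L) (at x)"
proof -
  interpret L: bounded_linear L by fact
  obtain B where B: "B > 0" "\<And>v. \<bar>L v\<bar> \<le> B * norm v"
    using L.pos_bounded by (auto simp: mult.commute)
  have "\<exists>d>0. \<forall>y. norm (y - x) < d \<longrightarrow> norm (f y - f x - L (y - x)) \<le> e * norm (y - x)" if e: "e > 0" for e
  proof -
    define r where "r = e / (\<bar>M\<bar> + B + 1)"
    \<comment> \<open>The three summands of the denominator belong to three errors: changing the
      direction in \<open>f\<close>, changing it in \<open>L\<close>, and the quotient
      itself.\<close>
    have den: "\<bar>M\<bar> + B + 1 > 0" using B by linarith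
    have r: "r > 0" using e den by (simp add: r_def)
    have r_eq: "\<bar>M\<bar> * r + B * r + r = e"
    proof -
      have "(\<bar>M\<bar> + B + 1) * r = e" using den by (simp add: r_def)
      then show ?thesis by (simp add: distrib_right)
    qed
    have "sphere 0 1 \<subseteq> (\<Union>v\<in>D. ball v r)"
    proof
      fix u :: 'a
      obtain v where "v \<in> D" "v \<in> ball u r" using dense[of "ball u r"] r by auto
      then show "u \<in> (\<Union>v\<in>D. ball v r)" by (auto simp: dist_commute)
    qed
    with compactE_image[OF compact_sphere, of D "\<lambda>v. ball v r" 0 1]
    obtain C where C: "C \<subseteq> D" "finite C" "sphere (0::'a) 1 \<subseteq> (\<Union>v\<in>C. ball v r)" by auto
    have "\<forall>\<^sub>F t in at_right 0. \<forall>v\<in>C. dist (dquot f v t x) (L v) < r"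
      using C lim r by (intro eventually_ball_finite ballI tendstoD) auto
    then obtain d where "d > 0"
      and d: "\<And>t v. 0 < t \<Longrightarrow> t < d \<Longrightarrow> v \<in> C \<Longrightarrow> \<bar>dquot f v t x - L v\<bar> < r"
      unfolding eventually_at_right_field dist_real_def by blast
    have "\<bar>f y - f x - L (y - x)\<bar> \<le> e * norm (y - x)" if y: "norm (y - x) < d" for y
    proof (cases "y = x")
      case False
      define t where "t = norm (y - x)"
      define u where "u = (y - x) /\<^sub>R t"
      have t: "t > 0" "t < d" using False y by (auto simp: t_def)
      have y_eq: "y = x + t *\<^sub>R u" using t by (simp add: u_def)
      have "u \<in> sphere 0 1" using t by (simp add: u_def t_def)
      then obtain v where v: "v \<in> C" "norm (v - u) < r" using C(3) by (auto simp: dist_norm)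
      have "\<bar>f (x + t *\<^sub>R u) - f (x + t *\<^sub>R v)\<bar> \<le> M * norm (t *\<^sub>R u - t *\<^sub>R v)"
        using lip[of "x + t *\<^sub>R u" "x + t *\<^sub>R v"] by simp
      also have "\<dots> \<le> \<bar>M\<bar> * (t * norm (v - u))"
        using t by (simp add: mult_right_mono norm_minus_commute flip: scaleR_diff_right)
      also have "\<dots> \<le> \<bar>M\<bar> * (t * r)"
        using v t by (intro mult_left_mono) auto
      finally have 1: "\<bar>f (x + t *\<^sub>R u) - f (x + t *\<^sub>R v)\<bar> \<le> t * (\<bar>M\<bar> * r)" by (simp add: algebra_simps)
      have "f (x + t *\<^sub>R v) - f x - t * L v = t * (dquot f v t x - L v)"
        using t by (simp add: dquot_def field_simps)
      then have 2: "\<bar>f (x + t *\<^sub>R v) - f x - t * L v\<bar> \<le> t * r"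
        using d[OF t v(1)] t by (simp add: abs_mult)
      have "\<bar>t * L v - t * L u\<bar> = t * \<bar>L (v - u)\<bar>"
        using t by (simp add: L.diff abs_mult flip: right_diff_distrib)
      also have "\<dots> \<le> t * (B * norm (v - u))"
        using t by (intro mult_left_mono B) auto
      also have "\<dots> \<le> t * (B * r)"
        using t B v by (intro mult_left_mono) auto
      finally have 3: "\<bar>t * L v - t * L u\<bar> \<le> t * (B * r)" .
      have "\<bar>f y - f x - L (y - x)\<bar> \<le> t * (\<bar>M\<bar> * r) + t * r + t * (B * r)"
        using 1 2 3 by (simp add: y_eq L.scaleR)
      also have "\<dots> = e * t" by (simp add: algebra_simps flip: r_eq)
      finally show ?thesis by (simp add: t_def)
    qed (simp add: L.zero)
    then show ?thesis using \<open>d > 0\<close> by auto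
  qed
  then show ?thesis unfolding has_derivative_at_alt using assms(2) by blast
qed

lemma rademacher_real:
  obtains N where "negligible N" "\<And>x. x \<notin> N \<Longrightarrow> f differentiable (at x)"
proof -
  obtain D :: "'a set" where D: "countable D" "\<And>X. open X \<Longrightarrow> X \<noteq> {} \<Longrightarrow> \<exists>d\<in>D. d \<in> X"
    using countable_dense_setE by blast
  have "\<forall>v. \<exists>N. negligible N \<and> (\<forall>x. x \<notin> N \<longrightarrow> dderiv f v x = (\<Sum>i\<in>Basis. (v \<bullet> i) * dderiv f i x))"
    using dderiv_linear_ae by metis
  then obtain P where P: "\<And>v. negligible (P v)"
    "\<And>v x. x \<notin> P v \<Longrightarrow> dderiv f v x = (\<Sum>i\<in>Basis. (v \<bullet> i) * dderiv f i x)" by metis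
  \<comment> \<open>Countably many directions keep the union of the exceptional sets null.\<close>
  let ?N = "\<Union>v\<in>D. P v \<union> - dcauchy f v"
  have "negligible (- dcauchy f v)" for v
    using dcauchy_ae[OF lip, of v] by (simp add: negligible_iff_null_sets null_sets_completionI)
  then have "negligible (P v \<union> - dcauchy f v)" for v
    using P(1) by (intro negligible_Un)
  then have N: "negligible ?N"
    using D(1) by (intro negligible_countable_Union) auto
  show thesis
  proof (rule that[OF N])
    fix x assume x: "x \<notin> ?N"
    let ?L = "\<lambda>v. \<Sum>i\<in>Basis. (v \<bullet> i) * dderiv f i x"
    have "(f has_derivative ?L) (at x)"
    proof (rule has_derivative_if_dense_directions[OF D(2)])
      show "bounded_linear ?L"
        unfolding linear_conv_bounded_linear[symmetric]
        by (intro linearI) (simp_all add: algebra_simps sum.distrib sum_distrib_left)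
      show "((\<lambda>t. dquot f v t x) \<longlongrightarrow> ?L v) (at_right 0)" if "v \<in> D" for v
      proof -
        have "x \<in> dcauchy f v" "x \<notin> P v" using x that by auto
        then show ?thesis using dcauchyD P(2) by metis
      qed
    qed
    then show "f differentiable (at x)" by (auto simp: differentiable_def)
  qed
qed

end

theorem rademacher:
  fixes f :: "'a::euclidean_space \<Rightarrow> 'b::euclidean_space"
  assumes lip: "\<And>x y. norm (f x - f y) \<le> M * norm (x - y)"
  obtains N where "negligible N" "\<And>x. x \<notin> N \<Longrightarrow> f differentiable (at x)"
proof -
  have "\<exists>N. negligible N \<and> (\<forall>x. x \<notin> N \<longrightarrow> (\<lambda>x. f x \<bullet> i) differentiable (at x))" if "i \<in> Basis" for i
  proof -
    have "\<bar>f x \<bullet> i - f y \<bullet> i\<bar> \<le> M * norm (x - y)" for x y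
      using Basis_le_norm[OF that, of "f x - f y"] lip[of x y] by (simp add: inner_diff_left)
    then show ?thesis by (rule rademacher_real) blast
  qed
  then obtain P where P: "\<And>i. i \<in> Basis \<Longrightarrow> negligible (P i)"
    "\<And>i x. i \<in> Basis \<Longrightarrow> x \<notin> P i \<Longrightarrow> (\<lambda>x. f x \<bullet> i) differentiable (at x)" by metis
  have "negligible (\<Union>i\<in>Basis. P i)"
    using P(1) by (intro negligible_Union) auto
  then show thesis
    by (rule that) (use P(2) in \<open>auto simp: differentiable_componentwise_within[of f]\<close>)
qed

section \<open>Second-order differentiability of convex functions\<close>

lemma nonneg_if_nonneg_perturb:
  fixes a b :: real
  assumes "\<And>t. 0 < t \<Longrightarrow> t < 1 \<Longrightarrow> 0 \<le> a + t * b"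
  shows "0 \<le> a"
proof (rule tendsto_lowerbound)
  show "((\<lambda>t. a + t * b) \<longlongrightarrow> a) (at_right 0)"
  proof -
    have "((\<lambda>t. a + t * b) \<longlongrightarrow> a + 0 * b) (at_right 0)" by (intro tendsto_intros)
    then show ?thesis by simp
  qed
  show "\<forall>\<^sub>F t in at_right 0. 0 \<le> a + t * b"
    unfolding eventually_at_right_field using assms by (intro exI[of _ 1]) auto
qed simp

text \<open>On a mesh of size 1 / (n + 1) the quadratic terms add up to \<open>b\<close> / (n + 1),
  which vanishes in the limit. This integrates subgradients along a segment without any
  measurability question.\<close>

lemma telescope_bound:
  fixes \<rho> :: "real \<Rightarrow> real"
  assumes step: "\<And>s t. 0 \<le> s \<Longrightarrow> s < t \<Longrightarrow> t \<le> 1 \<Longrightarrow> \<bar>\<rho> t - \<rho> s\<bar> \<le> (t - s) * (a + b * (t - s))"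
  shows "\<bar>\<rho> 1 - \<rho> 0\<bar> \<le> a"
proof (rule tendsto_lowerbound)
  show "(\<lambda>n. a + b * (1 / real (Suc n))) \<longlonglongrightarrow> a"
    using tendsto_add[OF tendsto_const tendsto_mult[OF tendsto_const LIMSEQ_Suc[OF lim_1_over_n[where 'a=real]]], of a b] by simp
  have "\<bar>\<rho> 1 - \<rho> 0\<bar> \<le> a + b * (1 / real (Suc n))" for n
  proof -
    define m where "m = real (Suc n)"
    have m: "m > 0" by (simp add: m_def)
    have "\<rho> 1 - \<rho> 0 = (\<Sum>k<Suc n. \<rho> (real (Suc k) / m) - \<rho> (real k / m))"
      using sum_lessThan_telescope[of "\<lambda>k. \<rho> (real k / m)" "Suc n"] m by (simp add: m_def)
    also have "\<bar>\<dots>\<bar> \<le> (\<Sum>k<Suc n. (1 / m) * (a + b * (1 / m)))"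
    proof (rule order_trans[OF sum_abs sum_mono])
      fix k assume "k \<in> {..<Suc n}"
      then have "real (Suc k) / m \<le> 1" "real k / m < real (Suc k) / m"
        using m by (auto simp: m_def field_simps)
      moreover have "real (Suc k) / m - real k / m = 1 / m" by (simp add: diff_divide_distrib[symmetric])
      ultimately show "\<bar>\<rho> (real (Suc k) / m) - \<rho> (real k / m)\<bar> \<le> (1 / m) * (a + b * (1 / m))"
        using step[of "real k / m" "real (Suc k) / m"] m by simp
    qed
    also have "\<dots> = a + b * (1 / m)" using m by (simp add: m_def[symmetric] del: of_nat_Suc)
    finally show ?thesis by (simp add: m_def)
  qed
  then show "\<forall>\<^sub>F n in sequentially. \<bar>\<rho> 1 - \<rho> 0\<bar> \<le> a + b * (1 / real (Suc n))" by simp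
qed simp

definition subgrad :: "('a::real_inner \<Rightarrow> real) \<Rightarrow> 'a \<Rightarrow> 'a \<Rightarrow> bool" where
  "subgrad U x q \<longleftrightarrow> (\<forall>y. U x + q \<bullet> (y - x) \<le> U y)"

text \<open>A Peano expansion at the single point \<open>y\<close>; differentiability of
  \<open>U\<close> nearby is not presupposed.\<close>

definition second_order_at :: "('a::real_inner \<Rightarrow> real) \<Rightarrow> 'a \<Rightarrow> 'a \<Rightarrow> ('a \<Rightarrow> 'a) \<Rightarrow> bool" where
  "second_order_at U y q X \<longleftrightarrow> linear X \<and> (\<forall>a b. X a \<bullet> b = a \<bullet> X b) \<and>
     (\<forall>e>0. \<exists>r>0. \<forall>h. norm h < r \<longrightarrow>
        \<bar>U (y + h) - U y - q \<bullet> h - (h \<bullet> X h) / 2\<bar> \<le> e * (norm h)\<^sup>2)"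

lemma subgrad_monotone:
  assumes "subgrad U x p" "subgrad U y q"
  shows "0 \<le> (p - q) \<bullet> (x - y)"
proof -
  have "U x + p \<bullet> (y - x) \<le> U y" "U y + q \<bullet> (x - y) \<le> U x" using assms by (auto simp: subgrad_def)
  then show ?thesis by (simp add: inner_diff_left inner_diff_right)
qed

lemma norm_le_if_inner_le_sphere:
  fixes w :: "'a::real_inner"
  assumes "\<And>k. norm k = s \<Longrightarrow> w \<bullet> k \<le> c" "0 \<le> s" "w \<noteq> 0"
  shows "s * norm w \<le> c"
  using assms(1)[of "(s / norm w) *\<^sub>R w"] assms(2,3) by (simp add: dot_square_norm power2_eq_square)

text \<open>Test \<open>q'\<close> with increments of length |x - y|: the end point is within 2 |x -
  y| of \<open>y\<close>, so the quadratic term there is at most 4 C |x - y|^2.\<close>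

lemma subgrad_lipschitz_at_contact:
  assumes q': "subgrad U x q'" and q: "subgrad U y q"
    and upper: "\<And>x. U x \<le> U y + q \<bullet> (x - y) + C * (norm (x - y))\<^sup>2"
    and "x \<noteq> y"
  shows "norm (q' - q) \<le> 4 * C * norm (x - y)"
proof (cases "q' = q")
  case True
  have "U y + q \<bullet> (x - y) \<le> U y + q \<bullet> (x - y) + C * (norm (x - y))\<^sup>2"
    using q upper[of x] order_trans unfolding subgrad_def by blast
  then have "C * (norm (x - y))\<^sup>2 \<ge> 0" by simp
  then have "C \<ge> 0" using \<open>x \<noteq> y\<close> by (simp add: zero_le_mult_iff)
  then show ?thesis using True by simp
next
  case False
  define d where "d = norm (x - y)"
  have "d > 0" using assms(4) by (simp add: d_def)
  have C: "0 \<le> C * (norm (x' - y))\<^sup>2" for x'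
    using q upper[of x'] unfolding subgrad_def by (smt (verit))
  have "C \<ge> 0" using C[of x] assms(4) by (simp add: zero_le_mult_iff)
  have "d * norm (q' - q) \<le> C * (2 * d)\<^sup>2"
  proof (rule norm_le_if_inner_le_sphere)
    fix k :: 'a assume k: "norm k = d"
    have "U x + q' \<bullet> k \<le> U (x + k)" using q' unfolding subgrad_def by (metis add_diff_cancel_left')
    moreover have "U y + q \<bullet> (x - y) \<le> U x" using q by (auto simp: subgrad_def)
    moreover have "U (x + k) \<le> U y + q \<bullet> (x + k - y) + C * (norm (x + k - y))\<^sup>2" by (rule upper)
    ultimately have "(q' - q) \<bullet> k \<le> C * (norm (x + k - y))\<^sup>2"
      by (simp add: inner_diff_left inner_diff_right inner_add_right)
    also have "\<dots> \<le> C * (2 * d)\<^sup>2"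
      using norm_triangle_ineq[of "x - y" k] k \<open>C \<ge> 0\<close>
      by (intro mult_left_mono power_mono) (auto simp: d_def algebra_simps)
    finally show "(q' - q) \<bullet> k \<le> C * (2 * d)\<^sup>2" .
  qed (use False \<open>d > 0\<close> in auto)
  then have "d * norm (q' - q) \<le> d * (4 * C * d)" by (simp add: power2_eq_square algebra_simps)
  then show ?thesis using \<open>d > 0\<close> by (simp add: d_def)
qed

context
  fixes U :: "'a::euclidean_space \<Rightarrow> real"
  assumes sub: "\<And>x. \<exists>q. subgrad U x q"
begin

text \<open>The supporting plane at the intermediate point lies below both end points. Subgradients
  everywhere are assumed in place of convexity because sup-convolutions come with them.\<close>

lemma subgrad_convex: "convex_on UNIV U"
proof (rule convex_onI)
  fix t :: real and x y :: 'a
  assume t: "0 < t" "t < 1"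
  define z where "z = (1 - t) *\<^sub>R x + t *\<^sub>R y"
  obtain q where q: "subgrad U z q" using sub by blast
  have "U z + q \<bullet> (x - z) \<le> U x" "U z + q \<bullet> (y - z) \<le> U y" using q by (auto simp: subgrad_def)
  then have "(1 - t) * (U z + q \<bullet> (x - z)) + t * (U z + q \<bullet> (y - z)) \<le> (1 - t) * U x + t * U y"
    using t by (intro add_mono mult_left_mono) auto
  moreover have "(1 - t) * (U z + q \<bullet> (x - z)) + t * (U z + q \<bullet> (y - z))
      = U z + q \<bullet> ((1 - t) *\<^sub>R (x - z) + t *\<^sub>R (y - z))"
    by (simp add: inner_add_right algebra_simps)
  moreover have "(1 - t) *\<^sub>R (x - z) + t *\<^sub>R (y - z) = 0"
    by (simp add: z_def algebra_simps)
  ultimately show "U ((1 - t) *\<^sub>R x + t *\<^sub>R y) \<le> (1 - t) * U x + t * U y" by (simp add: z_def)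
qed simp

lemma subgrad_continuous: "continuous_on UNIV U"
  by (rule convex_on_continuous[OF open_UNIV subgrad_convex])

text \<open>Minimize \<open>U\<close> plus half the squared distance to \<open>z\<close>. Comparing
  the minimizer with points of a segment issuing from it and dividing by the segment parameter gives
  the subgradient inequality.\<close>

lemma resolvent_exists: "\<exists>y. subgrad U y (z - y)"
proof -
  define \<phi> where "\<phi> = (\<lambda>y. U y + (norm (y - z))\<^sup>2 / 2)"
  obtain q where q: "subgrad U z q" using sub by blast
  have cont: "continuous_on UNIV \<phi>"
    unfolding \<phi>_def by (intro continuous_intros subgrad_continuous) simp
  \<comment> \<open>Beyond the radius \<open>2 * norm q\<close> the quadratic term outweighs the
    slope of the supporting plane at \<open>z\<close>.\<close>
  have "\<exists>y\<in>cball z (2 * norm q). \<forall>x\<in>cball z (2 * norm q). \<phi> y \<le> \<phi> x"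
    by (rule continuous_attains_inf) (auto intro: continuous_on_subset[OF cont])
  then obtain y where y: "\<And>x. x \<in> cball z (2 * norm q) \<Longrightarrow> \<phi> y \<le> \<phi> x" by blast
  have min: "\<phi> y \<le> \<phi> x" for x
  proof (cases "x \<in> cball z (2 * norm q)")
    case False
    then have "2 * norm q \<le> norm (x - z)" by (simp add: dist_norm norm_minus_commute)
    then have "norm q * norm (x - z) \<le> (norm (x - z))\<^sup>2 / 2"
      using mult_right_mono[of "2 * norm q" "norm (x - z)" "norm (x - z)"] by (simp add: power2_eq_square)
    moreover have "- (q \<bullet> (x - z)) \<le> norm q * norm (x - z)"
      using Cauchy_Schwarz_ineq2[of q "x - z"] by linarith
    moreover have "U z + q \<bullet> (x - z) \<le> U x" using q by (auto simp: subgrad_def)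
    ultimately have "\<phi> z \<le> \<phi> x" by (simp add: \<phi>_def)
    then show ?thesis using y[of z] by simp
  qed (rule y)
  have "U y + (z - y) \<bullet> (x - y) \<le> U x" for x
  proof -
    have "0 \<le> U x - U y + (y - z) \<bullet> (x - y)"
    proof (rule nonneg_if_nonneg_perturb)
      fix t :: real assume t: "0 < t" "t < 1"
      have "U ((1 - t) *\<^sub>R y + t *\<^sub>R x) \<le> (1 - t) * U y + t * U x"
        using convex_onD[OF subgrad_convex, of t y x] t by simp
      moreover have "\<phi> y \<le> \<phi> ((1 - t) *\<^sub>R y + t *\<^sub>R x)" by (rule min)
      moreover have "(norm ((1 - t) *\<^sub>R y + t *\<^sub>R x - z))\<^sup>2
          = (norm (y - z))\<^sup>2 + 2 * t * ((y - z) \<bullet> (x - y)) + t\<^sup>2 * (norm (x - y))\<^sup>2"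
      proof -
        have "(1 - t) *\<^sub>R y + t *\<^sub>R x - z = (y - z) + t *\<^sub>R (x - y)" by (simp add: algebra_simps)
        then show ?thesis
          by (simp only: power2_norm_eq_inner inner_add_left inner_add_right inner_scaleR_left inner_scaleR_right)
            (simp add: inner_commute power2_eq_square distrib_left mult.assoc)
      qed
      ultimately have "0 \<le> t * (U x - U y) + t * ((y - z) \<bullet> (x - y)) + t\<^sup>2 * (norm (x - y))\<^sup>2 / 2"
        by (simp add: \<phi>_def algebra_simps)
      then have "0 \<le> t * (U x - U y + (y - z) \<bullet> (x - y) + t * ((norm (x - y))\<^sup>2 / 2))"
        by (simp add: algebra_simps power2_eq_square)
      then show "0 \<le> U x - U y + (y - z) \<bullet> (x - y) + t * ((norm (x - y))\<^sup>2 / 2)"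
        using t by (simp add: zero_le_mult_iff)
    qed
    then show ?thesis by (simp add: inner_diff_left)
  qed
  then show ?thesis by (auto simp: subgrad_def)
qed

definition resolvent :: "'a \<Rightarrow> 'a" where
  "resolvent z = (SOME y. subgrad U y (z - y))"

lemma subgrad_resolvent: "subgrad U (resolvent z) (z - resolvent z)"
  unfolding resolvent_def by (rule someI_ex[OF resolvent_exists])

text \<open>Monotonicity of subgradients and Cauchy-Schwarz. The factor 1 fits the hypothesis of
  \<open>rademacher\<close>.\<close>

lemma resolvent_nonexpansive: "norm (resolvent x - resolvent y) \<le> 1 * norm (x - y)"
proof -
  let ?d = "resolvent x - resolvent y"
  have "0 \<le> ((x - resolvent x) - (y - resolvent y)) \<bullet> ?d"
    by (rule subgrad_monotone[OF subgrad_resolvent subgrad_resolvent])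
  also have "((x - resolvent x) - (y - resolvent y)) = (x - y) - ?d" by simp
  finally have "?d \<bullet> ?d \<le> (x - y) \<bullet> ?d" by (simp add: inner_diff_left)
  then have "norm ?d * norm ?d \<le> norm (x - y) * norm ?d"
    using norm_cauchy_schwarz[of "x - y" ?d] by (simp add: dot_square_norm power2_eq_square)
  then show ?thesis by (cases "?d = 0") auto
qed

text \<open>Monotonicity makes the solution of the resolvent inclusion unique, so the arbitrary
  choice in \<open>resolvent\<close> is no choice.\<close>

lemma resolvent_eq:
  assumes "subgrad U y q"
  shows "resolvent (y + q) = y"
proof -
  have "0 \<le> (q - (y + q - resolvent (y + q))) \<bullet> (y - resolvent (y + q))"
    by (rule subgrad_monotone[OF assms subgrad_resolvent])
  then have "(y - resolvent (y + q)) \<bullet> (y - resolvent (y + q)) \<le> 0"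
    by (simp add: inner_diff_left)
  then have "(y - resolvent (y + q)) \<bullet> (y - resolvent (y + q)) = 0"
    by (intro antisym) auto
  then show ?thesis by simp
qed

text \<open>At a contact point with an upper paraboloid the subgradients near \<open>y\<close> are pairs
  \<open>(y + h, q + k - h)\<close> with \<open>\<bar>k\<bar> = O(\<bar>h\<bar>)\<close>, and the resolvent maps \<open>y + q + k\<close> to \<open>y + h\<close>. Inverting its
  derivative at \<open>y + q\<close> differentiates the subgradient.\<close>

lemma subgrad_differentiable_at_contact:
  assumes q: "subgrad U y q"
    and upper: "\<And>x. U x \<le> U y + q \<bullet> (x - y) + C * (norm (x - y))\<^sup>2"
    and diff: "resolvent differentiable (at (y + q))"
  obtains X where "linear X"
    "\<And>e. e > 0 \<Longrightarrow> \<exists>r>0. \<forall>h q'. norm h < r \<longrightarrow> subgrad U (y + h) q' \<longrightarrow> h \<noteq> 0 \<longrightarrow>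
       norm (q' - q - X h) \<le> e * norm h"
proof -
  obtain A where A: "(resolvent has_derivative A) (at (y + q))"
    using diff by (auto simp: differentiable_def)
  have linA: "linear A" using A has_derivative_linear by blast
  \<comment> \<open>The argument of the resolvent moves by \<open>h + (q' - q)\<close>, of norm at
    most |h| + 4 |C| |h| by the estimate at a contact point.\<close>
  define D where "D = 1 + 4 * \<bar>C\<bar>"
  have D: "D > 0" by (simp add: D_def)
  have k_bound: "norm (h + (q' - q)) \<le> D * norm h" if "subgrad U (y + h) q'" "h \<noteq> 0" for h q'
  proof -
    have "norm (q' - q) \<le> 4 * C * norm h"
      using subgrad_lipschitz_at_contact[OF that(1) q upper] that(2) by simp
    also have "\<dots> \<le> 4 * \<bar>C\<bar> * norm h" by (intro mult_right_mono) auto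
    finally show ?thesis using norm_triangle_ineq[of h "q' - q"] by (simp add: D_def algebra_simps)
  qed
  have approx: "\<exists>r>0. \<forall>h q'. norm h < r \<longrightarrow> subgrad U (y + h) q' \<longrightarrow> h \<noteq> 0 \<longrightarrow>
      norm (h - A (h + (q' - q))) \<le> e * norm h" if "e > 0" for e
  proof -
    have "e / D > 0" using that D by simp
    then obtain d where "d > 0" and d: "\<And>x. norm (x - (y + q)) < d \<Longrightarrow>
        norm (resolvent x - resolvent (y + q) - A (x - (y + q))) \<le> e / D * norm (x - (y + q))"
      using A unfolding has_derivative_at_alt by blast
    have "norm (h - A (h + (q' - q))) \<le> e * norm h"
      if h: "norm h < d / D" "subgrad U (y + h) q'" "h \<noteq> 0" for h q'
    proof -
      let ?k = "h + (q' - q)"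
      have k: "norm ?k \<le> D * norm h" by (rule k_bound[OF h(2,3)])
      have eq: "(y + h) + q' - (y + q) = ?k" by simp
      have "norm ?k < d" using k h(1) D by (simp add: field_simps)
      then have "norm (resolvent ((y + h) + q') - resolvent (y + q) - A ?k) \<le> e / D * norm ?k"
        using d[of "(y + h) + q'"] unfolding eq by simp
      moreover have "resolvent ((y + h) + q') - resolvent (y + q) = h"
        by (simp only: resolvent_eq[OF h(2)] resolvent_eq[OF q]) simp
      ultimately have "norm (h - A ?k) \<le> e / D * norm ?k" by simp
      also have "\<dots> \<le> e / D * (D * norm h)"
        using k \<open>e / D > 0\<close> by (intro mult_left_mono) auto
      finally show ?thesis using D by simp
    qed
    then show ?thesis using \<open>d > 0\<close> D by (intro exI[of _ "d / D"]) auto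
  qed
  \<comment> \<open>Every \<open>h\<close> is a limit of values of \<open>A\<close>: apply the
    approximation to a short multiple of \<open>h\<close> and rescale by linearity. The range is a
    subspace, hence closed.\<close>
  have "surj A"
  proof -
    have sub_range: "subspace (range A)"
      by (rule linear_subspace_image[OF linA subspace_UNIV])
    have "h \<in> range A" for h
    proof (cases "h = 0")
      case True
      then show ?thesis using linear_0[OF linA] by (metis rangeI)
    next
      case False
      have "h \<in> closure (range A)"
        unfolding closure_approachable
      proof (intro allI impI)
        fix e :: real assume "e > 0"
        then have "e / (2 * norm h) > 0" using False by simp
        from approx[OF this] obtain r where "r > 0" and r: "\<And>h' q'. norm h' < r \<Longrightarrow>
          subgrad U (y + h') q' \<Longrightarrow> h' \<noteq> 0 \<Longrightarrow> norm (h' - A (h' + (q' - q))) \<le> e / (2 * norm h) * norm h'"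
          by blast
        define t where "t = r / (2 * norm h)"
        have t: "t > 0" "norm (t *\<^sub>R h) < r" using \<open>r > 0\<close> False by (auto simp: t_def)
        obtain q' where "subgrad U (y + t *\<^sub>R h) q'" using sub by blast
        from r[OF t(2) this] False t(1)
        have "norm (t *\<^sub>R h - A (t *\<^sub>R h + (q' - q))) \<le> e / 2 * t" by simp
        moreover have "t *\<^sub>R h - A (t *\<^sub>R h + (q' - q)) = t *\<^sub>R (h - A ((1 / t) *\<^sub>R (t *\<^sub>R h + (q' - q))))"
          using t(1) by (simp add: linear_scale[OF linA] scaleR_diff_right)
        ultimately have "t * norm (h - A ((1 / t) *\<^sub>R (t *\<^sub>R h + (q' - q)))) \<le> t * (e / 2)"
          using t(1) by (simp add: mult.commute)
        then have "norm (h - A ((1 / t) *\<^sub>R (t *\<^sub>R h + (q' - q)))) \<le> e / 2" using t(1) by simp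
        then have "dist (A ((1 / t) *\<^sub>R (t *\<^sub>R h + (q' - q)))) h < e"
          using \<open>e > 0\<close> by (simp add: dist_norm norm_minus_commute)
        then show "\<exists>w\<in>range A. dist w h < e" by blast
      qed
      then show ?thesis using closed_subspace[OF sub_range] by simp
    qed
    then show ?thesis by auto
  qed
  then obtain B where B: "linear B" "B \<circ> A = id"
    using linear_surjective_isomorphism[OF linA] by (auto simp: fun_eq_iff)
  have BA: "B (A w) = w" for w using B(2) by (simp add: fun_eq_iff)
  obtain \<beta> where \<beta>: "\<beta> > 0" "\<And>w. norm (B w) \<le> \<beta> * norm w"
    using linear_bounded_pos[OF B(1)] by blast
  show thesis
  \<comment> \<open>Since \<open>h + (q' - q)\<close> is close to \<open>B h\<close>, the increment
    \<open>q' - q\<close> is close to \<open>B h - h\<close>.\<close>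
  proof (rule that[of "\<lambda>h. B h - h"])
    show "linear (\<lambda>h. B h - h)" by (intro linear_compose_sub B(1) linear_id[unfolded id_def])
    fix e :: real assume "e > 0"
    then have "e / \<beta> > 0" using \<beta> by simp
    from approx[OF this] obtain r where "r > 0" and r: "\<And>h q'. norm h < r \<Longrightarrow>
      subgrad U (y + h) q' \<Longrightarrow> h \<noteq> 0 \<Longrightarrow> norm (h - A (h + (q' - q))) \<le> e / \<beta> * norm h"
      by blast
    have "norm (q' - q - (B h - h)) \<le> e * norm h"
      if h: "norm h < r" "subgrad U (y + h) q'" "h \<noteq> 0" for h q'
    proof -
      have "B (h - A (h + (q' - q))) = - (q' - q - (B h - h))"
        by (simp add: linear_diff[OF B(1)] BA)
      then have "norm (q' - q - (B h - h)) = norm (B (h - A (h + (q' - q))))"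
        by (metis norm_minus_cancel)
      also have "\<dots> \<le> \<beta> * (e / \<beta> * norm h)"
        using \<beta> r[OF h] by (meson mult_left_mono order_trans less_imp_le)
      finally show ?thesis using \<beta> by simp
    qed
    then show "\<exists>r>0. \<forall>h q'. norm h < r \<longrightarrow> subgrad U (y + h) q' \<longrightarrow> h \<noteq> 0 \<longrightarrow>
       norm (q' - q - (B h - h)) \<le> e * norm h" using \<open>r > 0\<close> by blast
  qed
qed

text \<open>The first-order expansion of the subgradients is integrated along the segment from
  \<open>y\<close>: an increment of \<open>U\<close> lies between its products with subgradients at
  the two ends.\<close>

lemma second_order_expansion_at_contact:
  assumes q: "subgrad U y q"
    and upper: "\<And>x. U x \<le> U y + q \<bullet> (x - y) + C * (norm (x - y))\<^sup>2"
    and diff: "resolvent differentiable (at (y + q))"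
  shows "\<exists>X. second_order_at U y q X"
proof -
  obtain Y where Y: "linear Y" and approx: "\<And>e. e > 0 \<Longrightarrow> \<exists>r>0. \<forall>h q'. norm h < r \<longrightarrow>
      subgrad U (y + h) q' \<longrightarrow> h \<noteq> 0 \<longrightarrow> norm (q' - q - Y h) \<le> e * norm h"
    by (rule subgrad_differentiable_at_contact[OF assms]) blast
  \<comment> \<open>\<open>Y\<close> is not known to be symmetric. The expansion sees only its
    quadratic form, so the symmetric part serves.\<close>
  define X where "X = (\<lambda>h. (1/2) *\<^sub>R (Y h + adjoint Y h))"
  have adj: "a \<bullet> adjoint Y b = Y a \<bullet> b" "adjoint Y b \<bullet> a = Y a \<bullet> b" for a b
    using adjoint_works[OF Y] by (auto simp: inner_commute)
  have quad: "h \<bullet> X h = h \<bullet> Y h" for h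
    by (simp add: X_def inner_add_right adj inner_commute)
  show ?thesis
    unfolding second_order_at_def
  proof (intro exI[of _ X] conjI allI impI)
    show "linear X" unfolding X_def
      by (intro linear_compose_scale_right linear_compose_add Y adjoint_linear)
    show "X a \<bullet> b = a \<bullet> X b" for a b
      by (simp add: X_def inner_add_right inner_add_left adj inner_commute)
    fix e :: real assume "e > 0"
    from approx[OF this] obtain r where "r > 0" and r: "\<And>h q'. norm h < r \<Longrightarrow>
      subgrad U (y + h) q' \<Longrightarrow> h \<noteq> 0 \<Longrightarrow> norm (q' - q - Y h) \<le> e * norm h" by blast
    have "\<bar>U (y + h) - U y - q \<bullet> h - (h \<bullet> X h) / 2\<bar> \<le> e * (norm h)\<^sup>2" if h: "norm h < r" for h
    proof (cases "h = 0")
      case False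
      \<comment> \<open>The remainder along the segment, to be estimated by
        \<open>telescope_bound\<close>; the error \<open>a\<close> is the one claimed, and
        \<open>b\<close> is |\<open>h \<bullet> Y h\<close>|.\<close>
      define \<rho> where "\<rho> = (\<lambda>t. U (y + t *\<^sub>R h) - t * (q \<bullet> h) - t\<^sup>2 / 2 * (h \<bullet> Y h))"
      define a where "a = e * (norm h)\<^sup>2"
      have incr: "\<bar>(q' - q) \<bullet> h - t * (h \<bullet> Y h)\<bar> \<le> a"
        if t: "0 \<le> t" "t \<le> 1" and q': "subgrad U (y + t *\<^sub>R h) q'" "t = 0 \<Longrightarrow> q' = q" for t q'
      proof (cases "t = 0")
        case True
        then show ?thesis using q' \<open>e > 0\<close> by (simp add: a_def)
      next
        case False
        have "norm (t *\<^sub>R h) \<le> norm h" using t by (simp add: mult_left_le_one_le)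
        then have "norm (t *\<^sub>R h) < r" using h by linarith
        then have "norm (q' - q - Y (t *\<^sub>R h)) \<le> e * norm (t *\<^sub>R h)"
          using r[OF _ q'(1)] False \<open>h \<noteq> 0\<close> by simp
        also have "\<dots> \<le> e * norm h" using \<open>norm (t *\<^sub>R h) \<le> norm h\<close> \<open>e > 0\<close> by simp
        finally have "norm (q' - q - Y (t *\<^sub>R h)) * norm h \<le> a"
          by (simp add: a_def power2_eq_square mult_right_mono flip: mult.assoc)
        moreover have "(q' - q - Y (t *\<^sub>R h)) \<bullet> h = (q' - q) \<bullet> h - t * (h \<bullet> Y h)"
          by (simp add: inner_diff_left linear_scale[OF Y] inner_commute[of "Y h"])
        ultimately show ?thesis
          using Cauchy_Schwarz_ineq2[of "q' - q - Y (t *\<^sub>R h)" h] by simp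
      qed
      have "\<bar>\<rho> 1 - \<rho> 0\<bar> \<le> a"
      proof (rule telescope_bound)
        fix s t :: real assume st: "0 \<le> s" "s < t" "t \<le> 1"
        obtain qt where qt: "subgrad U (y + t *\<^sub>R h) qt" using sub by blast
        \<comment> \<open>At \<open>s = 0\<close> the given \<open>q\<close> has to be taken,
          because \<open>approx\<close> excludes the increment 0.\<close>
        obtain qs where qs: "subgrad U (y + s *\<^sub>R h) qs" "s = 0 \<Longrightarrow> qs = q"
          using sub q by (cases "s = 0") auto
        let ?Y = "h \<bullet> Y h"
        have "U (y + t *\<^sub>R h) + qt \<bullet> ((y + s *\<^sub>R h) - (y + t *\<^sub>R h)) \<le> U (y + s *\<^sub>R h)"
          "U (y + s *\<^sub>R h) + qs \<bullet> ((y + t *\<^sub>R h) - (y + s *\<^sub>R h)) \<le> U (y + t *\<^sub>R h)"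
          using qt qs(1) unfolding subgrad_def by blast+
        then have U_up: "U (y + t *\<^sub>R h) - U (y + s *\<^sub>R h) \<le> (t - s) * (qt \<bullet> h)"
          and U_lo: "(t - s) * (qs \<bullet> h) \<le> U (y + t *\<^sub>R h) - U (y + s *\<^sub>R h)"
          by (auto simp: inner_diff_right algebra_simps)
        have \<rho>_eq: "\<rho> t - \<rho> s = (U (y + t *\<^sub>R h) - U (y + s *\<^sub>R h)) - (t - s) * (q \<bullet> h) - (t - s) * ((t + s) / 2 * ?Y)"
          by (simp add: \<rho>_def power2_eq_square field_simps)
        \<comment> \<open>Here \<open>c\<close> is one of the end parameters; replacing it by the
          midpoint costs at most |\<open>h \<bullet> Y h\<close>| times the mesh.\<close>
        have slope: "\<bar>q' \<bullet> h - q \<bullet> h - (t + s) / 2 * ?Y\<bar> \<le> a + \<bar>?Y\<bar> * (t - s)"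
          if "\<bar>(q' - q) \<bullet> h - c * ?Y\<bar> \<le> a" "\<bar>c - (t + s) / 2\<bar> \<le> t - s" for q' c
        proof -
          have "q' \<bullet> h - q \<bullet> h - (t + s) / 2 * ?Y = ((q' - q) \<bullet> h - c * ?Y) + (c - (t + s) / 2) * ?Y"
            by (simp add: inner_diff_left left_diff_distrib)
          moreover have "\<bar>(c - (t + s) / 2) * ?Y\<bar> \<le> \<bar>?Y\<bar> * (t - s)"
            unfolding abs_mult mult.commute[of "\<bar>?Y\<bar>"] by (rule mult_right_mono[OF that(2)]) simp
          ultimately show ?thesis using that(1) by linarith
        qed
        have "\<rho> t - \<rho> s \<le> (t - s) * (qt \<bullet> h - q \<bullet> h - (t + s) / 2 * ?Y)"
          using U_up by (simp add: \<rho>_eq algebra_simps)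
        also have "\<dots> \<le> (t - s) * (a + \<bar>?Y\<bar> * (t - s))"
          using slope[OF incr[of t qt]] st qt by (intro mult_left_mono) (auto simp: abs_le_iff)
        finally have upper: "\<rho> t - \<rho> s \<le> (t - s) * (a + \<bar>?Y\<bar> * (t - s))" .
        have "- ((t - s) * (a + \<bar>?Y\<bar> * (t - s))) = (t - s) * (- (a + \<bar>?Y\<bar> * (t - s)))" by (simp only: mult_minus_right)
        also have "\<dots> \<le> (t - s) * (qs \<bullet> h - q \<bullet> h - (t + s) / 2 * ?Y)"
          using slope[OF incr[of s qs]] st qs by (intro mult_left_mono) (auto simp: abs_le_iff)
        also have "\<dots> \<le> \<rho> t - \<rho> s"
          using U_lo by (simp add: \<rho>_eq algebra_simps)
        finally show "\<bar>\<rho> t - \<rho> s\<bar> \<le> (t - s) * (a + \<bar>?Y\<bar> * (t - s))" using upper by linarith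
      qed
      then show ?thesis by (simp add: \<rho>_def a_def quad)
    qed simp
    then show "\<exists>r>0. \<forall>h. norm h < r \<longrightarrow> \<bar>U (y + h) - U y - q \<bullet> h - (h \<bullet> X h) / 2\<bar> \<le> e * (norm h)\<^sup>2"
      using \<open>r > 0\<close> by blast
  qed
qed

text \<open>A point \<open>y\<close> with subgradient \<open>q\<close> is the resolvent of
  \<open>y + q\<close>, so bad points lie in the image of a null set under a nonexpansive map. The
  null set does not depend on \<open>C\<close>, which may vary with the point.\<close>

lemma alexandrov_at_contact:
  "\<exists>N. negligible N \<and> (\<forall>y q C. y \<notin> N \<longrightarrow> subgrad U y q \<longrightarrow>
      (\<forall>x. U x \<le> U y + q \<bullet> (x - y) + C * (norm (x - y))\<^sup>2) \<longrightarrow> (\<exists>X. second_order_at U y q X))"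
proof -
  obtain N where N: "negligible N" "\<And>x. x \<notin> N \<Longrightarrow> resolvent differentiable (at x)"
    using rademacher[OF resolvent_nonexpansive] by blast
  show ?thesis
  proof (intro exI[of _ "resolvent ` N"] conjI allI impI)
    show "negligible (resolvent ` N)"
    proof (rule negligible_locally_Lipschitz_image[OF order_refl N(1)])
      show "\<exists>T B. open T \<and> x \<in> T \<and> (\<forall>y\<in>N \<inter> T. norm (resolvent y - resolvent x) \<le> B * norm (y - x))" for x
        using resolvent_nonexpansive by (intro exI[of _ UNIV] exI[of _ 1]) auto
    qed
    fix y q C assume y: "y \<notin> resolvent ` N" and q: "subgrad U y q"
      and upper: "\<forall>x. U x \<le> U y + q \<bullet> (x - y) + C * (norm (x - y))\<^sup>2"
    have "y + q \<notin> N" using y resolvent_eq[OF q] by (metis imageI)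
    then show "\<exists>X. second_order_at U y q X"
      by (rule second_order_expansion_at_contact[OF q upper[rule_format] N(2)])
  qed
qed

end

section \<open>Sup-convolutions and the theorem on sums\<close>

lemma upper_semicont_on_subset:
  "upper_semicont_on S F \<Longrightarrow> S' \<subseteq> S \<Longrightarrow> upper_semicont_on S' F"
  unfolding upper_semicont_on_def by (meson at_le filter_leD subsetD)

lemma upper_semicont_on_add_continuous:
  assumes "upper_semicont_on S F" "continuous_on S G"
  shows "upper_semicont_on S (\<lambda>x. F x + G x)"
  unfolding upper_semicont_on_def
proof (intro ballI allI impI)
  fix z r assume z: "z \<in> S" "F z + G z < r"
  define e where "e = (r - F z - G z) / 2"
  have e: "F z < F z + e" "G z < G z + e" using z by (auto simp: e_def)
  have "\<forall>\<^sub>F y in at z within S. F y < F z + e"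
    using assms(1) z e unfolding upper_semicont_on_def by blast
  moreover have "\<forall>\<^sub>F y in at z within S. G y < G z + e"
    using assms(2) z e by (auto simp: continuous_on_def order_tendsto_iff)
  ultimately show "\<forall>\<^sub>F y in at z within S. F y + G y < r"
    by eventually_elim (simp add: e_def field_simps)
qed

text \<open>Without a maximum each \<open>z\<close> has a better point \<open>s z\<close>, which
  beats a whole neighbourhood of \<open>z\<close>. The best of these points for a finite subcover
  lies in one of the neighbourhoods and is beaten in turn.\<close>

lemma upper_semicont_on_attains_sup:
  assumes usc: "upper_semicont_on S F" and "compact S" "S \<noteq> {}"
  shows "\<exists>z\<in>S. \<forall>y\<in>S. F y \<le> F z"
proof (rule ccontr)
  assume "\<not> ?thesis"
  then obtain s where s: "\<And>z. z \<in> S \<Longrightarrow> s z \<in> S" "\<And>z. z \<in> S \<Longrightarrow> F z < F (s z)"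
    by (metis linorder_not_le)
  have "\<exists>T. open T \<and> z \<in> T \<and> (\<forall>y\<in>T \<inter> S. F y < F (s z))" if "z \<in> S" for z
  proof -
    have "\<forall>\<^sub>F y in at z within S. F y < F (s z)"
      using usc s(2) that unfolding upper_semicont_on_def by blast
    then obtain T where T: "open T" "z \<in> T" "\<forall>y\<in>T. y \<noteq> z \<longrightarrow> y \<in> S \<longrightarrow> F y < F (s z)"
      unfolding eventually_at_topological by blast
    moreover have "F z < F (s z)" by (rule s(2)[OF that])
    ultimately show ?thesis by (intro exI[of _ T]) (metis IntE)
  qed
  then obtain T where T: "\<And>z. z \<in> S \<Longrightarrow> open (T z)" "\<And>z. z \<in> S \<Longrightarrow> z \<in> T z"
    "\<And>z y. z \<in> S \<Longrightarrow> y \<in> T z \<Longrightarrow> y \<in> S \<Longrightarrow> F y < F (s z)" by (metis IntI)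
  have "S \<subseteq> (\<Union>z\<in>S. T z)" using T(2) by blast
  then obtain D where D: "D \<subseteq> S" "finite D" "S \<subseteq> (\<Union>z\<in>D. T z)"
    using compactE_image[OF \<open>compact S\<close>, of S T] T(1) by blast
  have "D \<noteq> {}" using D(3) \<open>S \<noteq> {}\<close> by auto
  define m where "m = Max ((\<lambda>z. F (s z)) ` D)"
  have "m \<in> (\<lambda>z. F (s z)) ` D" using D(2) \<open>D \<noteq> {}\<close> unfolding m_def by (intro Max_in) auto
  then obtain z where z: "z \<in> D" "F (s z) = m" by auto
  obtain z' where z': "z' \<in> D" "s z \<in> T z'" using D s(1) z(1) by blast
  then have "F (s z) < F (s z')" using T(3) D(1) s(1) z(1) by blast
  moreover have "F (s z') \<le> m" unfolding m_def using D(2) z'(1) by auto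
  ultimately show False using z(2) by simp
qed

lemma upper_semicont_on_attains_sup_coercive:
  fixes F :: "'a::heine_borel \<Rightarrow> real"
  assumes usc: "upper_semicont_on Q F" and "closed Q" "z0 \<in> Q"
    and bdd: "bounded {z\<in>Q. F z0 \<le> F z}"
  shows "\<exists>z\<in>Q. \<forall>y\<in>Q. F y \<le> F z"
proof -
  obtain e where e: "{z\<in>Q. F z0 \<le> F z} \<subseteq> cball z0 e" "e \<ge> 0"
  proof -
    obtain e where "\<forall>y\<in>{z\<in>Q. F z0 \<le> F z}. dist z0 y \<le> e"
      using bdd bounded_any_center by blast
    with assms(3) show thesis by (intro that[of e]) force+
  qed
  have "compact (Q \<inter> cball z0 e)" using assms(2) by (simp add: closed_Int_compact)
  moreover have "upper_semicont_on (Q \<inter> cball z0 e) F" by (rule upper_semicont_on_subset[OF usc]) auto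
  moreover have z0: "Q \<inter> cball z0 e \<noteq> {}" using assms(3) e(2) by auto
  ultimately obtain z where z: "z \<in> Q" "\<And>y. y \<in> Q \<Longrightarrow> y \<in> cball z0 e \<Longrightarrow> F y \<le> F z"
    using upper_semicont_on_attains_sup[of "Q \<inter> cball z0 e" F] z0 by blast
  have "F y \<le> F z" if y: "y \<in> Q" for y
  proof (cases "F z0 \<le> F y")
    case True
    then show ?thesis using e(1) y z(2) by blast
  next
    case False
    then show ?thesis using z(2)[OF assms(3)] e(2) by simp
  qed
  then show ?thesis using z(1) by blast
qed

lemma continuous_attains_sup_coercive:
  fixes G :: "'a::euclidean_space \<Rightarrow> real"
  assumes cont: "continuous_on UNIV G" and bound: "\<And>x. G x \<le> C - (norm x)\<^sup>2 + k * norm x"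
  shows "\<exists>y. \<forall>x. G x \<le> G y"
proof -
  have "upper_semicont_on UNIV G"
    using cont by (auto simp: upper_semicont_on_def continuous_on_def order_tendsto_iff)
  moreover have "bounded {z\<in>UNIV. G 0 \<le> G z}"
  proof -
    have "norm z \<le> \<bar>k\<bar> + \<bar>C - G 0\<bar> + 1" if "G 0 \<le> G z" for z
    proof (rule ccontr)
      assume "\<not> ?thesis"
      then have z: "norm z - k > \<bar>C - G 0\<bar> + 1 - 1" "norm z \<ge> 1" by auto
      have "\<bar>C - G 0\<bar> \<le> norm z * \<bar>C - G 0\<bar>" using z(2) mult_right_mono[of 1 "norm z" "\<bar>C - G 0\<bar>"] by simp
      also have "\<dots> < norm z * (norm z - k)" using z by (intro mult_strict_left_mono) auto
      finally show False using bound[of z] that by (simp add: power2_eq_square algebra_simps)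
    qed
    then show ?thesis by (auto simp: bounded_iff)
  qed
  ultimately show ?thesis
    using upper_semicont_on_attains_sup_coercive[of UNIV G 0] by auto
qed

section \<open>Quadratic forms\<close>

lemma eq_zero_if_inner_le_quadratic:
  fixes w :: "'a::real_inner"
  assumes "\<And>h. w \<bullet> h \<le> K * (norm h)\<^sup>2"
  shows "w = 0"
proof -
  have "0 \<le> - (norm w)\<^sup>2"
  proof (rule nonneg_if_nonneg_perturb)
    fix t :: real assume t: "0 < t" "t < 1"
    have "w \<bullet> (t *\<^sub>R w) \<le> K * (norm (t *\<^sub>R w))\<^sup>2" by (rule assms)
    then have "0 \<le> t * (- (norm w)\<^sup>2 + t * (K * (norm w)\<^sup>2))"
      by (simp add: dot_square_norm power_mult_distrib algebra_simps power2_eq_square)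
    then show "0 \<le> - (norm w)\<^sup>2 + t * (K * (norm w)\<^sup>2)" using t by (simp add: zero_le_mult_iff)
  qed
  then show ?thesis by simp
qed

text \<open>Homogeneity: scaling \<open>h\<close> into the small ball multiplies both sides by the
  same square.\<close>

lemma quadratic_form_nonpos_if_small:
  fixes Z :: "'a::real_inner \<Rightarrow> 'a"
  assumes lin: "linear Z"
    and small: "\<And>e. e > 0 \<Longrightarrow> \<exists>r>0. \<forall>h. norm h < r \<longrightarrow> h \<bullet> Z h \<le> e * (norm h)\<^sup>2"
  shows "h \<bullet> Z h \<le> 0"
proof (rule field_le_epsilon)
  fix e :: real assume e: "e > 0"
  define k where "k = (norm h)\<^sup>2 + 1"
  have k: "k > 0" by (simp add: k_def add_pos_nonneg add.commute)
  obtain r where "r > 0" and r: "\<And>h. norm h < r \<Longrightarrow> h \<bullet> Z h \<le> e / k * (norm h)\<^sup>2"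
    using small[of "e / k"] e k by auto
  define t where "t = r / (norm h + 1)"
  have pos: "norm h + 1 > 0" by (simp add: add_nonneg_pos)
  have t: "t > 0" using \<open>r > 0\<close> pos by (simp add: t_def)
  have "norm (t *\<^sub>R h) < r"
    using \<open>r > 0\<close> pos by (simp add: t_def field_simps)
  from r[OF this] have "t\<^sup>2 * (h \<bullet> Z h) \<le> t\<^sup>2 * (e / k * (norm h)\<^sup>2)"
    by (simp add: linear_scale[OF lin] power_mult_distrib power2_eq_square mult_ac)
  then have "h \<bullet> Z h \<le> e / k * (norm h)\<^sup>2" 
    by (rule mult_left_le_imp_le) (use t in simp)
  also have "\<dots> \<le> e / k * k" using e k by (intro mult_left_mono) (auto simp: k_def)
  finally show "h \<bullet> Z h \<le> 0 + e" using k by simp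
qed

lemma positive_definite_inverse:
  fixes A :: "'a::euclidean_space \<Rightarrow> 'a"
  assumes lin: "linear A" and sym: "\<And>a b. A a \<bullet> b = a \<bullet> A b"
    and pos: "\<And>h. \<theta> * (norm h)\<^sup>2 \<le> h \<bullet> A h" and "\<theta> > 0"
  obtains B where "linear B" "\<And>x. A (B x) = x" "\<And>a b. B a \<bullet> b = a \<bullet> B b"
proof -
  have "h = 0" if "A h = 0" for h
    using pos[of h] that \<open>\<theta> > 0\<close> by (simp add: mult_le_0_iff)
  then have "inj A" using linear_injective_0[OF lin] by blast
  then obtain B where B: "linear B" "\<And>x. A (B x) = x"
    using linear_injective_isomorphism[OF lin] by blast
  have "B a \<bullet> b = a \<bullet> B b" for a b
    using sym[of "B a" "B b"] B(2) by simp
  with B show thesis by (rule that)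
qed

text \<open>Completing the square: \<open>h \<mapsto> h \<bullet> A h - 2 h \<bullet> \<xi>\<close> is minimal at \<open>h = B \<xi>\<close>.\<close>

lemma quadratic_form_inverse_le:
  fixes A :: "'a::euclidean_space \<Rightarrow> 'a"
  assumes lin: "linear A" and sym: "\<And>a b. A a \<bullet> b = a \<bullet> A b"
    and pos: "\<And>h. 0 \<le> h \<bullet> A h" and inv: "\<And>x. A (B x) = x"
  shows "- (\<xi> \<bullet> B \<xi>) \<le> h \<bullet> A h - 2 * (h \<bullet> \<xi>)"
proof -
  have "0 \<le> (h - B \<xi>) \<bullet> A (h - B \<xi>)" by (rule pos)
  also have "\<dots> = h \<bullet> A h - 2 * (h \<bullet> \<xi>) + \<xi> \<bullet> B \<xi>"
    using sym[of "B \<xi>" h] by (simp add: linear_diff[OF lin] inv inner_diff_left inner_diff_right inner_commute)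
  finally show ?thesis by simp
qed

text \<open>A superjet relative to \<open>Q\<close>, with an exact inequality on a ball in place of
  an error o(|\<xi>|^2). The slack \<theta> in \<open>jet_at_maximizer\<close> absorbs that error
  beforehand.\<close>

definition upper_jet :: "'a::real_inner set \<Rightarrow> ('a \<Rightarrow> real) \<Rightarrow> 'a \<Rightarrow> 'a \<Rightarrow> ('a \<Rightarrow> 'a) \<Rightarrow> bool" where
  "upper_jet Q w z P S \<longleftrightarrow> linear S \<and> (\<forall>a b. S a \<bullet> b = a \<bullet> S b) \<and>
     (\<exists>\<rho>>0. \<forall>\<xi>. norm \<xi> < \<rho> \<longrightarrow> z + \<xi> \<in> Q \<longrightarrow> w (z + \<xi>) \<le> w z + P \<bullet> \<xi> + (\<xi> \<bullet> S \<xi>) / 2)"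

lemma second_order_nonneg:
  assumes X: "second_order_at U y q X" and q: "subgrad U y q"
  shows "0 \<le> h \<bullet> X h"
proof -
  have "h \<bullet> (- X h) \<le> 0"
  proof (rule quadratic_form_nonpos_if_small)
    show "linear (\<lambda>h. - X h)" using X by (intro linear_compose_neg) (simp add: second_order_at_def)
    fix e :: real assume "e > 0"
    then have "e / 2 > 0" by simp
    then obtain r where r: "r > 0" "\<And>h. norm h < r \<Longrightarrow>
       \<bar>U (y + h) - U y - q \<bullet> h - (h \<bullet> X h) / 2\<bar> \<le> e / 2 * (norm h)\<^sup>2"
      using X unfolding second_order_at_def by blast
    have "h \<bullet> (- X h) \<le> e * (norm h)\<^sup>2" if "norm h < r" for h
      using r(2)[OF that] q[unfolded subgrad_def, rule_format, of "y + h"]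
      unfolding inner_minus_right add_diff_cancel_left' by linarith
    then show "\<exists>r>0. \<forall>h. norm h < r \<longrightarrow> h \<bullet> (- X h) \<le> e * (norm h)\<^sup>2" using r(1) by blast
  qed
  then show ?thesis by simp
qed

text \<open>\<open>legendre \<kappa> w x z = w z - \<bar>x - z\<bar>\<^sup>2 / 2\<kappa> + \<bar>x\<bar>\<^sup>2 / 2\<kappa>\<close>: its supremum over \<open>z\<close> is the sup-convolution of
  \<open>w\<close> convexified by \<open>\<bar>x\<bar>\<^sup>2 / 2\<kappa>\<close>.\<close>

definition legendre :: "real \<Rightarrow> ('a::real_inner \<Rightarrow> real) \<Rightarrow> 'a \<Rightarrow> 'a \<Rightarrow> real" where
  "legendre \<kappa> w x z = w z + (2 * (x \<bullet> z) - (norm z)\<^sup>2) / (2 * \<kappa>)"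

lemma legendre_attained:
  fixes w :: "'a::euclidean_space \<Rightarrow> real"
  assumes "closed Q" "Q \<noteq> {}" and usc: "upper_semicont_on Q w"
    and bound: "\<And>z. z \<in> Q \<Longrightarrow> w z \<le> C - (norm z)\<^sup>2" and \<kappa>: "\<kappa> > 0"
  shows "\<exists>z\<in>Q. \<forall>z'\<in>Q. legendre \<kappa> w x z' \<le> legendre \<kappa> w x z"
proof -
  obtain z0 where z0: "z0 \<in> Q" using assms(2) by blast
  have "upper_semicont_on Q (legendre \<kappa> w x)"
    unfolding legendre_def
    by (rule upper_semicont_on_add_continuous[OF usc]) (intro continuous_intros, use \<kappa> in auto)
  moreover have "bounded {z \<in> Q. legendre \<kappa> w x z0 \<le> legendre \<kappa> w x z}"
  proof -
    define R where "R = \<bar>C\<bar> + (norm x)\<^sup>2 / (2 * \<kappa>) + \<bar>legendre \<kappa> w x z0\<bar> + 1"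
    have R: "R \<ge> 1" using \<kappa> by (simp add: R_def)
    have "norm z \<le> R" if "z \<in> Q" "legendre \<kappa> w x z0 \<le> legendre \<kappa> w x z" for z
    proof (rule ccontr)
      assume "\<not> norm z \<le> R"
      then have "R * 1 < norm z * norm z" using R by (intro mult_strict_mono) auto
      moreover have "2 * (x \<bullet> z) - (norm z)\<^sup>2 \<le> (norm x)\<^sup>2"
        using zero_le_power2[of "norm (x - z)"]
        by (simp add: power2_norm_eq_inner inner_diff_left inner_diff_right inner_commute)
      then have "(2 * (x \<bullet> z) - (norm z)\<^sup>2) / (2 * \<kappa>) \<le> (norm x)\<^sup>2 / (2 * \<kappa>)"
        using \<kappa> by (intro divide_right_mono) auto
      moreover have "w z \<le> C - (norm z)\<^sup>2" by (rule bound[OF that(1)])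
      ultimately show False using that(2) by (simp add: legendre_def[of _ _ _ z] R_def power2_eq_square)
    qed
    then show ?thesis by (auto simp: bounded_iff)
  qed
  ultimately show ?thesis using upper_semicont_on_attains_sup_coercive assms(1) z0 by blast
qed

text \<open>Affine dependence on the first point makes the supremum over \<open>z\<close> convex,
  with the scaled maximizer as a subgradient.\<close>

lemma legendre_shift:
  "\<kappa> > 0 \<Longrightarrow> legendre \<kappa> w x' z = legendre \<kappa> w x z + (z /\<^sub>R \<kappa>) \<bullet> (x' - x)"
  by (simp add: legendre_def inner_diff_right inner_commute field_simps)

text \<open>The quadratic decay of \<open>w\<close> makes the suprema attained, and the bound 1/2 on
  \<kappa> lets part of the decay survive the sup-convolution.\<close>

locale sup_convolution =
  fixes Q :: "'a::euclidean_space set" and w :: "'a \<Rightarrow> real" and C \<kappa> :: real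
  assumes Q: "closed Q" "Q \<noteq> {}" and usc: "upper_semicont_on Q w"
    and bound: "\<And>z. z \<in> Q \<Longrightarrow> w z \<le> C - (norm z)\<^sup>2" and \<kappa>: "0 < \<kappa>" "\<kappa> \<le> 1/2"
begin

definition maximizer :: "'a \<Rightarrow> 'a" where
  "maximizer x = (SOME z. z \<in> Q \<and> (\<forall>z'\<in>Q. legendre \<kappa> w x z' \<le> legendre \<kappa> w x z))"

definition conv :: "'a \<Rightarrow> real" where
  "conv x = legendre \<kappa> w x (maximizer x)"

lemma maximizer: "maximizer x \<in> Q" "z \<in> Q \<Longrightarrow> legendre \<kappa> w x z \<le> conv x"
proof -
  have "\<exists>z. z \<in> Q \<and> (\<forall>z'\<in>Q. legendre \<kappa> w x z' \<le> legendre \<kappa> w x z)"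
    using legendre_attained[OF Q usc bound \<kappa>(1)] by blast
  from someI_ex[OF this] show "maximizer x \<in> Q" "z \<in> Q \<Longrightarrow> legendre \<kappa> w x z \<le> conv x"
    unfolding maximizer_def[symmetric] conv_def by auto
qed

lemma subgrad_conv: "subgrad conv x (maximizer x /\<^sub>R \<kappa>)"
proof -
  have "conv x + (maximizer x /\<^sub>R \<kappa>) \<bullet> (x' - x) \<le> conv x'" for x'
  proof -
    have "conv x + (maximizer x /\<^sub>R \<kappa>) \<bullet> (x' - x) = legendre \<kappa> w x' (maximizer x)"
      by (simp only: conv_def legendre_shift[OF \<kappa>(1), of w x' "maximizer x" x])
    also have "\<dots> \<le> conv x'" by (rule maximizer(2)[OF maximizer(1)])
    finally show ?thesis .
  qed
  then show ?thesis by (simp add: subgrad_def)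
qed

lemma conv_continuous: "continuous_on UNIV conv"
  by (rule subgrad_continuous) (use subgrad_conv in blast)

text \<open>From |x|^2 / 2 <= |z|^2 + |x - z|^2 and 2 \<kappa> <= 1 half of the decay of
  \<open>w\<close> is kept. Two such functions together still decay like -|x|^2.\<close>

lemma conv_upper: "conv x \<le> C - (norm x)\<^sup>2 / 2 + (norm x)\<^sup>2 / (2 * \<kappa>)"
proof -
  let ?z = "maximizer x"
  have sq: "(norm (x - ?z))\<^sup>2 = (norm x)\<^sup>2 - 2 * (x \<bullet> ?z) + (norm ?z)\<^sup>2"
    by (simp add: power2_norm_eq_inner inner_diff_left inner_diff_right inner_commute)
  have "(norm (x - 2 *\<^sub>R ?z))\<^sup>2 = (norm x)\<^sup>2 - 4 * (x \<bullet> ?z) + 4 * (norm ?z)\<^sup>2"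
    by (simp add: power2_norm_eq_inner inner_diff_left inner_diff_right inner_commute)
  then have "(norm x)\<^sup>2 / 2 \<le> (norm ?z)\<^sup>2 + (norm (x - ?z))\<^sup>2"
    using zero_le_power2[of "norm (x - 2 *\<^sub>R ?z)"] sq by linarith
  also have "\<dots> \<le> (norm ?z)\<^sup>2 + (norm (x - ?z))\<^sup>2 / (2 * \<kappa>)"
    using \<kappa> mult_right_mono[of "2 * \<kappa>" 1 "(norm (x - ?z))\<^sup>2"] by (simp add: field_simps)
  finally have "- (norm ?z)\<^sup>2 - (norm (x - ?z))\<^sup>2 / (2 * \<kappa>) \<le> - ((norm x)\<^sup>2 / 2)" by simp
  moreover have "conv x = w ?z - (norm (x - ?z))\<^sup>2 / (2 * \<kappa>) + (norm x)\<^sup>2 / (2 * \<kappa>)"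
    using \<kappa> by (simp add: conv_def legendre_def sq field_simps)
  ultimately show ?thesis using bound[OF maximizer(1), of x] by linarith
qed

lemma conv_at_self: "z \<in> Q \<Longrightarrow> w z + (norm z)\<^sup>2 / (2 * \<kappa>) \<le> conv z"
  using maximizer(2)[of z z] by (simp add: legendre_def dot_square_norm)

text \<open>Legendre duality for second-order expansions. For each \<open>h\<close> the value of
  \<open>conv\<close> at \<open>y + h\<close> bounds \<open>w\<close> near the maximizer; minimizing
  the quadratic bound over \<open>h\<close> replaces a Hessian by its inverse. In the second
  property \<open>k\<close> stays free so that one \<open>k\<close> can serve two functions at
  once.\<close>

lemma jet_at_maximizer:
  assumes X: "second_order_at conv y (maximizer y /\<^sub>R \<kappa>) X" and "\<theta> > 0"
  obtains S where "upper_jet Q w (maximizer y) ((maximizer y - y) /\<^sub>R \<kappa>) S"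
    "\<And>\<xi> k. \<xi> \<bullet> S \<xi> \<le> (norm \<xi>)\<^sup>2 / \<kappa> + (k \<bullet> X k + \<theta> * (norm k)\<^sup>2) - 2 * (k \<bullet> \<xi>) / \<kappa>"
proof -
  let ?z = "maximizer y"
  \<comment> \<open>The summand with \<theta> absorbs the remainder of the expansion and makes the
    semidefinite \<open>X\<close> invertible.\<close>
  define A where "A = (\<lambda>h. X h + \<theta> *\<^sub>R h)"
  have A: "linear A" "\<And>a b. A a \<bullet> b = a \<bullet> A b"
    using X unfolding A_def second_order_at_def
    by (auto intro: linear_compose_add linear_scale_self simp: inner_add_left inner_add_right)
  have A_eq: "h \<bullet> A h = h \<bullet> X h + \<theta> * (norm h)\<^sup>2" for h
    by (simp add: A_def inner_add_right dot_square_norm)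
  have A_pos: "\<theta> * (norm h)\<^sup>2 \<le> h \<bullet> A h" for h
    using second_order_nonneg[OF X subgrad_conv, of h] by (simp add: A_eq)
  have A_nonneg: "0 \<le> h \<bullet> A h" for h
    using A_pos[of h] \<open>\<theta> > 0\<close> by (auto intro: order_trans[rotated])
  obtain B where B: "linear B" "\<And>x. A (B x) = x" "\<And>a b. B a \<bullet> b = a \<bullet> B b"
    using positive_definite_inverse[OF A A_pos \<open>\<theta> > 0\<close>] by blast
  obtain \<beta> where \<beta>: "\<beta> > 0" "\<And>x. norm (B x) \<le> \<beta> * norm x"
    using linear_bounded_pos[OF B(1)] by blast
  \<comment> \<open>The first term comes from the square in \<open>legendre\<close>; the second is
    twice the minimum over \<open>h\<close> of
    \<open>(h \<bullet> A h) / 2 - (h \<bullet> \<xi>) / \<kappa>\<close>.\<close>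
  define S where "S = (\<lambda>\<xi>. (1 / \<kappa>) *\<^sub>R \<xi> - (1 / \<kappa>\<^sup>2) *\<^sub>R B \<xi>)"
  have "\<theta> / 2 > 0" using \<open>\<theta> > 0\<close> by simp
  then obtain r where "r > 0" and r: "\<And>h. norm h < r \<Longrightarrow>
      \<bar>conv (y + h) - conv y - (?z /\<^sub>R \<kappa>) \<bullet> h - (h \<bullet> X h) / 2\<bar> \<le> \<theta> / 2 * (norm h)\<^sup>2"
    using X unfolding second_order_at_def by blast
  have jet: "w (?z + \<xi>) \<le> w ?z + ((?z - y) /\<^sub>R \<kappa>) \<bullet> \<xi> + (\<xi> \<bullet> S \<xi>) / 2"
    if \<xi>: "norm \<xi> < r * \<kappa> / \<beta>" "?z + \<xi> \<in> Q" for \<xi>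
  proof -
    \<comment> \<open>The minimizer: here \<open>A h\<close> equals \<xi> / \<kappa>.\<close>
    define h where "h = (1 / \<kappa>) *\<^sub>R B \<xi>"
    have "norm h \<le> (1 / \<kappa>) * (\<beta> * norm \<xi>)" using \<beta>(2)[of \<xi>] \<kappa> by (simp add: h_def divide_right_mono)
    also have "\<dots> < r" using \<xi>(1) \<beta>(1) \<kappa> by (simp add: field_simps)
    finally have "\<bar>conv (y + h) - conv y - (?z /\<^sub>R \<kappa>) \<bullet> h - (h \<bullet> X h) / 2\<bar> \<le> \<theta> / 2 * (norm h)\<^sup>2" by (rule r)
    moreover have "\<theta> / 2 * (norm h)\<^sup>2 = \<theta> * (norm h)\<^sup>2 / 2" by simp
    ultimately have "conv (y + h) \<le> conv y + (?z /\<^sub>R \<kappa>) \<bullet> h + (h \<bullet> A h) / 2"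
      unfolding A_eq add_divide_distrib by linarith
    moreover have "legendre \<kappa> w (y + h) (?z + \<xi>) \<le> conv (y + h)" by (rule maximizer(2)[OF \<xi>(2)])
    moreover have hA: "h \<bullet> A h = (h \<bullet> \<xi>) / \<kappa>"
      by (simp add: h_def linear_scale[OF A(1)] B(2))
    moreover have "(?z /\<^sub>R \<kappa>) \<bullet> h + (h \<bullet> A h) / 2 = (2 * (?z \<bullet> h) + h \<bullet> \<xi>) / (2 * \<kappa>)"
      using \<kappa> by (simp add: hA field_simps)
    ultimately have "legendre \<kappa> w (y + h) (?z + \<xi>) \<le> legendre \<kappa> w y ?z + (2 * (?z \<bullet> h) + h \<bullet> \<xi>) / (2 * \<kappa>)"
      unfolding conv_def by linarith
    then have "w (?z + \<xi>) \<le> w ?z + (2 * (y \<bullet> ?z) - (norm ?z)\<^sup>2 + (2 * (?z \<bullet> h) + h \<bullet> \<xi>)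
        - (2 * ((y + h) \<bullet> (?z + \<xi>)) - (norm (?z + \<xi>))\<^sup>2)) / (2 * \<kappa>)"
      unfolding legendre_def by (simp add: add_divide_distrib diff_divide_distrib)
    also have "2 * (y \<bullet> ?z) - (norm ?z)\<^sup>2 + (2 * (?z \<bullet> h) + h \<bullet> \<xi>)
        - (2 * ((y + h) \<bullet> (?z + \<xi>)) - (norm (?z + \<xi>))\<^sup>2) = 2 * ((?z - y) \<bullet> \<xi>) + \<xi> \<bullet> \<xi> - h \<bullet> \<xi>"
      by (simp add: power2_norm_eq_inner inner_add_left inner_add_right inner_diff_left inner_diff_right inner_commute)
    also have "w ?z + (2 * ((?z - y) \<bullet> \<xi>) + \<xi> \<bullet> \<xi> - h \<bullet> \<xi>) / (2 * \<kappa>)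
      = w ?z + ((?z - y) /\<^sub>R \<kappa>) \<bullet> \<xi> + (\<xi> \<bullet> S \<xi>) / 2"
      using \<kappa> by (simp add: S_def h_def inner_diff_right inner_commute power2_eq_square field_simps)
    finally show ?thesis .
  qed
  show thesis
  proof (rule that[of S])
    have "linear S" unfolding S_def
      by (intro linear_compose_sub linear_compose_scale_right linear_scale_self B)
    moreover have "S a \<bullet> b = a \<bullet> S b" for a b
      by (simp add: S_def inner_diff_left inner_diff_right B)
    moreover have "r * \<kappa> / \<beta> > 0" using \<beta> \<open>r > 0\<close> \<kappa> by simp
    ultimately show "upper_jet Q w ?z ((?z - y) /\<^sub>R \<kappa>) S" unfolding upper_jet_def using jet by blast
    fix \<xi> k
    have "- (\<xi> \<bullet> B \<xi>) \<le> (\<kappa> *\<^sub>R k) \<bullet> A (\<kappa> *\<^sub>R k) - 2 * ((\<kappa> *\<^sub>R k) \<bullet> \<xi>)"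
      by (rule quadratic_form_inverse_le[OF A A_nonneg B(2)])
    also have "\<dots> = \<kappa>\<^sup>2 * (k \<bullet> A k - 2 * (k \<bullet> \<xi>) / \<kappa>)"
      using \<kappa> by (simp add: linear_scale[OF A(1)] power2_eq_square field_simps)
    finally have "(1 / \<kappa>\<^sup>2) * - (\<xi> \<bullet> B \<xi>) \<le> (1 / \<kappa>\<^sup>2) * (\<kappa>\<^sup>2 * (k \<bullet> A k - 2 * (k \<bullet> \<xi>) / \<kappa>))"
      by (rule mult_left_mono) simp
    also have "\<dots> = k \<bullet> A k - 2 * (k \<bullet> \<xi>) / \<kappa>" using \<kappa> by simp
    finally show "\<xi> \<bullet> S \<xi> \<le> (norm \<xi>)\<^sup>2 / \<kappa> + (k \<bullet> X k + \<theta> * (norm k)\<^sup>2) - 2 * (k \<bullet> \<xi>) / \<kappa>"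
      by (simp add: S_def A_eq inner_diff_right dot_square_norm)
  qed
qed

end

text \<open>With \<open>W\<close> the sum of the two sup-convolutions, the set of maxima of its linear perturbations is
  mapped by a Lipschitz map onto a ball of slopes, so it is not negligible and meets the points of
  twice differentiability of both terms.\<close>

theorem theorem_on_sums:
  fixes w1 w2 :: "'a::euclidean_space \<Rightarrow> real"
  assumes Q: "closed Q" "Q \<noteq> {}"
    and usc: "upper_semicont_on Q w1" "upper_semicont_on Q w2"
    and bound: "\<And>z. z \<in> Q \<Longrightarrow> w1 z \<le> C - (norm z)\<^sup>2" "\<And>z. z \<in> Q \<Longrightarrow> w2 z \<le> C - (norm z)\<^sup>2"
    and \<kappa>: "0 < \<kappa>" "\<kappa> \<le> 1/2" and \<delta>: "\<delta> > 0" and \<theta>: "\<theta> > 0"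
  shows "\<exists>z1 z2 y S1 S2. z1 \<in> Q \<and> z2 \<in> Q \<and> norm (z1 + z2 - 2 *\<^sub>R y) \<le> \<kappa> * \<delta> \<and>
    upper_jet Q w1 z1 ((z1 - y) /\<^sub>R \<kappa>) S1 \<and> upper_jet Q w2 z2 ((z2 - y) /\<^sub>R \<kappa>) S2 \<and>
    (\<forall>z\<in>Q. w1 z + w2 z - \<delta> * norm (z - y)
       \<le> w1 z1 + w2 z2 - ((norm (z1 - y))\<^sup>2 + (norm (z2 - y))\<^sup>2) / (2 * \<kappa>)) \<and>
    (\<forall>\<xi> \<eta>. \<xi> \<bullet> S1 \<xi> + \<eta> \<bullet> S2 \<eta> \<le> (norm (\<xi> - \<eta>))\<^sup>2 / (2 * \<kappa>) + \<theta> * ((norm \<xi>)\<^sup>2 + (norm \<eta>)\<^sup>2))"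
proof -
  interpret c1: sup_convolution Q w1 C \<kappa> by unfold_locales (use assms in auto)
  interpret c2: sup_convolution Q w2 C \<kappa> by unfold_locales (use assms in auto)
  \<comment> \<open>The convexifying terms |x|^2 / (2 \<kappa>) of both summands are removed
    again.\<close>
  define W where "W = (\<lambda>x. c1.conv x + c2.conv x - (norm x)\<^sup>2 / \<kappa>)"
  \<comment> \<open>The candidate gradient of \<open>W\<close>, read off from the subgradients of
    its two convex parts.\<close>
  define slope where "slope = (\<lambda>y. (1 / \<kappa>) *\<^sub>R (c1.maximizer y + c2.maximizer y - 2 *\<^sub>R y))"
  define K where "K = {y. \<exists>p. norm p < \<delta> \<and> (\<forall>x. W x \<le> W y + p \<bullet> (x - y))}"
  have sq: "(norm x)\<^sup>2 = (norm y)\<^sup>2 + 2 * (y \<bullet> (x - y)) + (norm (x - y))\<^sup>2" for x y :: 'a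
    by (simp add: power2_norm_eq_inner inner_diff_left inner_diff_right inner_commute)
  have W_cont: "continuous_on UNIV W"
    unfolding W_def by (intro continuous_intros c1.conv_continuous c2.conv_continuous) (use \<kappa> in auto)
  have W_bound: "W x \<le> 2 * C - (norm x)\<^sup>2" for x
  proof -
    have "(norm x)\<^sup>2 / (2 * \<kappa>) + (norm x)\<^sup>2 / (2 * \<kappa>) = (norm x)\<^sup>2 / \<kappa>" using \<kappa> by (simp add: field_simps)
    then show ?thesis using c1.conv_upper[of x] c2.conv_upper[of x] unfolding W_def by linarith
  qed
  have slope_inner: "slope y \<bullet> (x - y) = (c1.maximizer y /\<^sub>R \<kappa>) \<bullet> (x - y)
      + (c2.maximizer y /\<^sub>R \<kappa>) \<bullet> (x - y) - 2 * (y \<bullet> (x - y)) / \<kappa>" for x y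
    by (simp add: slope_def inner_add_left inner_diff_left divide_inverse algebra_simps)
  have norm_expand: "(norm x)\<^sup>2 / \<kappa> = (norm y)\<^sup>2 / \<kappa> + 2 * (y \<bullet> (x - y)) / \<kappa> + (norm (x - y))\<^sup>2 / \<kappa>" for x y :: 'a
    using sq[of x y] by (simp add: add_divide_distrib)
  have semiconvex: "W y + slope y \<bullet> (x - y) - (norm (x - y))\<^sup>2 / \<kappa> \<le> W x" for x y
  proof -
    have "c1.conv y + (c1.maximizer y /\<^sub>R \<kappa>) \<bullet> (x - y) \<le> c1.conv x"
      "c2.conv y + (c2.maximizer y /\<^sub>R \<kappa>) \<bullet> (x - y) \<le> c2.conv x"
      using c1.subgrad_conv[of y] c2.subgrad_conv[of y] by (auto simp: subgrad_def)
    then show ?thesis using slope_inner[of y x] norm_expand[of x y] unfolding W_def by linarith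
  qed
  \<comment> \<open>Between a plane touching from above and a concave paraboloid touching from below
    the slope is forced.\<close>
  have slope_unique: "p = slope y" if "\<And>x. W x \<le> W y + p \<bullet> (x - y)" for p y
  proof -
    have "slope y - p = 0"
    proof (rule eq_zero_if_inner_le_quadratic)
      fix h
      show "(slope y - p) \<bullet> h \<le> (1 / \<kappa>) * (norm h)\<^sup>2"
        using that[of "y + h"] semiconvex[of y "y + h"] by (simp add: inner_diff_left)
    qed
    then show ?thesis by simp
  qed
  have K_upper: "W x \<le> W y + slope y \<bullet> (x - y)" and K_slope: "norm (slope y) < \<delta>" if "y \<in> K" for x y
    using that slope_unique unfolding K_def by blast+
  \<comment> \<open>As in \<open>subgrad_lipschitz_at_contact\<close>, but with planes above
    \<open>W\<close> and paraboloids below.\<close>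
  have slope_lip: "norm (slope y2 - slope y1) \<le> 2 / \<kappa> * norm (y2 - y1)" if y: "y1 \<in> K" "y2 \<in> K" for y1 y2
  proof (cases "slope y1 = slope y2 \<or> y1 = y2")
    case False
    define s where "s = norm (y2 - y1)"
    have "s > 0" using False by (auto simp: s_def)
    have "s * norm (slope y2 - slope y1) \<le> 2 * s\<^sup>2 / \<kappa>"
    proof (rule norm_le_if_inner_le_sphere)
      fix k :: 'a assume k: "norm k = s"
      have "W (y2 + k) \<le> W y1 + slope y1 \<bullet> (y2 + k - y1)" by (rule K_upper[OF y(1)])
      moreover have "W y2 + slope y2 \<bullet> k - s\<^sup>2 / \<kappa> \<le> W (y2 + k)"
        using semiconvex[of y2 "y2 + k"] k by simp
      moreover have "W y1 + slope y1 \<bullet> (y2 - y1) - s\<^sup>2 / \<kappa> \<le> W y2"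
        using semiconvex[of y1 y2] by (simp add: s_def)
      ultimately show "(slope y2 - slope y1) \<bullet> k \<le> 2 * s\<^sup>2 / \<kappa>"
        by (simp add: inner_diff_left inner_diff_right inner_add_right)
    qed (use False \<open>s > 0\<close> in auto)
    then have "s * norm (slope y2 - slope y1) \<le> s * (2 / \<kappa> * s)" by (simp add: power2_eq_square mult_ac)
    then show ?thesis using \<open>s > 0\<close> unfolding s_def[symmetric] by (simp only: mult_le_cancel_left_pos)
  qed (use \<kappa> in auto)
  have "ball 0 \<delta> \<subseteq> slope ` K"
  proof
    \<comment> \<open>\<open>W\<close> minus a linear function is still coercive, so every slope in
      the ball occurs at a maximum.\<close>
    fix p :: 'a assume p: "p \<in> ball 0 \<delta>"
    have "W x - p \<bullet> x \<le> 2 * C - (norm x)\<^sup>2 + norm p * norm x" for x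
      using W_bound[of x] Cauchy_Schwarz_ineq2[of p x] by linarith
    moreover have "continuous_on UNIV (\<lambda>x. W x - p \<bullet> x)" by (intro continuous_intros W_cont)
    ultimately obtain y where y: "\<And>x. W x - p \<bullet> x \<le> W y - p \<bullet> y"
      using continuous_attains_sup_coercive[of "\<lambda>x. W x - p \<bullet> x" "2 * C" "norm p"] by auto
    have y': "W x \<le> W y + p \<bullet> (x - y)" for x using y[of x] by (simp add: inner_diff_right)
    then have "y \<in> K" using p unfolding K_def by auto
    moreover have "p = slope y" by (rule slope_unique[OF y'])
    ultimately show "p \<in> slope ` K" by blast
  qed
  moreover have "\<not> negligible (ball (0::'a) \<delta>)"
    using \<delta> by (intro open_not_negligible) auto
  ultimately have "\<not> negligible (slope ` K)" using negligible_subset by blast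
  then have K_big: "\<not> negligible K"
  proof (rule contrapos_nn)
    assume "negligible K"
    then show "negligible (slope ` K)"
    proof (rule negligible_locally_Lipschitz_image[OF order_refl])
      show "\<exists>T B. open T \<and> x \<in> T \<and> (\<forall>y\<in>K \<inter> T. norm (slope y - slope x) \<le> B * norm (y - x))"
        if "x \<in> K" for x
        using slope_lip that by (intro exI[of _ UNIV] exI[of _ "2 / \<kappa>"]) auto
    qed
  qed
  obtain N1 where N1: "negligible N1" "\<forall>y q C. y \<notin> N1 \<longrightarrow> subgrad c1.conv y q \<longrightarrow>
      (\<forall>x. c1.conv x \<le> c1.conv y + q \<bullet> (x - y) + C * (norm (x - y))\<^sup>2) \<longrightarrow>
      (\<exists>X. second_order_at c1.conv y q X)"
    using alexandrov_at_contact[of c1.conv] c1.subgrad_conv by blast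
  obtain N2 where N2: "negligible N2" "\<forall>y q C. y \<notin> N2 \<longrightarrow> subgrad c2.conv y q \<longrightarrow>
      (\<forall>x. c2.conv x \<le> c2.conv y + q \<bullet> (x - y) + C * (norm (x - y))\<^sup>2) \<longrightarrow>
      (\<exists>X. second_order_at c2.conv y q X)"
    using alexandrov_at_contact[of c2.conv] c2.subgrad_conv by blast
  have "\<not> K \<subseteq> N1 \<union> N2"
    using K_big negligible_subset[OF negligible_Un[OF N1(1) N2(1)]] by blast
  then obtain y where y: "y \<in> K" "y \<notin> N1" "y \<notin> N2" by blast
  define z1 z2 where "z1 = c1.maximizer y" and "z2 = c2.maximizer y"
  have sum_upper: "c1.conv x + c2.conv x \<le> c1.conv y + c2.conv y
      + (z1 /\<^sub>R \<kappa>) \<bullet> (x - y) + (z2 /\<^sub>R \<kappa>) \<bullet> (x - y) + (norm (x - y))\<^sup>2 / \<kappa>" for x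
    using K_upper[OF y(1), of x] slope_inner[of y x] norm_expand[of x y] unfolding W_def z1_def z2_def by linarith
  have sub1: "c1.conv y + (z1 /\<^sub>R \<kappa>) \<bullet> (x - y) \<le> c1.conv x"
    and sub2: "c2.conv y + (z2 /\<^sub>R \<kappa>) \<bullet> (x - y) \<le> c2.conv x" for x
    using c1.subgrad_conv[of y] c2.subgrad_conv[of y] by (auto simp: subgrad_def z1_def z2_def)
  \<comment> \<open>A supporting plane of the second summand turns the upper paraboloid for the sum
    into one for the first, as the contact condition requires.\<close>
  obtain X1 where X1: "second_order_at c1.conv y (z1 /\<^sub>R \<kappa>) X1"
  proof -
    have "c1.conv x \<le> c1.conv y + (z1 /\<^sub>R \<kappa>) \<bullet> (x - y) + (1 / \<kappa>) * (norm (x - y))\<^sup>2" for x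
      using sum_upper[of x] sub2[of x] by simp
    then show thesis using that N1(2) y(2) c1.subgrad_conv[of y] unfolding z1_def by blast
  qed
  obtain X2 where X2: "second_order_at c2.conv y (z2 /\<^sub>R \<kappa>) X2"
  proof -
    have "c2.conv x \<le> c2.conv y + (z2 /\<^sub>R \<kappa>) \<bullet> (x - y) + (1 / \<kappa>) * (norm (x - y))\<^sup>2" for x
      using sum_upper[of x] sub1[of x] by simp
    then show thesis using that N2(2) y(3) c2.subgrad_conv[of y] unfolding z2_def by blast
  qed
  \<comment> \<open>The paraboloid touching the sum from above bounds the sum of the
    Hessians.\<close>
  have X_sum: "h \<bullet> X1 h + h \<bullet> X2 h \<le> 2 / \<kappa> * (norm h)\<^sup>2" for h
  proof -
    have "h \<bullet> (X1 h + X2 h - (2 / \<kappa>) *\<^sub>R h) \<le> 0"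
    proof (rule quadratic_form_nonpos_if_small)
      show "linear (\<lambda>h. X1 h + X2 h - (2 / \<kappa>) *\<^sub>R h)"
        using X1 X2 unfolding second_order_at_def
        by (intro linear_compose_sub linear_compose_add linear_scale_self) auto
      fix e :: real assume "e > 0"
      then have "e / 4 > 0" by simp
      obtain r1 where r1: "r1 > 0" "\<And>h. norm h < r1 \<Longrightarrow>
         \<bar>c1.conv (y + h) - c1.conv y - (z1 /\<^sub>R \<kappa>) \<bullet> h - (h \<bullet> X1 h) / 2\<bar> \<le> e / 4 * (norm h)\<^sup>2"
        using X1 \<open>e / 4 > 0\<close> unfolding second_order_at_def by blast
      obtain r2 where r2: "r2 > 0" "\<And>h. norm h < r2 \<Longrightarrow>
         \<bar>c2.conv (y + h) - c2.conv y - (z2 /\<^sub>R \<kappa>) \<bullet> h - (h \<bullet> X2 h) / 2\<bar> \<le> e / 4 * (norm h)\<^sup>2"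
        using X2 \<open>e / 4 > 0\<close> unfolding second_order_at_def by blast
      have "h \<bullet> (X1 h + X2 h - (2 / \<kappa>) *\<^sub>R h) \<le> e * (norm h)\<^sup>2" if h: "norm h < min r1 r2" for h
      proof -
        have "h \<bullet> (X1 h + X2 h - (2 / \<kappa>) *\<^sub>R h) = h \<bullet> X1 h + h \<bullet> X2 h - 2 * ((norm h)\<^sup>2 / \<kappa>)"
          by (simp add: inner_add_right inner_diff_right dot_square_norm)
        moreover have "norm h < r1" "norm h < r2" using h by auto
        ultimately show ?thesis using r1(2)[of h] r2(2)[of h] sum_upper[of "y + h"]
          unfolding abs_le_iff add_diff_cancel_left' by linarith
      qed
      then show "\<exists>r>0. \<forall>h. norm h < r \<longrightarrow> h \<bullet> (X1 h + X2 h - (2 / \<kappa>) *\<^sub>R h) \<le> e * (norm h)\<^sup>2"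
        using r1(1) r2(1) by (intro exI[of _ "min r1 r2"]) auto
    qed
    then show ?thesis by (simp add: inner_add_right inner_diff_right dot_square_norm)
  qed
  obtain S1 where S1: "upper_jet Q w1 z1 ((z1 - y) /\<^sub>R \<kappa>) S1"
    "\<And>\<xi> k. \<xi> \<bullet> S1 \<xi> \<le> (norm \<xi>)\<^sup>2 / \<kappa> + (k \<bullet> X1 k + \<theta> * (norm k)\<^sup>2) - 2 * (k \<bullet> \<xi>) / \<kappa>"
    using c1.jet_at_maximizer[OF X1[unfolded z1_def] \<theta>] unfolding z1_def by blast
  obtain S2 where S2: "upper_jet Q w2 z2 ((z2 - y) /\<^sub>R \<kappa>) S2"
    "\<And>\<xi> k. \<xi> \<bullet> S2 \<xi> \<le> (norm \<xi>)\<^sup>2 / \<kappa> + (k \<bullet> X2 k + \<theta> * (norm k)\<^sup>2) - 2 * (k \<bullet> \<xi>) / \<kappa>"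
    using c2.jet_at_maximizer[OF X2[unfolded z2_def] \<theta>] unfolding z2_def by blast
  show ?thesis
  proof (rule exI[of _ z1], rule exI[of _ z2], rule exI[of _ y], rule exI[of _ S1], rule exI[of _ S2],
      intro conjI ballI allI)
    show "z1 \<in> Q" "z2 \<in> Q" unfolding z1_def z2_def by (rule c1.maximizer c2.maximizer)+
    have "z1 + z2 - 2 *\<^sub>R y = \<kappa> *\<^sub>R slope y" using \<kappa> by (simp add: slope_def z1_def z2_def)
    then show "norm (z1 + z2 - 2 *\<^sub>R y) \<le> \<kappa> * \<delta>" using K_slope[OF y(1)] \<kappa> by simp
    show "upper_jet Q w1 z1 ((z1 - y) /\<^sub>R \<kappa>) S1" "upper_jet Q w2 z2 ((z2 - y) /\<^sub>R \<kappa>) S2"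
      by (rule S1 S2)+
    show "w1 z + w2 z - \<delta> * norm (z - y)
       \<le> w1 z1 + w2 z2 - ((norm (z1 - y))\<^sup>2 + (norm (z2 - y))\<^sup>2) / (2 * \<kappa>)" if z: "z \<in> Q" for z
    proof -
      have "w1 z + w2 z \<le> W z"
      proof -
        have "(norm z)\<^sup>2 / \<kappa> = (norm z)\<^sup>2 / (2 * \<kappa>) + (norm z)\<^sup>2 / (2 * \<kappa>)" using \<kappa> by (simp add: field_simps)
        then show ?thesis using c1.conv_at_self[OF z] c2.conv_at_self[OF z] unfolding W_def by linarith
      qed
      also have "\<dots> \<le> W y + slope y \<bullet> (z - y)" by (rule K_upper[OF y(1)])
      also have "slope y \<bullet> (z - y) \<le> norm (slope y) * norm (z - y)" by (rule norm_cauchy_schwarz)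
      also have "\<dots> \<le> \<delta> * norm (z - y)" using K_slope[OF y(1)] by (intro mult_right_mono) auto
      finally have "w1 z + w2 z - \<delta> * norm (z - y) \<le> W y" by simp
      also have "W y = w1 z1 + w2 z2 - ((norm (z1 - y))\<^sup>2 + (norm (z2 - y))\<^sup>2) / (2 * \<kappa>)"
      proof -
        have n: "(norm (z - y))\<^sup>2 = (norm z)\<^sup>2 - 2 * (y \<bullet> z) + (norm y)\<^sup>2" for z
          by (simp add: power2_norm_eq_inner inner_diff_left inner_diff_right inner_commute)
        have "W y = w1 z1 + (2 * (y \<bullet> z1) - (norm z1)\<^sup>2) / (2 * \<kappa>) + (w2 z2 + (2 * (y \<bullet> z2) - (norm z2)\<^sup>2) / (2 * \<kappa>))
          - (2 * (norm y)\<^sup>2) / (2 * \<kappa>)"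
          by (simp add: W_def c1.conv_def c2.conv_def legendre_def z1_def z2_def)
        also have "\<dots> = w1 z1 + w2 z2 - ((norm (z1 - y))\<^sup>2 + (norm (z2 - y))\<^sup>2) / (2 * \<kappa>)"
          by (simp add: n add_divide_distrib diff_divide_distrib)
        finally show ?thesis .
      qed
      finally show ?thesis .
    qed
    show "\<xi> \<bullet> S1 \<xi> + \<eta> \<bullet> S2 \<eta> \<le> (norm (\<xi> - \<eta>))\<^sup>2 / (2 * \<kappa>) + \<theta> * ((norm \<xi>)\<^sup>2 + (norm \<eta>)\<^sup>2)" for \<xi> \<eta>
    proof -
      \<comment> \<open>The midpoint minimizes the sum of the two bounds over \<open>k\<close> once
        \<open>X_sum\<close> is inserted, the terms with \<theta> aside.\<close>
      define k where "k = (1 / 2) *\<^sub>R (\<xi> + \<eta>)"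
      have k_sq: "(norm k)\<^sup>2 = (norm \<xi>)\<^sup>2 / 2 + (norm \<eta>)\<^sup>2 / 2 - (norm (\<xi> - \<eta>))\<^sup>2 / 4"
        by (simp add: k_def power2_norm_eq_inner inner_add_left inner_add_right inner_diff_left inner_diff_right
          inner_commute field_simps)
      have k_inner: "k \<bullet> \<xi> + k \<bullet> \<eta> = 2 * (norm k)\<^sup>2"
      proof -
        have "k \<bullet> \<xi> + k \<bullet> \<eta> = k \<bullet> (2 *\<^sub>R k)" by (simp add: k_def inner_add_right)
        then show ?thesis by (simp add: dot_square_norm)
      qed
      have "\<xi> \<bullet> S1 \<xi> + \<eta> \<bullet> S2 \<eta> \<le> ((norm \<xi>)\<^sup>2 / \<kappa> + (norm \<eta>)\<^sup>2 / \<kappa>)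
          + (k \<bullet> X1 k + k \<bullet> X2 k) + 2 * \<theta> * (norm k)\<^sup>2 - 2 * (k \<bullet> \<xi> + k \<bullet> \<eta>) / \<kappa>"
        using S1(2)[of \<xi> k] S2(2)[of \<eta> k] unfolding distrib_left add_divide_distrib by linarith
      also have "\<dots> \<le> ((norm \<xi>)\<^sup>2 / \<kappa> + (norm \<eta>)\<^sup>2 / \<kappa>) + 2 / \<kappa> * (norm k)\<^sup>2
          + 2 * \<theta> * (norm k)\<^sup>2 - 2 * (2 * (norm k)\<^sup>2) / \<kappa>"
        unfolding k_inner using X_sum[of k] by simp
      also have "\<dots> = (norm (\<xi> - \<eta>))\<^sup>2 / (2 * \<kappa>) + 2 * \<theta> * (norm k)\<^sup>2"
        using \<kappa> by (simp add: k_sq field_simps)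
      also have "2 * \<theta> * (norm k)\<^sup>2 \<le> \<theta> * ((norm \<xi>)\<^sup>2 + (norm \<eta>)\<^sup>2)"
        using \<theta> by (simp add: k_sq algebra_simps)
      finally show ?thesis by simp
    qed
  qed
qed

section \<open>Test functions and jets\<close>

lemma C12_with_derivsD:
  assumes "C12_with_derivs T h ht Dh D2h"
  shows "t \<in> {0..<T} \<Longrightarrow> ((\<lambda>s. h s x) has_real_derivative ht t x) (at t within {0..<T})"
    "t \<in> {0..<T} \<Longrightarrow> GDERIV (h t) x :> Dh t x"
    "t \<in> {0..<T} \<Longrightarrow> (Dh t has_derivative (\<lambda>y. D2h t x *v y)) (at x)"
    "continuous_on ({0..<T} \<times> UNIV) (\<lambda>z. h (fst z) (snd z))"
    "continuous_on ({0..<T} \<times> UNIV) (\<lambda>z. ht (fst z) (snd z))"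
    "continuous_on ({0..<T} \<times> UNIV) (\<lambda>z. Dh (fst z) (snd z))"
    "continuous_on ({0..<T} \<times> UNIV) (\<lambda>z. D2h (fst z) (snd z))"
  using assms by (simp_all add: C12_with_derivs_def case_prod_beta)

lemma C12_with_derivs_add:
  assumes "C12_with_derivs T h1 ht1 Dh1 D2h1" "C12_with_derivs T h2 ht2 Dh2 D2h2"
  shows "C12_with_derivs T (\<lambda>t x. h1 t x + h2 t x) (\<lambda>t x. ht1 t x + ht2 t x)
    (\<lambda>t x. Dh1 t x + Dh2 t x) (\<lambda>t x. D2h1 t x + D2h2 t x)"
  unfolding C12_with_derivs_def case_prod_beta
proof (intro conjI ballI allI)
  note D1 = C12_with_derivsD[OF assms(1)] and D2 = C12_with_derivsD[OF assms(2)]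
  fix t x assume t: "t \<in> {0..<T}"
  show "((\<lambda>s. h1 s x + h2 s x) has_real_derivative ht1 t x + ht2 t x) (at t within {0..<T})"
    by (rule DERIV_add[OF D1(1)[OF t] D2(1)[OF t]])
  show "GDERIV (\<lambda>x. h1 t x + h2 t x) x :> Dh1 t x + Dh2 t x"
    by (rule GDERIV_add[OF D1(2)[OF t] D2(2)[OF t]])
  show "((\<lambda>x. Dh1 t x + Dh2 t x) has_derivative (\<lambda>y. (D2h1 t x + D2h2 t x) *v y)) (at x)"
    unfolding matrix_vector_mult_add_rdistrib
    by (rule has_derivative_add[OF D1(3)[OF t] D2(3)[OF t]])
qed (rule continuous_on_add[OF C12_with_derivsD(4)[OF assms(1)] C12_with_derivsD(4)[OF assms(2)]]
   continuous_on_add[OF C12_with_derivsD(5)[OF assms(1)] C12_with_derivsD(5)[OF assms(2)]]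
   continuous_on_add[OF C12_with_derivsD(6)[OF assms(1)] C12_with_derivsD(6)[OF assms(2)]]
   continuous_on_add[OF C12_with_derivsD(7)[OF assms(1)] C12_with_derivsD(7)[OF assms(2)]])+
lemma C12_with_derivs_scale:
  assumes "C12_with_derivs T h ht Dh D2h"
  shows "C12_with_derivs T (\<lambda>t x. \<alpha> * h t x) (\<lambda>t x. \<alpha> * ht t x)
    (\<lambda>t x. \<alpha> *\<^sub>R Dh t x) (\<lambda>t x. \<alpha> *\<^sub>R D2h t x)"
  unfolding C12_with_derivs_def case_prod_beta
proof (intro conjI ballI allI)
  note D = C12_with_derivsD[OF assms]
  fix t x assume t: "t \<in> {0..<T}"
  show "((\<lambda>s. \<alpha> * h s x) has_real_derivative \<alpha> * ht t x) (at t within {0..<T})"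
    by (rule DERIV_cmult[OF D(1)[OF t]])
  show "GDERIV (\<lambda>x. \<alpha> * h t x) x :> \<alpha> *\<^sub>R Dh t x"
    using has_derivative_mult_right[OF D(2)[OF t, unfolded gderiv_def], of \<alpha>] by (simp add: gderiv_def)
  show "((\<lambda>x. \<alpha> *\<^sub>R Dh t x) has_derivative (\<lambda>y. \<alpha> *\<^sub>R D2h t x *v y)) (at x)"
    unfolding scaleR_matrix_vector_assoc[symmetric]
    by (rule has_derivative_scaleR_right[OF D(3)[OF t]])
qed (rule continuous_on_mult[OF continuous_on_const C12_with_derivsD(4)[OF assms]]
   continuous_on_mult[OF continuous_on_const C12_with_derivsD(5)[OF assms]]
   continuous_on_scaleR[OF continuous_on_const C12_with_derivsD(6)[OF assms]]
   continuous_on_scaleR[OF continuous_on_const C12_with_derivsD(7)[OF assms]])+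

section \<open>Quadratic and separated test functions\<close>

abbreviation space_block :: "(real \<times> (real^'n) \<Rightarrow> real \<times> (real^'n)) \<Rightarrow> real^'n^'n" where
  "space_block S \<equiv> matrix (\<lambda>y. snd (S (0, y)))"

lemma space_block_mult:
  fixes S :: "real \<times> (real^'n) \<Rightarrow> real \<times> (real^'n)"
  assumes "linear S"
  shows "space_block S *v y = snd (S (0, y))"
proof -
  have "linear (\<lambda>y. snd (S (0, y)))"
  proof (rule linearI)
    fix x y :: "real^'n" and r :: real
    show "snd (S (0, x + y)) = snd (S (0, x)) + snd (S (0, y))"
      using linear_add[OF assms, of "(0, x)" "(0, y)"] by simp
    show "snd (S (0, r *\<^sub>R x)) = r *\<^sub>R snd (S (0, x))"
      using linear_scale[OF assms, of r "(0, x)"] by simp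
  qed
  from matrix_vector_mul(2)[OF this] show ?thesis by metis
qed

text \<open>Of \<open>S\<close> only the spatial block reaches the Hessian; its time and mixed
  entries leave no trace in the derivatives at \<open>z0\<close>.\<close>

lemma C12_with_derivs_quadratic:
  fixes S :: "real \<times> (real^'n) \<Rightarrow> real \<times> (real^'n)"
  assumes S: "linear S" "\<And>a b. S a \<bullet> b = a \<bullet> S b"
  shows "C12_with_derivs T
    (\<lambda>t x. a + P \<bullet> ((t, x) - z0) + (((t, x) - z0) \<bullet> S ((t, x) - z0)) / 2)
    (\<lambda>t x. fst P + fst (S ((t, x) - z0)))
    (\<lambda>t x. snd P + snd (S ((t, x) - z0)))
    (\<lambda>t x. space_block S)"
proof -
  have bl: "bounded_linear S" using S(1) by (simp add: linear_conv_bounded_linear)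
  have S_cont: "continuous_on A (\<lambda>z. S (z - z0))" for A
    by (rule bounded_linear.continuous_on[OF bl continuous_on_diff[OF continuous_on_id continuous_on_const]])
  let ?F = "\<lambda>\<xi>. a + P \<bullet> \<xi> + (\<xi> \<bullet> S \<xi>) / 2"
  have F: "(?F has_derivative (\<lambda>k. k \<bullet> (P + S \<xi>))) (at \<xi>)" for \<xi>
  proof -
    have "(?F has_derivative (\<lambda>k. 0 + P \<bullet> k + (\<xi> \<bullet> S k + k \<bullet> S \<xi>) / 2)) (at \<xi>)"
    proof (intro has_derivative_add has_derivative_const has_derivative_inner_right has_derivative_ident)
      have "((\<lambda>\<xi>. \<xi> \<bullet> S \<xi>) has_derivative (\<lambda>k. \<xi> \<bullet> S k + k \<bullet> S \<xi>)) (at \<xi>)"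
        by (rule has_derivative_inner[OF has_derivative_ident bounded_linear_imp_has_derivative[OF bl]])
      from has_derivative_mult_right[OF this, of "1/2"]
      show "((\<lambda>\<xi>. \<xi> \<bullet> S \<xi> / 2) has_derivative (\<lambda>k. (\<xi> \<bullet> S k + k \<bullet> S \<xi>) / 2)) (at \<xi>)" by simp
    qed
    moreover have "\<xi> \<bullet> S k = k \<bullet> S \<xi>" for k using S(2)[of \<xi> k] by (simp add: inner_commute)
    ultimately show ?thesis by (simp add: inner_add_right inner_commute)
  qed
  show ?thesis
    unfolding C12_with_derivs_def case_prod_beta prod.collapse
  proof (intro conjI ballI allI)
    fix t x
    have "((\<lambda>s. (s, x) - z0) has_derivative (\<lambda>s. (s, 0))) (at t within {0..<T})"
      by (auto intro!: derivative_eq_intros)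
    from has_derivative_compose[OF this F]
    show "((\<lambda>s. ?F ((s, x) - z0)) has_real_derivative fst P + fst (S ((t, x) - z0))) (at t within {0..<T})"
      unfolding has_field_derivative_def
      by (rule has_derivative_eq_rhs) (auto simp: fun_eq_iff inner_prod_def algebra_simps)
    have "((\<lambda>x. (t, x) - z0) has_derivative (\<lambda>y. (0, y))) (at x)"
      by (auto intro!: derivative_eq_intros)
    note der = this
    from has_derivative_compose[OF der F]
    show "GDERIV (\<lambda>x. ?F ((t, x) - z0)) x :> snd P + snd (S ((t, x) - z0))"
      unfolding gderiv_def
      by (rule has_derivative_eq_rhs) (auto simp: fun_eq_iff inner_prod_def)
    have "((\<lambda>x. snd P + snd (S ((t, x) - z0))) has_derivative (\<lambda>y. 0 + snd (S (0, y)))) (at x)"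
      by (intro has_derivative_add has_derivative_const has_derivative_snd bounded_linear.has_derivative[OF bl der])
    then show "((\<lambda>x. snd P + snd (S ((t, x) - z0))) has_derivative (*v) (space_block S)) (at x)"
      by (simp add: space_block_mult[OF S(1), THEN eq_reflection, abs_def])
  qed (intro continuous_intros S_cont; simp)+
qed

definition outer_square :: "real^'n \<Rightarrow> real^'n^'n" where
  "outer_square v = (\<chi> i j. v $ i * v $ j)"

lemma outer_square_mult: "outer_square v *v y = (v \<bullet> y) *\<^sub>R v"
  by (simp add: vec_eq_iff outer_square_def matrix_vector_mult_def inner_vec_def sum_distrib_right sum_distrib_left mult_ac)

lemma outer_square_0 [simp]: "outer_square 0 = 0"
  by (simp add: vec_eq_iff outer_square_def)

lemma continuous_on_outer_square [continuous_intros]: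
  "continuous_on A f \<Longrightarrow> continuous_on A (\<lambda>x. outer_square (f x))"
  unfolding outer_square_def by (intro continuous_on_vec_lambda continuous_intros)

text \<open>One computation for the penalty (\<open>s = 1\<close>, \<open>x0 = 0\<close>) and for
  both parts of the quartic barrier. The truncated exponents \<open>k - 1\<close> and
  \<open>k - 1 - 1\<close> are harmless: where truncation occurs, the factor \<open>real k\<close>
  or \<open>real (k - 1)\<close> is 0.\<close>

lemma C12_with_derivs_separated:
  fixes x0 :: "real^'n" and A A' :: "real \<Rightarrow> real" and s :: real and k :: nat
  assumes A: "\<And>t. t \<in> {0..<T} \<Longrightarrow> (A has_real_derivative A' t) (at t within {0..<T})"
    "continuous_on {0..<T} A" "continuous_on {0..<T} A'"
  defines "r \<equiv> \<lambda>x. s + (x - x0) \<bullet> (x - x0)"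
  shows "C12_with_derivs T (\<lambda>t x. A t * r x ^ k) (\<lambda>t x. A' t * r x ^ k)
    (\<lambda>t x. (A t * (2 * real k * r x ^ (k - 1))) *\<^sub>R (x - x0))
    (\<lambda>t x. (A t * (2 * real k * r x ^ (k - 1))) *\<^sub>R mat 1
       + (A t * (4 * real k * real (k - 1) * r x ^ (k - 1 - 1))) *\<^sub>R outer_square (x - x0))"
proof -
  have r_deriv: "(r has_derivative (\<lambda>y. 2 * ((x - x0) \<bullet> y))) (at x)" for x
    unfolding r_def by (auto intro!: derivative_eq_intros simp: inner_commute)
  have A_cont: "continuous_on ({0..<T} \<times> UNIV) (\<lambda>z. A (fst z))" "continuous_on ({0..<T} \<times> UNIV) (\<lambda>z. A' (fst z))"
    for z :: "real \<times> (real^'n)"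
    by (auto intro!: continuous_on_compose2[OF A(2)] continuous_on_compose2[OF A(3)] continuous_intros)
  show ?thesis
    unfolding C12_with_derivs_def case_prod_beta
  proof (intro conjI ballI allI)
    fix t x assume t: "t \<in> {0..<T}"
    show "((\<lambda>t. A t * r x ^ k) has_real_derivative A' t * r x ^ k) (at t within {0..<T})"
      using DERIV_cmult_right[OF A(1)[OF t], of "r x ^ k"] by simp
    show "GDERIV (\<lambda>x. A t * r x ^ k) x :> (A t * (2 * real k * r x ^ (k - 1))) *\<^sub>R (x - x0)"
      unfolding gderiv_def
      by (rule has_derivative_eq_rhs[OF has_derivative_mult_right[OF has_derivative_power[OF r_deriv]]])
        (auto simp: fun_eq_iff inner_commute algebra_simps)
    show "((\<lambda>x. (A t * (2 * real k * r x ^ (k - 1))) *\<^sub>R (x - x0)) has_derivative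
       (*v) ((A t * (2 * real k * r x ^ (k - 1))) *\<^sub>R mat 1
       + (A t * (4 * real k * real (k - 1) * r x ^ (k - 1 - 1))) *\<^sub>R outer_square (x - x0))) (at x)"
      by (rule has_derivative_eq_rhs[OF has_derivative_scaleR[OF has_derivative_mult_right[OF has_derivative_mult_right[OF
            has_derivative_power[OF r_deriv]]] has_derivative_diff[OF has_derivative_ident has_derivative_const]]])
        (auto simp: fun_eq_iff matrix_vector_mult_add_rdistrib scaleR_matrix_vector_assoc[symmetric]
          outer_square_mult algebra_simps)
  qed (auto simp: r_def intro!: continuous_intros A_cont)
qed

text \<open>Outside the ball where the jet inequality holds, the quartic \<open>N (\<bar>t - t\<^sub>0\<bar>\<^sup>4 + \<bar>x - x\<^sub>0\<bar>\<^sup>4)\<close> dominates; its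
  derivatives up to second order vanish at the contact point.\<close>

lemma upper_jet_test_function:
  fixes w :: "real \<times> (real^'n) \<Rightarrow> real"
  assumes upper: "upper_jet ({0..T} \<times> UNIV) w z0 P S" and z0: "fst z0 \<in> {0..<T}"
    and bound: "\<And>z. z \<in> {0..T} \<times> UNIV \<Longrightarrow> w z \<le> C"
  obtains h ht Dh D2h where "C12_with_derivs T h ht Dh D2h" "h (fst z0) (snd z0) = w z0"
    "ht (fst z0) (snd z0) = fst P" "Dh (fst z0) (snd z0) = snd P"
    "D2h (fst z0) (snd z0) = space_block S"
    "\<And>t x. t \<in> {0..<T} \<Longrightarrow> w (t, x) \<le> h t x"
proof -
  obtain \<rho> where S: "linear S" "\<And>a b. S a \<bullet> b = a \<bullet> S b" and "\<rho> > 0"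
    and jet: "\<And>\<xi>. norm \<xi> < \<rho> \<Longrightarrow> z0 + \<xi> \<in> {0..T} \<times> UNIV \<Longrightarrow> w (z0 + \<xi>) \<le> w z0 + P \<bullet> \<xi> + (\<xi> \<bullet> S \<xi>) / 2"
    using upper unfolding upper_jet_def by blast
  obtain \<beta> where \<beta>: "\<beta> > 0" "\<And>\<xi>. norm (S \<xi>) \<le> \<beta> * norm \<xi>" using linear_bounded_pos[OF S(1)] by blast
  define M where "M = \<bar>C - w z0\<bar>"
  \<comment> \<open>For |\<xi>| >= \<rho> a constant, linear or quadratic term is at most its
    coefficient times |\<xi>|^4 over a power of \<rho>. The factor 2 comes from
    \<open>n4\<close>.\<close>
  define N where "N = 2 * (M / \<rho> ^ 4 + norm P / \<rho> ^ 3 + \<beta> / \<rho>\<^sup>2)"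
  have N: "N \<ge> 0" using \<open>\<rho> > 0\<close> \<beta> by (simp add: N_def M_def)
  let ?q = "\<lambda>\<xi>. P \<bullet> \<xi> + (\<xi> \<bullet> S \<xi>) / 2"
  let ?quart = "\<lambda>\<xi>::real \<times> (real^'n). (fst \<xi>) ^ 4 + (snd \<xi> \<bullet> snd \<xi>)\<^sup>2"
  have far: "w (z0 + \<xi>) \<le> w z0 + ?q \<xi> + N * ?quart \<xi>"
    if \<xi>: "z0 + \<xi> \<in> {0..T} \<times> UNIV" for \<xi>
  proof (cases "norm \<xi> < \<rho>")
    case True
    have "0 \<le> N * ?quart \<xi>" using N by simp
    then show ?thesis using jet[OF True \<xi>] by linarith
  next
    case False
    define n where "n = norm \<xi>"
    have n: "n \<ge> \<rho>" using False by (simp add: n_def)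
    have n2: "n\<^sup>2 = (fst \<xi>)\<^sup>2 + snd \<xi> \<bullet> snd \<xi>"
      by (simp add: n_def norm_prod_def dot_square_norm)
    have "n ^ 4 = ((fst \<xi>)\<^sup>2 + snd \<xi> \<bullet> snd \<xi>)\<^sup>2"
      by (simp only: n2[symmetric] power_mult[symmetric]) simp
    also have "\<dots> \<le> 2 * ?quart \<xi>"
      using sum_squares_bound[of "(fst \<xi>)\<^sup>2" "snd \<xi> \<bullet> snd \<xi>"] by (simp add: power2_sum power_mult[symmetric])
    finally have n4: "n ^ 4 \<le> 2 * ?quart \<xi>" .
    have "- ?q \<xi> \<le> norm P * n + \<beta> * n\<^sup>2"
    proof -
      have "\<bar>P \<bullet> \<xi>\<bar> \<le> norm P * n" unfolding n_def by (rule Cauchy_Schwarz_ineq2)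
      moreover have "\<bar>\<xi> \<bullet> S \<xi>\<bar> \<le> n * (\<beta> * n)"
        using Cauchy_Schwarz_ineq2[of \<xi> "S \<xi>"] mult_left_mono[OF \<beta>(2)[of \<xi>], of n] by (simp add: n_def)
      moreover have "0 \<le> n * (\<beta> * n)" using \<beta>(1) by (simp add: n_def)
      ultimately show ?thesis unfolding power2_eq_square by (simp add: algebra_simps)
    qed
    moreover have "w (z0 + \<xi>) - w z0 \<le> M" using bound[OF \<xi>] by (simp add: M_def)
    moreover have "M \<le> M / \<rho> ^ 4 * n ^ 4"
      using power_mono[OF n, of 4] \<open>\<rho> > 0\<close> mult_left_mono[of "\<rho> ^ 4" "n ^ 4" M] by (simp add: M_def field_simps)
    moreover have "norm P * n \<le> norm P / \<rho> ^ 3 * n ^ 4"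
    proof -
      have "norm P * n * \<rho> ^ 3 \<le> norm P * n * n ^ 3"
        using n \<open>\<rho> > 0\<close> by (intro mult_left_mono power_mono) auto
      then show ?thesis using \<open>\<rho> > 0\<close> by (simp add: field_simps power3_eq_cube power4_eq_xxxx)
    qed
    moreover have "\<beta> * n\<^sup>2 \<le> \<beta> / \<rho>\<^sup>2 * n ^ 4"
    proof -
      have "\<beta> * n\<^sup>2 * \<rho>\<^sup>2 \<le> \<beta> * n\<^sup>2 * n\<^sup>2"
        using n \<open>\<rho> > 0\<close> \<beta> by (intro mult_left_mono power_mono) auto
      then show ?thesis using \<open>\<rho> > 0\<close> by (simp add: field_simps power2_eq_square power4_eq_xxxx)
    qed
    ultimately have "w (z0 + \<xi>) - w z0 - ?q \<xi> \<le> (M / \<rho> ^ 4 + norm P / \<rho> ^ 3 + \<beta> / \<rho>\<^sup>2) * n ^ 4"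
      unfolding distrib_right by linarith
    also have "\<dots> \<le> (M / \<rho> ^ 4 + norm P / \<rho> ^ 3 + \<beta> / \<rho>\<^sup>2) * (2 * ?quart \<xi>)"
      using n4 N by (intro mult_left_mono) (auto simp: N_def)
    also have "\<dots> = N * ?quart \<xi>" by (simp only: N_def mult.assoc mult.left_commute)
    finally show ?thesis by linarith
  qed
  define t0 x0 where "t0 = fst z0" and "x0 = snd z0"
  have z0_eq: "z0 = (t0, x0)" by (simp add: t0_def x0_def)
  have quad: "C12_with_derivs T (\<lambda>t x. w z0 + P \<bullet> ((t, x) - z0) + (((t, x) - z0) \<bullet> S ((t, x) - z0)) / 2)
    (\<lambda>t x. fst P + fst (S ((t, x) - z0))) (\<lambda>t x. snd P + snd (S ((t, x) - z0)))
    (\<lambda>t x. space_block S)"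
    by (rule C12_with_derivs_quadratic[OF S])
  have A: "((\<lambda>t. (t - t0) ^ 4) has_real_derivative 4 * (t - t0) ^ 3) (at t within {0..<T})"
    "((\<lambda>t. 1) has_real_derivative 0) (at t within {0..<T})" for t
    by (auto intro!: derivative_eq_intros)
  have cont: "continuous_on {0..<T} (\<lambda>t. (t - t0) ^ 4)" "continuous_on {0..<T} (\<lambda>t. 4 * (t - t0) ^ 3)"
    by (intro continuous_intros)+
  \<comment> \<open>Exponent 0 leaves the pure time factor; exponent 2 with \<open>s = 0\<close>
    gives |x - x0|^4.\<close>
  note quart_t = C12_with_derivs_separated[of T, OF A(1) cont, of 1 x0 0]
  note quart_x = C12_with_derivs_separated[of T, OF A(2) continuous_on_const continuous_on_const, of 0 x0 2]
  show thesis
  proof (rule that[OF C12_with_derivs_add[OF quad C12_with_derivs_scale[OF C12_with_derivs_add[OF quart_t quart_x], of N]]])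
    fix t x assume "t \<in> {0..<T}"
    then have "z0 + ((t, x) - z0) \<in> {0..T} \<times> UNIV" by auto
    from far[OF this] show "w (t, x) \<le> w z0 + P \<bullet> ((t, x) - z0) + (((t, x) - z0) \<bullet> S ((t, x) - z0)) / 2
       + N * ((t - t0) ^ 4 * (1 + (x - x0) \<bullet> (x - x0)) ^ 0 + 1 * (0 + (x - x0) \<bullet> (x - x0)) ^ 2)"
      by (simp add: z0_eq)
  qed (auto simp: z0_eq linear_0[OF S(1)] zero_prod_def[symmetric])
qed

section \<open>Limits of the penalized maxima\<close>

lemma upper_semicont_on_seq:
  assumes "upper_semicont_on S w" "z \<in> S" "\<And>n. x n \<in> S" "x \<longlonglongrightarrow> z" "w z < r"
  shows "\<forall>\<^sub>F n in sequentially. w (x n) < r"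
proof -
  have "\<forall>\<^sub>F y in at z within S. w y < r"
    using assms unfolding upper_semicont_on_def by blast
  then obtain A where A: "open A" "z \<in> A" "\<And>y. y \<in> A \<Longrightarrow> y \<noteq> z \<Longrightarrow> y \<in> S \<Longrightarrow> w y < r"
    unfolding eventually_at_topological by blast
  have "\<forall>\<^sub>F n in sequentially. x n \<in> A" by (rule topological_tendstoD[OF assms(4) A(1,2)])
  then show ?thesis by eventually_elim (metis A(3) assms(3,5))
qed

text \<open>The limit argument of variable doubling, with \<kappa>, \<delta> and \<theta> of
  \<open>theorem_on_sums\<close> all equal to one null sequence, so that the slope mismatch vanishes
  as well.\<close>

lemma penalized_maxima:
  fixes w1 w2 :: "'a::euclidean_space \<Rightarrow> real"
  assumes Q: "closed Q" "z0 \<in> Q"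
    and usc: "upper_semicont_on Q w1" "upper_semicont_on Q w2"
    and bound: "\<And>z. z \<in> Q \<Longrightarrow> w1 z \<le> C - (norm z)\<^sup>2" "\<And>z. z \<in> Q \<Longrightarrow> w2 z \<le> C - (norm z)\<^sup>2"
  obtains z1 z2 y :: "nat \<Rightarrow> 'a" and S1 S2 :: "nat \<Rightarrow> 'a \<Rightarrow> 'a" and \<kappa> :: "nat \<Rightarrow> real" and z where
    "\<forall>n. 0 < \<kappa> n" "\<kappa> \<longlonglongrightarrow> 0" "\<forall>n. z1 n \<in> Q" "\<forall>n. z2 n \<in> Q" "z \<in> Q"
    "\<forall>n. upper_jet Q w1 (z1 n) ((z1 n - y n) /\<^sub>R \<kappa> n) (S1 n)"
    "\<forall>n. upper_jet Q w2 (z2 n) ((z2 n - y n) /\<^sub>R \<kappa> n) (S2 n)"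
    "\<forall>n \<xi> \<eta>. \<xi> \<bullet> S1 n \<xi> + \<eta> \<bullet> S2 n \<eta> \<le> (norm (\<xi> - \<eta>))\<^sup>2 / (2 * \<kappa> n) + \<kappa> n * ((norm \<xi>)\<^sup>2 + (norm \<eta>)\<^sup>2)"
    "(\<lambda>n. norm (z1 n + z2 n - 2 *\<^sub>R y n) / \<kappa> n) \<longlonglongrightarrow> 0"
    "(\<lambda>n. ((norm (z1 n - y n))\<^sup>2 + (norm (z2 n - y n))\<^sup>2) / \<kappa> n) \<longlonglongrightarrow> 0"
    "z1 \<longlonglongrightarrow> z" "z2 \<longlonglongrightarrow> z" "(\<lambda>n. w1 (z1 n)) \<longlonglongrightarrow> w1 z" "(\<lambda>n. w2 (z2 n)) \<longlonglongrightarrow> w2 z"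
    "w1 z0 + w2 z0 \<le> w1 z + w2 z"
proof -
  \<comment> \<open>The shift by 2 gives the required bound 1/2 already at
    \<open>n = 0\<close>.\<close>
  define k where "k = (\<lambda>n::nat. 1 / (real n + 2))"
  have k: "0 < k n" "k n \<le> 1/2" for n by (auto simp: k_def)
  have k_lim: "k \<longlonglongrightarrow> 0"
    using LIMSEQ_ignore_initial_segment[OF lim_1_over_n[where 'a=real], of 2] by (simp add: k_def add.commute)
  define good where "good = (\<lambda>n z1 z2 y S1 S2. z1 \<in> Q \<and> z2 \<in> Q \<and> norm (z1 + z2 - 2 *\<^sub>R y) \<le> k n * k n \<and>
      upper_jet Q w1 z1 ((z1 - y) /\<^sub>R k n) S1 \<and> upper_jet Q w2 z2 ((z2 - y) /\<^sub>R k n) S2 \<and>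
      (\<forall>z\<in>Q. w1 z + w2 z - k n * norm (z - y)
         \<le> w1 z1 + w2 z2 - ((norm (z1 - y))\<^sup>2 + (norm (z2 - y))\<^sup>2) / (2 * k n)) \<and>
      (\<forall>\<xi> \<eta>. \<xi> \<bullet> S1 \<xi> + \<eta> \<bullet> S2 \<eta> \<le> (norm (\<xi> - \<eta>))\<^sup>2 / (2 * k n) + k n * ((norm \<xi>)\<^sup>2 + (norm \<eta>)\<^sup>2)))"
  have "\<exists>z1 z2 y S1 S2. good n z1 z2 y S1 S2" for n
  proof -
    have "Q \<noteq> {}" using Q(2) by blast
    from theorem_on_sums[OF Q(1) this usc bound k k(1) k(1)]
    have "\<exists>z1 z2 y S1 S2. good n z1 z2 y S1 S2" unfolding good_def by blast
    then show ?thesis by blast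
  qed
  then obtain Z1 Z2 Y T1 T2 where good: "\<And>n. good n (Z1 n) (Z2 n) (Y n) (T1 n) (T2 n)" by metis
  define D where "D = (\<lambda>n. (norm (Z1 n - Y n))\<^sup>2 + (norm (Z2 n - Y n))\<^sup>2)"
  have Z_in: "Z1 n \<in> Q" "Z2 n \<in> Q" for n using good unfolding good_def by blast+
  have max: "w1 z + w2 z - k n * norm (z - Y n) \<le> w1 (Z1 n) + w2 (Z2 n) - D n / (2 * k n)" if "z \<in> Q" for z n
    using good that unfolding good_def D_def by blast
  have D_le: "D n \<le> D n / (2 * k n)" for n
    using k[of n] mult_left_mono[of "2 * k n" 1 "D n"] by (simp add: D_def field_simps)
  define B where "B = 2 * \<bar>C\<bar> + \<bar>w1 z0 + w2 z0\<bar> + norm z0 + 2"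
  have est: "(norm (Z1 n))\<^sup>2 + (norm (Z2 n))\<^sup>2 + D n / (2 * k n) \<le> B + norm (Z1 n) + norm (Z1 n - Y n)" for n
  proof -
    have "norm (z0 - Y n) \<le> norm z0 + (norm (Z1 n) + norm (Z1 n - Y n))"
      using norm_triangle_ineq4[of z0 "Y n"] norm_triangle_ineq4[of "Z1 n" "Z1 n - Y n"] by simp
    moreover have "k n * norm (z0 - Y n) \<le> 1 * norm (z0 - Y n)" using k[of n] by (intro mult_right_mono) auto
    ultimately show ?thesis
      using max[OF Q(2), of n] bound(1)[OF Z_in(1)[of n]] bound(2)[OF Z_in(2)[of n]] unfolding B_def by linarith
  qed
  have lin_sq: "a \<le> (a\<^sup>2 + 1) / 2" for a :: real using zero_le_power2[of "a - 1"] by (simp add: power2_diff)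
  \<comment> \<open>The linear terms on the right of \<open>est\<close> are absorbed into halves of
    squares by \<open>lin_sq\<close>; \<open>D_le\<close> provides the square for |Z1 - Y|.\<close>
  have est2: "(norm (Z1 n))\<^sup>2 \<le> 2 * B + 2" "D n / (2 * k n) \<le> 2 * B + 2" for n
  proof -
    have "(norm (Z1 n - Y n))\<^sup>2 \<le> D n" by (simp add: D_def)
    moreover have "a2 \<le> 2 * B + 2 \<and> E \<le> 2 * B + 2"
      if "a2 + b2 + E \<le> B + a + d" "a \<le> (a2 + 1) / 2" "d \<le> (d2 + 1) / 2" "D' \<le> E" "d2 \<le> D'"
        "0 \<le> a2" "0 \<le> b2" "0 \<le> d2" for a2 b2 E a d d2 D' :: real
      using that by argo
    ultimately show "(norm (Z1 n))\<^sup>2 \<le> 2 * B + 2" "D n / (2 * k n) \<le> 2 * B + 2"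
      using est[of n] lin_sq[of "norm (Z1 n)"] lin_sq[of "norm (Z1 n - Y n)"] D_le[of n]
        zero_le_power2 by blast+
  qed
  have "norm (Z1 n) \<le> (2 * B + 3) / 2" for n
    using est2(1)[of n] lin_sq[of "norm (Z1 n)"] by argo
  then have "bounded (range Z1)" unfolding bounded_iff by blast
  then obtain z r where r: "strict_mono r" "(Z1 \<circ> r) \<longlonglongrightarrow> z"
    using bounded_imp_convergent_subsequence by blast
  have z: "z \<in> Q" using closed_sequentially[OF Q(1) _ r(2)] Z_in(1) by simp
  have kr: "(\<lambda>n. k (r n)) \<longlonglongrightarrow> 0" using LIMSEQ_subseq_LIMSEQ[OF k_lim r(1)] by (simp add: o_def)
  have D_lim: "(\<lambda>n. D (r n)) \<longlonglongrightarrow> 0"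
  proof (rule tendsto_sandwich)
    show "\<forall>\<^sub>F n in sequentially. 0 \<le> D (r n)" by (simp add: D_def)
    show "\<forall>\<^sub>F n in sequentially. D (r n) \<le> (2 * k (r n)) * (2 * B + 2)"
      using est2(2) k(1) by (intro always_eventually allI) (simp add: field_simps)
    show "(\<lambda>n. (2 * k (r n)) * (2 * B + 2)) \<longlonglongrightarrow> 0"
      using tendsto_mult[OF tendsto_mult[OF tendsto_const kr] tendsto_const, of 2 "2 * B + 2"] by simp
  qed simp
  have diff_lim: "(\<lambda>n. f (r n)) \<longlonglongrightarrow> 0" if "\<And>n. (norm (f n))\<^sup>2 \<le> D n" for f :: "nat \<Rightarrow> 'a"
  proof -
    have "(\<lambda>n. sqrt (D (r n))) \<longlonglongrightarrow> 0" using tendsto_real_sqrt[OF D_lim] by simp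
    then show ?thesis
      by (rule Lim_null_comparison[rotated]) (use that in \<open>auto intro!: always_eventually real_le_rsqrt\<close>)
  qed
  have "(\<lambda>n. Z1 (r n) - Y (r n)) \<longlonglongrightarrow> 0" "(\<lambda>n. Z2 (r n) - Y (r n)) \<longlonglongrightarrow> 0"
    by (rule diff_lim[where f = "\<lambda>n. Z1 n - Y n"] diff_lim[where f = "\<lambda>n. Z2 n - Y n"]; simp add: D_def)+
  moreover have Z1_lim: "(\<lambda>n. Z1 (r n)) \<longlonglongrightarrow> z" using r(2) by (simp add: o_def)
  ultimately have Y_lim: "(\<lambda>n. Y (r n)) \<longlonglongrightarrow> z" and Z2_lim: "(\<lambda>n. Z2 (r n)) \<longlonglongrightarrow> z"
  proof -
    assume a: "(\<lambda>n. Z1 (r n) - Y (r n)) \<longlonglongrightarrow> 0" "(\<lambda>n. Z2 (r n) - Y (r n)) \<longlonglongrightarrow> 0"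
    show Y: "(\<lambda>n. Y (r n)) \<longlonglongrightarrow> z" using tendsto_diff[OF Z1_lim a(1)] by simp
    show "(\<lambda>n. Z2 (r n)) \<longlonglongrightarrow> z" using tendsto_add[OF Y a(2)] by simp
  qed
  have kY_lim: "(\<lambda>n. k (r n) * norm (x - Y (r n))) \<longlonglongrightarrow> 0" for x
    using tendsto_mult[OF kr tendsto_norm[OF tendsto_diff[OF tendsto_const Y_lim]], of x] by simp
  \<comment> \<open>Semicontinuity bounds each value from above only. The maximum property at the
    limit point \<open>z\<close> bounds the sum from below, which yields both the convergence of
    each value and the decay of the penalty.\<close>
  have up: "\<forall>\<^sub>F n in sequentially. w1 (Z1 (r n)) < w1 z + e \<and> w2 (Z2 (r n)) < w2 z + e \<and>
      k (r n) * norm (z - Y (r n)) < e" if "e > 0" for e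
    using that upper_semicont_on_seq[OF usc(1) z, of "\<lambda>n. Z1 (r n)" "w1 z + e"]
      upper_semicont_on_seq[OF usc(2) z, of "\<lambda>n. Z2 (r n)" "w2 z + e"] Z_in Z1_lim Z2_lim
      order_tendstoD(2)[OF kY_lim[of z] that]
    by (intro eventually_conj) auto
  have D_nonneg: "0 \<le> D n / (2 * k n)" for n using k[of n] by (simp add: D_def)
  have "(\<lambda>n. D (r n) / (2 * k (r n))) \<longlonglongrightarrow> 0"
  proof (rule tendstoI)
    fix e :: real assume "e > 0"
    then have "e / 3 > 0" by simp
    from up[OF this] show "\<forall>\<^sub>F n in sequentially. dist (D (r n) / (2 * k (r n))) 0 < e"
    proof eventually_elim
      case (elim n)
      then show ?case using max[OF z, of "r n"] D_nonneg[of "r n"] unfolding dist_real_def by linarith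
    qed
  qed
  from tendsto_mult[OF tendsto_const this, of 2]
  have Dk_lim: "(\<lambda>n. D (r n) / k (r n)) \<longlonglongrightarrow> 0" by simp
  have w_lim: "(\<lambda>n. w1 (Z1 (r n))) \<longlonglongrightarrow> w1 z" "(\<lambda>n. w2 (Z2 (r n))) \<longlonglongrightarrow> w2 z"
  proof -
    have "\<forall>\<^sub>F n in sequentially. dist (w1 (Z1 (r n))) (w1 z) < e \<and> dist (w2 (Z2 (r n))) (w2 z) < e" if "e > 0" for e
    proof -
      have "e / 3 > 0" using that by simp
      from up[OF this] show ?thesis
      proof eventually_elim
        case (elim n)
        then show ?case using max[OF z, of "r n"] D_nonneg[of "r n"] \<open>e > 0\<close> unfolding dist_real_def by linarith
      qed
    qed
    note ev = this
    show "(\<lambda>n. w1 (Z1 (r n))) \<longlonglongrightarrow> w1 z" "(\<lambda>n. w2 (Z2 (r n))) \<longlonglongrightarrow> w2 z"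
      by (rule tendstoI, rule eventually_mono[OF ev], assumption, simp)+
  qed
  have "w1 z0 + w2 z0 \<le> w1 z + w2 z"
  proof (rule tendsto_lowerbound)
    show "(\<lambda>n. w1 (Z1 (r n)) + w2 (Z2 (r n)) + k (r n) * norm (z0 - Y (r n))) \<longlonglongrightarrow> w1 z + w2 z"
      using tendsto_add[OF tendsto_add[OF w_lim] kY_lim[of z0]] by simp
    show "\<forall>\<^sub>F n in sequentially. w1 z0 + w2 z0 \<le> w1 (Z1 (r n)) + w2 (Z2 (r n)) + k (r n) * norm (z0 - Y (r n))"
    proof (rule always_eventually, rule allI)
      fix n show "w1 z0 + w2 z0 \<le> w1 (Z1 (r n)) + w2 (Z2 (r n)) + k (r n) * norm (z0 - Y (r n))"
        using max[OF Q(2), of "r n"] D_nonneg[of "r n"] by linarith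
    qed
  qed simp
  moreover have "(\<lambda>n. norm (Z1 (r n) + Z2 (r n) - 2 *\<^sub>R Y (r n)) / k (r n)) \<longlonglongrightarrow> 0"
  proof (rule Lim_null_comparison[OF _ kr])
    have "norm (Z1 n + Z2 n - 2 *\<^sub>R Y n) \<le> k n * k n" for n using good unfolding good_def by blast
    then show "\<forall>\<^sub>F n in sequentially. norm (norm (Z1 (r n) + Z2 (r n) - 2 *\<^sub>R Y (r n)) / k (r n)) \<le> k (r n)"
      using k(1) by (intro always_eventually allI) (simp add: field_simps abs_of_pos)
  qed
  moreover have jets: "upper_jet Q w1 (Z1 n) ((Z1 n - Y n) /\<^sub>R k n) (T1 n)"
    "upper_jet Q w2 (Z2 n) ((Z2 n - Y n) /\<^sub>R k n) (T2 n)"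
    "\<xi> \<bullet> T1 n \<xi> + \<eta> \<bullet> T2 n \<eta> \<le> (norm (\<xi> - \<eta>))\<^sup>2 / (2 * k n) + k n * ((norm \<xi>)\<^sup>2 + (norm \<eta>)\<^sup>2)" for n \<xi> \<eta>
    using good unfolding good_def by blast+
  ultimately show thesis
    using that[of "\<lambda>n. k (r n)" "\<lambda>n. Z1 (r n)" "\<lambda>n. Z2 (r n)" z "\<lambda>n. Y (r n)" "\<lambda>n. T1 (r n)" "\<lambda>n. T2 (r n)"]
      k(1) kr Z_in z Dk_lim[unfolded D_def] Z1_lim Z2_lim w_lim by blast
qed

section \<open>Jets as viscosity inequalities\<close>

lemma subsolution_upper_jet:
  fixes u :: "real \<Rightarrow> real^'n \<Rightarrow> real"
  assumes sub: "viscosity_subsolution T c H g u" and \<phi>: "C12_with_derivs T \<phi> \<phi>t D\<phi> D2\<phi>"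
    and jet: "upper_jet ({0..T} \<times> UNIV) (\<lambda>z. u (fst z) (snd z) - \<phi> (fst z) (snd z)) (t, x) P S"
    and t: "t \<in> {0..<T}"
    and bound: "\<And>z. z \<in> {0..T} \<times> UNIV \<Longrightarrow> u (fst z) (snd z) - \<phi> (fst z) (snd z) \<le> C"
  shows "u t x \<le> g x"
    "c t x * u t x - (fst P + \<phi>t t x) + H t x (snd P + D\<phi> t x) (space_block S + D2\<phi> t x) \<le> 0"
proof -
  obtain h ht Dh D2h where h: "C12_with_derivs T h ht Dh D2h" "h t x = u t x - \<phi> t x"
    "ht t x = fst P" "Dh t x = snd P" "D2h t x = space_block S"
    and above: "\<And>s y. s \<in> {0..<T} \<Longrightarrow> u s y - \<phi> s y \<le> h s y"
    using upper_jet_test_function[OF jet _ bound] t unfolding fst_conv snd_conv by blast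
  have below: "u s y - (h s y + \<phi> s y) \<le> 0" if "s \<in> {0..<T}" for s y
    using above[OF that, of y] by simp
  have eq: "u t x - (h t x + \<phi> t x) = 0" by (simp add: h(2))
  have "max (c t x * (h t x + \<phi> t x) - (ht t x + \<phi>t t x) + H t x (Dh t x + D\<phi> t x) (D2h t x + D2\<phi> t x))
               (h t x + \<phi> t x - g x) \<le> 0"
    using sub[unfolded viscosity_subsolution_def, THEN conjunct2, rule_format,
        OF C12_with_derivs_add[OF h(1) \<phi>], OF t, of x] below eq by fastforce
  then show "u t x \<le> g x"
    "c t x * u t x - (fst P + \<phi>t t x) + H t x (snd P + D\<phi> t x) (space_block S + D2\<phi> t x) \<le> 0"
    by (simp_all add: h)
qed

text \<open>The test function is the negative of the one above \<open>- v\<close>, so slope and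
  Hessian change sign. A nonnegative maximum yields only a disjunction, unlike the subsolution
  case.\<close>

lemma supersolution_upper_jet:
  fixes v :: "real \<Rightarrow> real^'n \<Rightarrow> real"
  assumes super: "viscosity_supersolution T c H g v" and \<phi>: "C12_with_derivs T \<phi> \<phi>t D\<phi> D2\<phi>"
    and jet: "upper_jet ({0..T} \<times> UNIV) (\<lambda>z. - v (fst z) (snd z) - \<phi> (fst z) (snd z)) (t, x) P S"
    and t: "t \<in> {0..<T}"
    and bound: "\<And>z. z \<in> {0..T} \<times> UNIV \<Longrightarrow> - v (fst z) (snd z) - \<phi> (fst z) (snd z) \<le> C"
  shows "g x \<le> v t x \<or>
    0 \<le> c t x * v t x + (fst P + \<phi>t t x) + H t x (- (snd P + D\<phi> t x)) (- (space_block S + D2\<phi> t x))"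
proof -
  obtain h ht Dh D2h where h: "C12_with_derivs T h ht Dh D2h" "h t x = - v t x - \<phi> t x"
    "ht t x = fst P" "Dh t x = snd P" "D2h t x = space_block S"
    and above: "\<And>s y. s \<in> {0..<T} \<Longrightarrow> - v s y - \<phi> s y \<le> h s y"
    using upper_jet_test_function[OF jet _ bound] t unfolding fst_conv snd_conv by blast
  have below: "0 \<le> v s y - - 1 * (h s y + \<phi> s y)" if "s \<in> {0..<T}" for s y
    using above[OF that, of y] by simp
  have eq: "v t x - - 1 * (h t x + \<phi> t x) = 0" by (simp add: h(2))
  have "0 \<le> max (c t x * (- 1 * (h t x + \<phi> t x)) - - 1 * (ht t x + \<phi>t t x)
        + H t x (- 1 *\<^sub>R (Dh t x + D\<phi> t x)) (- 1 *\<^sub>R (D2h t x + D2\<phi> t x))) (- 1 * (h t x + \<phi> t x) - g x)"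
    using super[unfolded viscosity_supersolution_def, THEN conjunct2, rule_format,
        OF C12_with_derivs_scale[OF C12_with_derivs_add[OF h(1) \<phi>], of "- 1"], OF t, of x]
      below eq by fastforce
  then show ?thesis by (auto simp: h le_max_iff_disj)
qed

section \<open>Traces of diffusion matrices\<close>

abbreviation conj_trace :: "real^'n^'n \<Rightarrow> real^'n^'n \<Rightarrow> real" where
  "conj_trace A M \<equiv> trace (A ** transpose A ** M)"

text \<open>As a sum of quadratic forms, the trace can be estimated column by column.\<close>

lemma conj_trace_columns:
  fixes A M :: "real^'n^'n"
  shows "conj_trace A M = (\<Sum>j\<in>UNIV. column j A \<bullet> (M *v column j A))"
proof -
  have "conj_trace A M = (\<Sum>i\<in>UNIV. \<Sum>k\<in>UNIV. \<Sum>j\<in>UNIV. A $ k $ j * M $ k $ i * A $ i $ j)"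
    by (simp add: trace_def matrix_matrix_mult_def transpose_def sum_distrib_right sum_distrib_left mult_ac)
  also have "\<dots> = (\<Sum>j\<in>UNIV. \<Sum>i\<in>UNIV. \<Sum>k\<in>UNIV. A $ k $ j * M $ k $ i * A $ i $ j)"
    by (subst sum.swap[of _ UNIV UNIV], subst (2) sum.swap, subst sum.swap, rule sum.cong[OF refl], rule sum.swap)
  also have "\<dots> = (\<Sum>j\<in>UNIV. column j A \<bullet> (M *v column j A))"
  proof (rule sum.cong[OF refl])
    fix j
    have "(\<Sum>i\<in>UNIV. \<Sum>k\<in>UNIV. A $ k $ j * M $ k $ i * A $ i $ j)
        = (\<Sum>k\<in>UNIV. \<Sum>i\<in>UNIV. A $ k $ j * M $ k $ i * A $ i $ j)" by (rule sum.swap)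
    then show "(\<Sum>i\<in>UNIV. \<Sum>k\<in>UNIV. A $ k $ j * M $ k $ i * A $ i $ j) = column j A \<bullet> (M *v column j A)"
      by (simp add: inner_vec_def matrix_vector_mult_def column_def sum_distrib_left mult_ac)
  qed
  finally show ?thesis .
qed

lemma sum_norm_column:
  fixes A :: "real^'n^'n"
  shows "(\<Sum>j\<in>UNIV. (norm (column j A))\<^sup>2) = (norm A)\<^sup>2"
proof -
  have "(\<Sum>j\<in>UNIV. (norm (column j A))\<^sup>2) = (\<Sum>j\<in>UNIV. \<Sum>i\<in>UNIV. (A $ i $ j)\<^sup>2)"
    by (simp only: power2_norm_eq_inner) (simp add: inner_vec_def column_def power2_eq_square)
  also have "\<dots> = (norm A)\<^sup>2"
    by (subst sum.swap, simp only: power2_norm_eq_inner) (simp add: inner_vec_def power2_eq_square)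
  finally show ?thesis .
qed

text \<open>Insert pairs of columns with zero time component into the inequality and sum; the column
  norms add up to Frobenius norms.\<close>

lemma trace_jets_le:
  fixes A B :: "real^'n^'n"
  assumes S: "linear S1" "linear S2"
    and le: "\<And>\<xi> \<eta>. \<xi> \<bullet> S1 \<xi> + \<eta> \<bullet> S2 \<eta> \<le> (norm (\<xi> - \<eta>))\<^sup>2 / (2 * \<kappa>) + \<theta> * ((norm \<xi>)\<^sup>2 + (norm \<eta>)\<^sup>2)"
  shows "conj_trace A (space_block S1) + conj_trace B (space_block S2)
    \<le> (norm (A - B))\<^sup>2 / (2 * \<kappa>) + \<theta> * ((norm A)\<^sup>2 + (norm B)\<^sup>2)"
proof -
  have cdiff: "column j (A - B) = column j A - column j B" for j by (simp add: column_def vec_eq_iff)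
  have "conj_trace A (space_block S1) + conj_trace B (space_block S2)
     = (\<Sum>j\<in>UNIV. (0, column j A) \<bullet> S1 (0, column j A) + (0, column j B) \<bullet> S2 (0, column j B))"
    by (simp add: conj_trace_columns space_block_mult S sum.distrib inner_prod_def)
  also have "\<dots> \<le> (\<Sum>j\<in>UNIV. (norm ((0::real, column j A) - (0, column j B)))\<^sup>2 / (2 * \<kappa>)
       + \<theta> * ((norm (0::real, column j A))\<^sup>2 + (norm (0::real, column j B))\<^sup>2))"
    by (intro sum_mono le)
  also have "\<dots> = (norm (A - B))\<^sup>2 / (2 * \<kappa>) + \<theta> * ((norm A)\<^sup>2 + (norm B)\<^sup>2)"
    by (simp add: norm_Pair sum.distrib sum_divide_distrib[symmetric] sum_distrib_left[symmetric]
        cdiff[symmetric] sum_norm_column)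
  finally show ?thesis .
qed

lemma conj_trace_identity: "conj_trace A (mat 1) = (norm (A :: real^'n^'n))\<^sup>2"
  by (simp add: conj_trace_columns sum_norm_column[symmetric] dot_square_norm del: matrix_mul_rid)

lemma conj_trace_outer:
  "conj_trace A (outer_square x) \<le> (norm x)\<^sup>2 * (norm (A :: real^'n^'n))\<^sup>2"
proof -
  have "conj_trace A (outer_square x) = (\<Sum>j\<in>UNIV. (x \<bullet> column j A)\<^sup>2)"
    by (simp add: conj_trace_columns outer_square_mult inner_commute power2_eq_square)
  also have "\<dots> \<le> (\<Sum>j\<in>UNIV. (norm x)\<^sup>2 * (norm (column j A))\<^sup>2)"
    by (intro sum_mono) (simp add: Cauchy_Schwarz_ineq power2_norm_eq_inner)
  finally show ?thesis by (simp add: sum_distrib_left[symmetric] sum_norm_column)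
qed

lemma conj_trace_add: "conj_trace (A :: real^'n^'n) (M + N) = conj_trace A M + conj_trace A (N :: real^'n^'n)"
  by (simp add: matrix_add_ldistrib trace_add)

lemma conj_trace_scale: "conj_trace (A :: real^'n^'n) (c *\<^sub>R M) = c * conj_trace A (M :: real^'n^'n)"
  by (simp add: conj_trace_columns scaleR_matrix_vector_assoc[symmetric] sum_distrib_left)

section \<open>The comparison principle\<close>

definition penalty :: "real \<Rightarrow> real \<Rightarrow> nat \<Rightarrow> real \<Rightarrow> real^'n \<Rightarrow> real" where
  "penalty l T m t x = exp (l * (T - t)) * (1 + x \<bullet> x) ^ m"

definition penalty_dt :: "real \<Rightarrow> real \<Rightarrow> nat \<Rightarrow> real \<Rightarrow> real^'n \<Rightarrow> real" where
  "penalty_dt l T m t x = - l * exp (l * (T - t)) * (1 + x \<bullet> x) ^ m"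

definition penalty_D :: "real \<Rightarrow> real \<Rightarrow> nat \<Rightarrow> real \<Rightarrow> real^'n \<Rightarrow> real^'n" where
  "penalty_D l T m t x = (exp (l * (T - t)) * (2 * real m * (1 + x \<bullet> x) ^ (m - 1))) *\<^sub>R x"

definition penalty_D2 :: "real \<Rightarrow> real \<Rightarrow> nat \<Rightarrow> real \<Rightarrow> real^'n \<Rightarrow> real^'n^'n" where
  "penalty_D2 l T m t x = (exp (l * (T - t)) * (2 * real m * (1 + x \<bullet> x) ^ (m - 1))) *\<^sub>R mat 1
     + (exp (l * (T - t)) * (4 * real m * real (m - 1) * (1 + x \<bullet> x) ^ (m - 1 - 1))) *\<^sub>R outer_square x"

lemma penalty_C12:
  "C12_with_derivs T (penalty l T m) (penalty_dt l T m) (penalty_D l T m) (penalty_D2 l T m)"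
proof -
  have deriv: "((\<lambda>t. exp (l * (T - t))) has_real_derivative - l * exp (l * (T - t))) (at t within {0..<T})" for t
    by (auto intro!: derivative_eq_intros)
  have cont: "continuous_on {0..<T} (\<lambda>t. exp (l * (T - t)))" "continuous_on {0..<T} (\<lambda>t. - l * exp (l * (T - t)))"
    by (intro continuous_intros)+
  show ?thesis
    using C12_with_derivs_separated[of T, OF deriv cont, of 1 0 m]
    unfolding penalty_def penalty_dt_def penalty_D_def penalty_D2_def diff_zero .
qed

lemma continuous_on_penalty: "continuous_on S (\<lambda>z. penalty l T m (fst z) (snd z))"
  unfolding penalty_def by (intro continuous_intros)

lemma penalty_ge:
  assumes "0 \<le> l" "t \<le> T"
  shows "(1 + x \<bullet> x) ^ m \<le> penalty l T m t x"
  using mult_right_mono[of 1 "exp (l * (T - t))" "(1 + x \<bullet> x) ^ m"] assms by (simp add: penalty_def)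

text \<open>With r = 1 + |x|^2, linear growth together with (1 + |x|) |x| <= 2 r and (1 + |x|)^2 <=
  2 r bounds drift and diffusion terms by \<Lambda> E r^m. The time derivative removes at least
  (\<Lambda> + 1) E r^m, and E r^m >= 1.\<close>

lemma penalty_strict_supersolution:
  fixes x \<beta> :: "real^'n" and s :: "real^'n^'n"
  assumes "2 \<le> m" "t \<le> T" "0 < K" and growth: "norm \<beta> + norm s \<le> K * (1 + norm x)"
    and l: "4 * K * m + 2 * m * K\<^sup>2 + 4 * m * real (m - 1) * K\<^sup>2 + 1 \<le> l"
  shows "penalty_dt l T m t x + \<beta> \<bullet> penalty_D l T m t x
    + 1/2 * conj_trace s (penalty_D2 l T m t x) \<le> - 1"
proof -
  define E where "E = exp (l * (T - t))"
  define r where "r = 1 + x \<bullet> x"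
  define \<Lambda> where "\<Lambda> = 4 * K * m + 2 * m * K\<^sup>2 + 4 * m * real (m - 1) * K\<^sup>2"
  define n where "n = norm x"
  have "\<Lambda> \<ge> 0" using assms(3) by (simp add: \<Lambda>_def)
  have l0: "l \<ge> \<Lambda> + 1" using l by (simp add: \<Lambda>_def)
  have E: "E \<ge> 1" using l0 \<open>\<Lambda> \<ge> 0\<close> assms(2) by (simp add: E_def)
  have r_n: "r = 1 + n\<^sup>2" by (simp add: r_def n_def dot_square_norm)
  have r: "r \<ge> 1" by (simp add: r_n)
  have n: "n \<ge> 0" "(1 + n) * n \<le> 2 * r" "(1 + n)\<^sup>2 \<le> 2 * r"
  proof -
    show "n \<ge> 0" by (simp add: n_def)
    have "0 \<le> 1 - 2 * n + n\<^sup>2" using zero_le_power2[of "n - 1"] by (simp add: power2_diff)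
    moreover have "n + q \<le> 2 * (1 + q) \<and> 1 + 2 * n + q \<le> 2 * (1 + q)" if "0 \<le> 1 - 2 * n + q" "0 \<le> q" for q
      using that \<open>n \<ge> 0\<close> by argo
    ultimately have "n + n\<^sup>2 \<le> 2 * r" "1 + 2 * n + n\<^sup>2 \<le> 2 * r"
      using zero_le_power2[of n] unfolding r_n by blast+
    then show "(1 + n) * n \<le> 2 * r" "(1 + n)\<^sup>2 \<le> 2 * r"
      by (simp_all add: power2_eq_square algebra_simps)
  qed
  \<comment> \<open>Two factors \<open>r\<close> are split off for the second derivative, hence
    \<open>2 \<le> m\<close>.\<close>
  have pow: "r ^ (m - 1) * r = r ^ m" "r ^ (m - 1 - 1) * (r * r) = r ^ m"
  proof -
    obtain m' where "m = Suc (Suc m')" using \<open>2 \<le> m\<close> by (metis Suc_le_D numeral_2_eq_2 Suc_le_mono)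
    then show "r ^ (m - 1) * r = r ^ m" "r ^ (m - 1 - 1) * (r * r) = r ^ m" by (simp_all add: mult_ac)
  qed
  have \<beta>: "\<beta> \<bullet> x \<le> 2 * K * r"
  proof -
    have "\<beta> \<bullet> x \<le> norm \<beta> * n" unfolding n_def by (rule norm_cauchy_schwarz)
    also have "\<dots> \<le> (K * (1 + n)) * n"
      using growth n(1) norm_ge_zero[of s] unfolding n_def by (intro mult_right_mono) linarith+
    also have "\<dots> \<le> K * (2 * r)" using mult_left_mono[OF n(2), of K] \<open>0 < K\<close> by (simp add: mult.assoc)
    finally show ?thesis by simp
  qed
  have s: "(norm s)\<^sup>2 \<le> 2 * K\<^sup>2 * r"
  proof -
    have "norm s \<le> K * (1 + n)" using growth norm_ge_zero[of \<beta>] unfolding n_def by linarith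
    then have "(norm s)\<^sup>2 \<le> (K * (1 + n))\<^sup>2" by (rule power_mono) simp
    also have "\<dots> \<le> K\<^sup>2 * (2 * r)" using mult_left_mono[OF n(3), of "K\<^sup>2"] by (simp add: power_mult_distrib)
    finally show ?thesis by simp
  qed
  have "\<beta> \<bullet> penalty_D l T m t x = (E * (2 * real m * r ^ (m - 1))) * (\<beta> \<bullet> x)"
    by (simp add: penalty_D_def E_def r_def)
  also have "\<dots> \<le> (E * (2 * real m * r ^ (m - 1))) * (2 * K * r)"
    using E r \<beta> by (intro mult_left_mono) auto
  also have "\<dots> = (4 * K * m) * (E * (r ^ (m - 1) * r))" by (simp add: mult_ac)
  finally have 1: "\<beta> \<bullet> penalty_D l T m t x \<le> (4 * K * m) * (E * r ^ m)" by (simp only: pow)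
  have "conj_trace s (penalty_D2 l T m t x) = (E * (2 * real m * r ^ (m - 1))) * (norm s)\<^sup>2
      + (E * (4 * real m * real (m - 1) * r ^ (m - 1 - 1))) * conj_trace s (outer_square x)"
    unfolding penalty_D2_def conj_trace_add conj_trace_scale conj_trace_identity E_def r_def by simp
  also have "\<dots> \<le> (E * (2 * real m * r ^ (m - 1))) * (2 * K\<^sup>2 * r)
      + (E * (4 * real m * real (m - 1) * r ^ (m - 1 - 1))) * (r * (2 * K\<^sup>2 * r))"
  proof (intro add_mono mult_left_mono)
    show "(norm s)\<^sup>2 \<le> 2 * K\<^sup>2 * r" by (rule s)
    have "conj_trace s (outer_square x) \<le> n\<^sup>2 * (norm s)\<^sup>2"
      unfolding n_def by (rule conj_trace_outer)
    also have "\<dots> \<le> r * (2 * K\<^sup>2 * r)" using s r by (intro mult_mono) (auto simp: r_n)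
    finally show "conj_trace s (outer_square x) \<le> r * (2 * K\<^sup>2 * r)" .
  qed (use E r in auto)
  also have "\<dots> = (4 * m * K\<^sup>2) * (E * (r ^ (m - 1) * r)) + (8 * m * real (m - 1) * K\<^sup>2) * (E * (r ^ (m - 1 - 1) * (r * r)))"
    by (simp only: mult_ac) simp
  finally have 2: "conj_trace s (penalty_D2 l T m t x)
      \<le> (4 * m * K\<^sup>2) * (E * r ^ m) + (8 * m * real (m - 1) * K\<^sup>2) * (E * r ^ m)" by (simp only: pow)
  have "1 * 1 \<le> E * r ^ m" using E r by (intro mult_mono) auto
  then have q: "1 \<le> E * r ^ m" by simp
  have "penalty_dt l T m t x = - l * (E * r ^ m)" by (simp add: penalty_dt_def E_def r_def)
  also have "\<dots> \<le> - (\<Lambda> + 1) * (E * r ^ m)" using l0 q by (intro mult_right_mono) auto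
  finally have 3: "penalty_dt l T m t x \<le> - \<Lambda> * (E * r ^ m) - E * r ^ m" by (simp add: algebra_simps)
  have "4 * K * m * q + 1/2 * (4 * m * K\<^sup>2 * q + 8 * m * real (m - 1) * K\<^sup>2 * q) = \<Lambda> * q" for q
    by (simp add: \<Lambda>_def algebra_simps)
  from this[of "E * r ^ m"] show ?thesis using 1 2 3 q by argo
qed

text \<open>From |x| <= 1 + |x|^2 a real power is bounded by an integer power. The exponent stays
  free above \<open>k\<close> so that \<open>u\<close> and \<open>v\<close> can share one.\<close>

lemma polynomial_growth_bound:
  fixes w :: "real \<Rightarrow> real^'n \<Rightarrow> real"
  assumes "polynomial_growth T w"
  obtains G k where "0 \<le> G" "\<And>t x k'. t \<in> {0..T} \<Longrightarrow> k \<le> k' \<Longrightarrow> \<bar>w t x\<bar> \<le> G * (1 + x \<bullet> x) ^ k'"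
proof -
  obtain p B where p: "p > 0"
    and B: "\<And>t x. t \<in> {0..T} \<Longrightarrow> \<bar>w t x\<bar> / (1 + norm x powr p) \<le> B"
    using assms unfolding polynomial_growth_def bdd_above_def by fastforce
  define k where "k = nat \<lceil>p\<rceil>"
  show thesis
  proof (rule that[of "2 * \<bar>B\<bar>" k])
    fix t :: real and x :: "real^'n" and k' assume t: "t \<in> {0..T}" and k': "k \<le> k'"
    define r where "r = 1 + x \<bullet> x"
    have r: "r \<ge> 1" by (simp add: r_def)
    have "0 \<le> 1 - 2 * norm x + (norm x)\<^sup>2" using zero_le_power2[of "norm x - 1"] by (simp add: power2_diff)
    then have "norm x \<le> r" using norm_ge_zero[of x] unfolding r_def dot_square_norm by linarith
    then have "norm x powr p \<le> r powr p" using p by (intro powr_mono2) auto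
    also have "\<dots> \<le> r powr real k'" using r real_nat_ceiling_ge[of p] k' by (intro powr_mono) (auto simp: k_def)
    also have "\<dots> = r ^ k'" using r by (simp add: powr_realpow)
    finally have powr: "norm x powr p \<le> r ^ k'" .
    have den: "1 + norm x powr p > 0" by (simp add: add_pos_nonneg)
    have "\<bar>w t x\<bar> \<le> B * (1 + norm x powr p)" using B[OF t, of x] den by (simp add: field_simps)
    also have "\<dots> \<le> \<bar>B\<bar> * (r ^ k' + r ^ k')"
      using powr r den by (intro mult_mono add_mono) auto
    finally show "\<bar>w t x\<bar> \<le> 2 * \<bar>B\<bar> * (1 + x \<bullet> x) ^ k'" by (simp add: r_def)
  qed simp
qed

text \<open>The penalty has one more power of 1 + |x|^2 than the growth bound. Beyond the threshold
  \<open>Y\<close> this power outweighs the factor \<open>G + 1\<close>, whose added 1 pays for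
  |x|^2.\<close>

lemma penalty_coercive:
  fixes G \<alpha> :: real
  assumes "0 \<le> G" "0 < \<alpha>" "0 \<le> l" "1 \<le> k"
  obtains C where "\<And>t (x :: real^'n). t \<in> {0..T} \<Longrightarrow>
    G * (1 + x \<bullet> x) ^ k - \<alpha> * penalty l T (Suc k) t x \<le> C - (norm (t, x))\<^sup>2"
proof -
  define Y where "Y = (G + 1) / \<alpha>"
  have Y: "Y > 0" using assms by (simp add: Y_def)
  show thesis
  proof (rule that[of "T\<^sup>2 + (G + 1) * Y ^ k"])
    fix t :: real and x :: "real^'n" assume t: "t \<in> {0..T}"
    define r where "r = 1 + x \<bullet> x"
    have r: "r \<ge> 1" by (simp add: r_def)
    have "r \<le> r ^ k" using power_increasing[OF assms(4) r] by simp
    moreover have "t\<^sup>2 \<le> T\<^sup>2" using t by (intro power_mono) auto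
    ultimately have n: "(norm (t, x))\<^sup>2 \<le> T\<^sup>2 + r ^ k"
      by (simp add: norm_Pair r_def dot_square_norm)
    have pen: "\<alpha> * r ^ Suc k \<le> \<alpha> * penalty l T (Suc k) t x"
      using assms t penalty_ge[of l t T x "Suc k"] by (intro mult_left_mono) (auto simp: r_def)
    have "(G + 1) * r ^ k \<le> (G + 1) * Y ^ k + \<alpha> * r ^ Suc k"
    proof (cases "r \<le> Y")
      case True
      have "(G + 1) * r ^ k \<le> (G + 1) * Y ^ k"
        using True r assms(1) by (intro mult_left_mono power_mono) auto
      moreover have "0 \<le> \<alpha> * r ^ Suc k" using assms(2) r by simp
      ultimately show ?thesis by linarith
    next
      case False
      have "(G + 1) * r ^ k = \<alpha> * (Y * r ^ k)" using assms(2) by (simp add: Y_def)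
      also have "\<dots> \<le> \<alpha> * r ^ Suc k" using False r assms(2) by (simp add: mult_right_mono)
      finally show ?thesis using assms(1) Y by (simp add: add_increasing)
    qed
    then show "G * (1 + x \<bullet> x) ^ k - \<alpha> * penalty l T (Suc k) t x \<le> T\<^sup>2 + (G + 1) * Y ^ k - (norm (t, x))\<^sup>2"
      using n pen unfolding r_def[symmetric] by (simp add: algebra_simps)
  qed
qed

text \<open>The infimum is below each member only if the set is bounded below, which the bounds
  uniform in the control provide.\<close>

lemma hamiltonian_le:
  fixes b :: "real \<Rightarrow> real^'n \<Rightarrow> 'm \<Rightarrow> real^'n" and \<sigma> :: "real \<Rightarrow> real^'n \<Rightarrow> 'm \<Rightarrow> real^'n^'n"
  assumes coeff: "\<And>a. norm (b t x a) + norm (\<sigma> t x a) \<le> B" and f: "\<And>a. f t x a \<le> F"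
  shows "hamiltonian b \<sigma> f t x p A
    \<le> - (b t x a \<bullet> p) - 1/2 * conj_trace (\<sigma> t x a) A - f t x a"
  unfolding hamiltonian_def
proof (rule cINF_lower)
  obtain \<beta> where \<beta>: "\<beta> > 0" "\<And>y. norm (A *v y) \<le> \<beta> * norm y"
    using linear_bounded_pos[OF matrix_vector_mul_linear[of A]] by blast
  have "- (B * norm p) - 1/2 * (\<beta> * B\<^sup>2) - F
      \<le> - (b t x a \<bullet> p) - 1/2 * conj_trace (\<sigma> t x a) A - f t x a" for a
  proof -
    have B: "norm (b t x a) \<le> B" "norm (\<sigma> t x a) \<le> B"
      using coeff[of a] norm_ge_zero[of "b t x a"] norm_ge_zero[of "\<sigma> t x a"] by linarith+
    have "b t x a \<bullet> p \<le> norm (b t x a) * norm p" by (rule norm_cauchy_schwarz)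
    also have "\<dots> \<le> B * norm p" using B(1) by (intro mult_right_mono) auto
    finally have 1: "b t x a \<bullet> p \<le> B * norm p" .
    have "conj_trace (\<sigma> t x a) A \<le> (\<Sum>j\<in>UNIV. \<beta> * (norm (column j (\<sigma> t x a)))\<^sup>2)"
      unfolding conj_trace_columns
    proof (rule sum_mono)
      fix j
      let ?c = "column j (\<sigma> t x a)"
      have "?c \<bullet> (A *v ?c) \<le> norm ?c * norm (A *v ?c)" by (rule norm_cauchy_schwarz)
      also have "\<dots> \<le> norm ?c * (\<beta> * norm ?c)" by (intro mult_left_mono \<beta>) auto
      finally show "?c \<bullet> (A *v ?c) \<le> \<beta> * (norm ?c)\<^sup>2" by (simp add: power2_eq_square mult_ac)
    qed
    also have "\<dots> = \<beta> * (norm (\<sigma> t x a))\<^sup>2" by (simp add: sum_distrib_left[symmetric] sum_norm_column)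
    also have "\<dots> \<le> \<beta> * B\<^sup>2" using B(2) \<beta>(1) by (intro mult_left_mono power_mono) auto
    finally show ?thesis using 1 f[of a] by linarith
  qed
  then show "bdd_below (range (\<lambda>a. - (b t x a \<bullet> p) - 1/2 * conj_trace (\<sigma> t x a) A - f t x a))"
    by (intro bdd_belowI2)
qed simp

lemma hamiltonian_less:
  assumes "hamiltonian b \<sigma> f t x p A < r"
  obtains a where "- (b t x a \<bullet> p) - 1/2 * conj_trace (\<sigma> t x a) A - f t x a < r"
  using cInf_lessD[OF _ assms[unfolded hamiltonian_def]] by auto

lemma conj_trace_minus: "conj_trace (A :: real^'n^'n) (- M) = - conj_trace A M"
  using conj_trace_scale[of A "- 1" M] by simp

text \<open>The control is nearly optimal for the subsolution and admissible for the supersolution.\<close>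

lemma hamiltonian_gap:
  fixes b :: "real \<Rightarrow> real^'n \<Rightarrow> 'm \<Rightarrow> real^'n" and \<sigma> :: "real \<Rightarrow> real^'n \<Rightarrow> 'm \<Rightarrow> real^'n^'n"
  assumes sub: "c1 - (p1 + q1) + hamiltonian b \<sigma> f t1 x1 (P1 + D1) (X1 + N1) \<le> 0"
    and super: "0 \<le> c2 + (p2 + q2) + hamiltonian b \<sigma> f t2 x2 (- (P2 + D2)) (- (X2 + N2))"
    and coeff: "\<And>a. norm (b t2 x2 a) + norm (\<sigma> t2 x2 a) \<le> B" and f: "\<And>a. f t2 x2 a \<le> F" and "e > 0"
  obtains a where "c1 - c2 \<le> e + (p1 + p2) + (b t1 x1 a \<bullet> P1 + b t2 x2 a \<bullet> P2)
    + 1/2 * (conj_trace (\<sigma> t1 x1 a) X1 + conj_trace (\<sigma> t2 x2 a) X2)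
    + (f t1 x1 a - f t2 x2 a)
    + (q1 + b t1 x1 a \<bullet> D1 + 1/2 * conj_trace (\<sigma> t1 x1 a) N1)
    + (q2 + b t2 x2 a \<bullet> D2 + 1/2 * conj_trace (\<sigma> t2 x2 a) N2)"
proof -
  have "hamiltonian b \<sigma> f t1 x1 (P1 + D1) (X1 + N1) < p1 + q1 - c1 + e" using sub \<open>e > 0\<close> by linarith
  then obtain a where a: "- (b t1 x1 a \<bullet> (P1 + D1)) - 1/2 * conj_trace (\<sigma> t1 x1 a) (X1 + N1)
      - f t1 x1 a < p1 + q1 - c1 + e" by (rule hamiltonian_less)
  have "0 \<le> c2 + (p2 + q2) + (- (b t2 x2 a \<bullet> (- (P2 + D2)))
      - 1/2 * conj_trace (\<sigma> t2 x2 a) (- (X2 + N2)) - f t2 x2 a)"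
    using super hamiltonian_le[where b = b and \<sigma> = \<sigma> and f = f and t = t2 and x = x2 and B = B and F = F
        and p = "- (P2 + D2)" and A = "- (X2 + N2)" and a = a, OF coeff f] by linarith
  moreover have "b t2 x2 a \<bullet> (- (P2 + D2)) = - (b t2 x2 a \<bullet> P2) - b t2 x2 a \<bullet> D2"
    by (simp add: inner_diff_right)
  ultimately show thesis
    using a by (intro that[of a]) (simp only: inner_add_right conj_trace_minus conj_trace_add, argo)
qed

theorem proposition6p1:
  fixes T K L p' cbar :: real
    and b :: "real \<Rightarrow> real^'n \<Rightarrow> 'm::metric_space \<Rightarrow> real^'n"
    and \<sigma> :: "real \<Rightarrow> real^'n \<Rightarrow> 'm \<Rightarrow> real^'n^'n"
    and f :: "real \<Rightarrow> real^'n \<Rightarrow> 'm \<Rightarrow> real"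
    and g :: "real^'n \<Rightarrow> real"
    and c u v :: "real \<Rightarrow> real^'n \<Rightarrow> real"
  assumes T: "T > 0"
    and separable: "separable_space (euclidean :: 'm topology)"
    and b_borel: "(\<lambda>(t, x, a). b t x a) \<in> borel_measurable (restrict_space borel ({0..T} \<times> UNIV))"
    and b_cont: "\<And>t. t \<in> {0..T} \<Longrightarrow> continuous_on UNIV (\<lambda>(x, a). b t x a)"
    and \<sigma>_borel: "(\<lambda>(t, x, a). \<sigma> t x a) \<in> borel_measurable (restrict_space borel ({0..T} \<times> UNIV))"
    and \<sigma>_cont: "\<And>t. t \<in> {0..T} \<Longrightarrow> continuous_on UNIV (\<lambda>(x, a). \<sigma> t x a)"
    and K: "K > 0"
    and b_\<sigma>_growth: "\<And>t x a. t \<in> {0..T} \<Longrightarrow> norm (b t x a) + norm (\<sigma> t x a) \<le> K * (1 + norm x)"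
    and f_nonneg: "\<And>t x a. t \<in> {0..T} \<Longrightarrow> f t x a \<ge> 0"
    and f_borel: "(\<lambda>(t, x, a). f t x a) \<in> borel_measurable (restrict_space borel ({0..T} \<times> UNIV))"
    and f_cont: "\<And>t. t \<in> {0..T} \<Longrightarrow> continuous_on UNIV (\<lambda>(x, a). f t x a)"
    and f_cont_unif: "\<And>t x e. t \<in> {0..T} \<Longrightarrow> e > 0 \<Longrightarrow>
          \<exists>\<delta>>0. \<forall>y. dist y x < \<delta> \<longrightarrow> (\<forall>a. \<bar>f t y a - f t x a\<bar> < e)"
    and g_nonneg: "\<And>x. g x \<ge> 0"
    and g_cont: "continuous_on UNIV g"
    and c_nonneg: "\<And>t x. t \<in> {0..T} \<Longrightarrow> c t x \<ge> 0"
    and c_cont: "continuous_on ({0..T} \<times> UNIV) (\<lambda>(t, x). c t x)"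
    and cbar: "cbar > 0"
    and c_bounded: "\<And>t x. t \<in> {0..T} \<Longrightarrow> c t x \<le> cbar"
    and p': "p' \<ge> 1"
    and f_g_growth: "\<And>t x a. t \<in> {0..T} \<Longrightarrow> \<bar>f t x a\<bar> + \<bar>g x\<bar> \<le> K * (1 + norm x powr p')"
    and L: "L > 0"
    and lipschitz: "\<And>t s x y a. t \<in> {0..T} \<Longrightarrow> s \<in> {0..T} \<Longrightarrow>
          norm (b t x a - b s y a) + norm (\<sigma> t x a - \<sigma> s y a) \<le> L * (\<bar>t - s\<bar> + norm (x - y))"
    and f_unif_cont: "\<And>e. e > 0 \<Longrightarrow>
          \<exists>\<delta>>0. \<forall>t\<in>{0..T}. \<forall>s\<in>{0..T}. \<forall>x y. dist (t, x) (s, y) < \<delta> \<longrightarrow>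
            (\<forall>a. \<bar>f t x a - f s y a\<bar> < e)"
    and u_sub: "viscosity_subsolution T c (hamiltonian b \<sigma> f) g u"
    and u_growth: "polynomial_growth T u"
    and v_super: "viscosity_supersolution T c (hamiltonian b \<sigma> f) g v"
    and v_growth: "polynomial_growth T v"
    and terminal: "\<And>x. u T x \<le> v T x"
  shows "\<forall>t\<in>{0..<T}. \<forall>x. u t x \<le> v t x"
proof (rule ccontr)
  assume "\<not> ?thesis"
  then obtain t0 x0 where t0: "t0 \<in> {0..<T}" and gt: "v t0 x0 < u t0 x0" by (auto simp: not_le)
  obtain Gu ku where u_bd: "0 \<le> Gu" "\<And>t x k'. t \<in> {0..T} \<Longrightarrow> ku \<le> k' \<Longrightarrow> \<bar>u t x\<bar> \<le> Gu * (1 + x \<bullet> x) ^ k'"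
    using polynomial_growth_bound[OF u_growth] by blast
  obtain Gv kv where v_bd: "0 \<le> Gv" "\<And>t x k'. t \<in> {0..T} \<Longrightarrow> kv \<le> k' \<Longrightarrow> \<bar>v t x\<bar> \<le> Gv * (1 + x \<bullet> x) ^ k'"
    using polynomial_growth_bound[OF v_growth] by blast
  \<comment> \<open>A common exponent for both functions, at least 1 as
    \<open>penalty_coercive\<close> demands.\<close>
  define k where "k = max 1 (max ku kv)"
  have k: "1 \<le> k" "ku \<le> k" "kv \<le> k" by (auto simp: k_def)
  define m where "m = Suc k"
  have m: "2 \<le> m" using k by (simp add: m_def)
  define l where "l = 4 * K * m + 2 * m * K\<^sup>2 + 4 * m * real (m - 1) * K\<^sup>2 + 1"
  have l: "0 \<le> l" using K by (simp add: l_def)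
  define \<psi> where "\<psi> = (penalty l T m :: real \<Rightarrow> real^'n \<Rightarrow> real)"
  have \<psi>_ge: "1 \<le> \<psi> t x" if "t \<le> T" for t x
  proof -
    have "1 \<le> (1 + x \<bullet> x) ^ m" by (intro one_le_power) simp
    then show ?thesis unfolding \<psi>_def by (rule order_trans[OF _ penalty_ge[OF l that]])
  qed
  \<comment> \<open>Chosen so that subtracting the penalty twice costs half of the gap at the point
    where \<open>u\<close> exceeds \<open>v\<close>.\<close>
  define \<alpha> where "\<alpha> = (u t0 x0 - v t0 x0) / (4 * \<psi> t0 x0)"
  have \<psi>0: "1 \<le> \<psi> t0 x0" using t0 by (intro \<psi>_ge) auto
  have \<alpha>: "0 < \<alpha>" using gt \<psi>0 by (simp add: \<alpha>_def)
  have \<alpha>\<psi>: "2 * (\<alpha> * \<psi> t0 x0) = (u t0 x0 - v t0 x0) / 2" using \<psi>0 by (simp add: \<alpha>_def)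
  define \<phi> where "\<phi> = (\<lambda>t x. \<alpha> * \<psi> t x)"
  define \<phi>t where "\<phi>t = (\<lambda>t x. \<alpha> * penalty_dt l T m t (x :: real^'n))"
  define D\<phi> where "D\<phi> = (\<lambda>t x. \<alpha> *\<^sub>R penalty_D l T m t (x :: real^'n))"
  define D2\<phi> where "D2\<phi> = (\<lambda>t x. \<alpha> *\<^sub>R penalty_D2 l T m t (x :: real^'n))"
  have \<phi>_C12: "C12_with_derivs T \<phi> \<phi>t D\<phi> D2\<phi>"
    unfolding \<phi>_def \<phi>t_def D\<phi>_def D2\<phi>_def \<psi>_def by (rule C12_with_derivs_scale[OF penalty_C12])
  have \<phi>_cont: "continuous_on S (\<lambda>z. \<phi> (fst z) (snd z))" for S
    unfolding \<phi>_def \<psi>_def by (intro continuous_intros continuous_on_penalty)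
  have \<phi>_super: "\<phi>t t x + b t x a \<bullet> D\<phi> t x
      + 1/2 * conj_trace (\<sigma> t x a) (D2\<phi> t x) \<le> - \<alpha>" if t: "t \<in> {0..T}" for t x a
  proof -
    have "t \<le> T" using t by simp
    from penalty_strict_supersolution[OF m this K b_\<sigma>_growth[OF t], of l] \<alpha>
    have "\<alpha> * (penalty_dt l T m t x + b t x a \<bullet> penalty_D l T m t x
      + 1/2 * conj_trace (\<sigma> t x a) (penalty_D2 l T m t x)) \<le> \<alpha> * (- 1)"
      by (intro mult_left_mono) (auto simp: l_def)
    then show ?thesis by (simp add: \<phi>t_def D\<phi>_def D2\<phi>_def conj_trace_scale algebra_simps)
  qed
  define Q where "Q = {0..T} \<times> (UNIV :: (real^'n) set)"
  define w1 where "w1 = (\<lambda>z. u (fst z) (snd z) - \<phi> (fst z) (snd z))"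
  define w2 where "w2 = (\<lambda>z. - v (fst z) (snd z) - \<phi> (fst z) (snd z))"
  have "closed Q" unfolding Q_def by (intro closed_Times) auto
  have z0: "(t0, x0) \<in> Q" using t0 by (auto simp: Q_def)
  have "upper_semicont_on Q (\<lambda>z. u (fst z) (snd z))"
    using u_sub[unfolded viscosity_subsolution_def case_prod_beta, THEN conjunct1] by (simp only: Q_def)
  then have usc1: "upper_semicont_on Q w1"
    unfolding w1_def diff_conv_add_uminus
    by (intro upper_semicont_on_add_continuous continuous_on_minus \<phi>_cont)
  have lsc: "lower_semicont_on Q (\<lambda>z. v (fst z) (snd z))"
    using v_super[unfolded viscosity_supersolution_def case_prod_beta, THEN conjunct1] by (simp only: Q_def)
  have "upper_semicont_on Q (\<lambda>z. - v (fst z) (snd z))"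
    unfolding upper_semicont_on_def
  proof (intro ballI allI impI)
    fix z r assume "z \<in> Q" "- v (fst z) (snd z) < r"
    then have "z \<in> Q" "- r < v (fst z) (snd z)" by auto
    then have "\<forall>\<^sub>F y in at z within Q. - r < v (fst y) (snd y)"
      using lsc unfolding lower_semicont_on_def by blast
    then show "\<forall>\<^sub>F y in at z within Q. - v (fst y) (snd y) < r" by eventually_elim simp
  qed
  then have usc2: "upper_semicont_on Q w2"
    unfolding w2_def diff_conv_add_uminus
    by (intro upper_semicont_on_add_continuous continuous_on_minus \<phi>_cont)
  obtain C where C: "\<And>t (x :: real^'n). t \<in> {0..T} \<Longrightarrow>
      (Gu + Gv) * (1 + x \<bullet> x) ^ k - \<alpha> * penalty l T (Suc k) t x \<le> C - (norm (t, x))\<^sup>2"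
    using penalty_coercive[of "Gu + Gv" \<alpha> l k T] u_bd v_bd \<alpha> l k by auto
  have bound: "w1 z \<le> C - (norm z)\<^sup>2" "w2 z \<le> C - (norm z)\<^sup>2" if "z \<in> Q" for z
  proof -
    have t: "fst z \<in> {0..T}" using that by (auto simp: Q_def)
    have "0 \<le> Gu * (1 + snd z \<bullet> snd z) ^ k" "0 \<le> Gv * (1 + snd z \<bullet> snd z) ^ k"
      using u_bd(1) v_bd(1) by auto
    then show "w1 z \<le> C - (norm z)\<^sup>2" "w2 z \<le> C - (norm z)\<^sup>2"
      using C[OF t, of "snd z"] u_bd(2)[OF t k(2), of "snd z"] v_bd(2)[OF t k(3), of "snd z"]
      unfolding w1_def w2_def \<phi>_def \<psi>_def m_def distrib_right prod.collapse by linarith+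
  qed
  have bound': "w1 z \<le> C" "w2 z \<le> C" if "z \<in> Q" for z
    using bound[OF that] zero_le_power2[of "norm z"] by linarith+
  obtain z1 z2 y S1 S2 \<kappa> z where \<kappa>_all: "\<forall>n::nat. 0 < \<kappa> n" "\<kappa> \<longlonglongrightarrow> 0"
    and z_in_all: "\<forall>n. z1 n \<in> Q" "\<forall>n. z2 n \<in> Q" "z \<in> Q"
    and jet1_all: "\<forall>n. upper_jet Q w1 (z1 n) ((z1 n - y n) /\<^sub>R \<kappa> n) (S1 n)"
    and jet2_all: "\<forall>n. upper_jet Q w2 (z2 n) ((z2 n - y n) /\<^sub>R \<kappa> n) (S2 n)"
    and mat_all: "\<forall>n \<xi> \<eta>. \<xi> \<bullet> S1 n \<xi> + \<eta> \<bullet> S2 n \<eta> \<le> (norm (\<xi> - \<eta>))\<^sup>2 / (2 * \<kappa> n) + \<kappa> n * ((norm \<xi>)\<^sup>2 + (norm \<eta>)\<^sup>2)"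
    and p_lim: "(\<lambda>n. norm (z1 n + z2 n - 2 *\<^sub>R y n) / \<kappa> n) \<longlonglongrightarrow> 0"
    and D_lim: "(\<lambda>n. ((norm (z1 n - y n))\<^sup>2 + (norm (z2 n - y n))\<^sup>2) / \<kappa> n) \<longlonglongrightarrow> 0"
    and z_lim: "z1 \<longlonglongrightarrow> z" "z2 \<longlonglongrightarrow> z"
    and w_lim: "(\<lambda>n. w1 (z1 n)) \<longlonglongrightarrow> w1 z" "(\<lambda>n. w2 (z2 n)) \<longlonglongrightarrow> w2 z"
    and w_ge: "w1 (t0, x0) + w2 (t0, x0) \<le> w1 z + w2 z"
    by (rule penalized_maxima[OF \<open>closed Q\<close> z0 usc1 usc2 bound])
  note \<kappa> = \<kappa>_all[rule_format] and z_in = z_in_all[rule_format] and jet1 = jet1_all[rule_format]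
    and jet2 = jet2_all[rule_format] and mat = mat_all[rule_format]
  define t1 x1 t2 x2 where "t1 = (\<lambda>n. fst (z1 n))" and "x1 = (\<lambda>n. snd (z1 n))"
    and "t2 = (\<lambda>n. fst (z2 n))" and "x2 = (\<lambda>n. snd (z2 n))"
  note coords = t1_def x1_def t2_def x2_def
  have t_in: "t1 n \<in> {0..T}" "t2 n \<in> {0..T}" "fst z \<in> {0..T}" for n
    using z_in(1,2)[of n] z_in(3) by (auto simp: Q_def coords mem_Times_iff)
  have w_pos: "0 < w1 z + w2 z"
  proof -
    have "w1 (t0, x0) + w2 (t0, x0) = (u t0 x0 - v t0 x0) - 2 * (\<alpha> * \<psi> t0 x0)"
      by (simp add: w1_def w2_def \<phi>_def)
    also have "\<dots> = (u t0 x0 - v t0 x0) / 2" unfolding \<alpha>\<psi> by (simp add: field_simps)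
    finally show ?thesis using w_ge gt by simp
  qed
  have uv_pos: "w1 z + w2 z \<le> u (fst z) (snd z) - v (fst z) (snd z) - 2 * \<phi> (fst z) (snd z)"
    by (simp add: w1_def w2_def)
  have \<phi>_pos: "0 < \<phi> t x" if "t \<in> {0..T}" for t x
    using \<psi>_ge[of t x] that \<alpha> by (auto simp: \<phi>_def intro!: mult_pos_pos)
  \<comment> \<open>At time \<open>T\<close> the penalized sum is negative, so the limit point lies
    where the viscosity inequalities are available.\<close>
  have t_less: "fst z < T"
  proof (rule ccontr)
    assume "\<not> fst z < T"
    then have "fst z = T" using t_in(3) by simp
    then show False using w_pos uv_pos terminal[of "snd z"] \<phi>_pos[OF t_in(3), of "snd z"] by simp
  qed
  define U where "U = (\<lambda>n. u (t1 n) (x1 n))"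
  define V where "V = (\<lambda>n. v (t2 n) (x2 n))"
  have \<phi>_lim: "(\<lambda>n. \<phi> (fst (s n)) (snd (s n))) \<longlonglongrightarrow> \<phi> (fst z) (snd z)" if "s \<longlonglongrightarrow> z" for s
    by (rule continuous_on_tendsto_compose[OF \<phi>_cont[of UNIV] that]) auto
  have U_lim: "U \<longlonglongrightarrow> u (fst z) (snd z)"
    using tendsto_add[OF w_lim(1) \<phi>_lim[OF z_lim(1)]] by (simp add: w1_def U_def coords)
  have V_lim: "V \<longlonglongrightarrow> v (fst z) (snd z)"
    using tendsto_minus[OF tendsto_add[OF w_lim(2) \<phi>_lim[OF z_lim(2)]]] by (simp add: w2_def V_def coords)
  have x_lim: "x1 \<longlonglongrightarrow> snd z" "x2 \<longlonglongrightarrow> snd z" and t_lim: "t1 \<longlonglongrightarrow> fst z" "t2 \<longlonglongrightarrow> fst z"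
    unfolding coords by (intro tendsto_intros z_lim)+
  have g_lim: "(\<lambda>n. g (s n)) \<longlonglongrightarrow> g (snd z)" if "s \<longlonglongrightarrow> snd z" for s
    by (rule continuous_on_tendsto_compose[OF g_cont that]) auto
  have c_lim: "(\<lambda>n. c (t1 n) (x1 n)) \<longlonglongrightarrow> c (fst z) (snd z)" "(\<lambda>n. c (t2 n) (x2 n)) \<longlonglongrightarrow> c (fst z) (snd z)"
    using continuous_on_tendsto_compose[OF c_cont z_lim(1)] continuous_on_tendsto_compose[OF c_cont z_lim(2)] z_in
    by (auto simp: Q_def case_prod_beta coords)
  define D where "D = (\<lambda>n. ((norm (z1 n - y n))\<^sup>2 + (norm (z2 n - y n))\<^sup>2) / \<kappa> n)"
  define p where "p = (\<lambda>n. norm (z1 n + z2 n - 2 *\<^sub>R y n) / \<kappa> n)"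
  \<comment> \<open>The total error: near-optimality of the control, mismatch of the time slopes,
    drift terms, trace terms.\<close>
  define R where "R = (\<lambda>n. \<kappa> n + p n + (4 * L * D n + K * (1 + norm (x2 n)) * p n)
      + 1/2 * (4 * L\<^sup>2 * D n + \<kappa> n * ((K * (1 + norm (x1 n)))\<^sup>2 + (K * (1 + norm (x2 n)))\<^sup>2)))"
  have R_lim: "R \<longlonglongrightarrow> 0"
  proof -
    have "R \<longlonglongrightarrow> 0 + 0 + (4 * L * 0 + K * (1 + norm (snd z)) * 0)
      + 1/2 * (4 * L\<^sup>2 * 0 + 0 * ((K * (1 + norm (snd z)))\<^sup>2 + (K * (1 + norm (snd z)))\<^sup>2))"
      unfolding R_def by (intro tendsto_intros \<kappa>(2) p_lim[folded p_def] D_lim[folded D_def] x_lim)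
    then show ?thesis by simp
  qed
  obtain \<delta> where "\<delta> > 0" and \<delta>: "\<And>t s x y a. t \<in> {0..T} \<Longrightarrow> s \<in> {0..T} \<Longrightarrow> dist (t, x) (s, y) < \<delta> \<Longrightarrow>
      \<bar>f t x a - f s y a\<bar> < \<alpha> / 2"
    using f_unif_cont[of "\<alpha> / 2"] \<alpha> by (metis half_gt_zero)
  \<comment> \<open>By the sign of \<open>c\<close> the zeroth-order difference is nonnegative in
    the limit, so any negative lower bound holds eventually. The comparison with \<open>g\<close>
    prepares the choice between obstacle and equation.\<close>
  have "\<forall>\<^sub>F n in sequentially. t1 n < T \<and> t2 n < T \<and> g (x1 n) - g (x2 n) < U n - V n \<and>
      - \<alpha> / 2 < c (t1 n) (x1 n) * U n - c (t2 n) (x2 n) * V n \<and> R n < \<alpha> / 2 \<and> dist (z1 n) (z2 n) < \<delta>"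
  proof (intro eventually_conj)
    show "\<forall>\<^sub>F n in sequentially. t1 n < T" "\<forall>\<^sub>F n in sequentially. t2 n < T"
      using order_tendstoD(2)[OF t_lim(1) t_less] order_tendstoD(2)[OF t_lim(2) t_less] by auto
    have lim: "(\<lambda>n. U n - V n - (g (x1 n) - g (x2 n))) \<longlonglongrightarrow> u (fst z) (snd z) - v (fst z) (snd z) - (g (snd z) - g (snd z))"
      by (intro tendsto_intros U_lim V_lim g_lim x_lim)
    have uv: "0 < u (fst z) (snd z) - v (fst z) (snd z)"
      using w_pos uv_pos \<phi>_pos[OF t_in(3), of "snd z"] by linarith
    have "\<forall>\<^sub>F n in sequentially. 0 < U n - V n - (g (x1 n) - g (x2 n))"
      by (rule order_tendstoD(1)[OF lim]) (use uv in simp)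
    then show "\<forall>\<^sub>F n in sequentially. g (x1 n) - g (x2 n) < U n - V n" by eventually_elim simp
    have lim: "(\<lambda>n. c (t1 n) (x1 n) * U n - c (t2 n) (x2 n) * V n)
        \<longlonglongrightarrow> c (fst z) (snd z) * u (fst z) (snd z) - c (fst z) (snd z) * v (fst z) (snd z)"
      by (intro tendsto_intros c_lim U_lim V_lim)
    have "0 \<le> c (fst z) (snd z) * (u (fst z) (snd z) - v (fst z) (snd z))"
      using c_nonneg[OF t_in(3)] uv by simp
    then show "\<forall>\<^sub>F n in sequentially. - \<alpha> / 2 < c (t1 n) (x1 n) * U n - c (t2 n) (x2 n) * V n"
      using \<alpha> by (intro order_tendstoD(1)[OF lim]) (simp add: right_diff_distrib)
    show "\<forall>\<^sub>F n in sequentially. R n < \<alpha> / 2"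
      using \<alpha> by (intro order_tendstoD(2)[OF R_lim]) simp
    show "\<forall>\<^sub>F n in sequentially. dist (z1 n) (z2 n) < \<delta>"
      using tendsto_dist[OF z_lim] \<open>\<delta> > 0\<close> by (intro order_tendstoD(2)) auto
  qed
  then obtain n where n: "t1 n < T" "t2 n < T" "g (x1 n) - g (x2 n) < U n - V n"
    "- \<alpha> / 2 < c (t1 n) (x1 n) * U n - c (t2 n) (x2 n) * V n" "R n < \<alpha> / 2" "dist (z1 n) (z2 n) < \<delta>"
    using eventually_happens'[OF sequentially_bot] by blast
  have t': "t1 n \<in> {0..<T}" "t2 n \<in> {0..<T}" using t_in n by auto
  define P1 P2 where "P1 = (z1 n - y n) /\<^sub>R \<kappa> n" and "P2 = (z2 n - y n) /\<^sub>R \<kappa> n"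
  note sub = subsolution_upper_jet[OF u_sub \<phi>_C12 _ t'(1), of "x1 n" P1 "S1 n" C]
  have sub: "U n \<le> g (x1 n)" "c (t1 n) (x1 n) * U n - (fst P1 + \<phi>t (t1 n) (x1 n))
      + hamiltonian b \<sigma> f (t1 n) (x1 n) (snd P1 + D\<phi> (t1 n) (x1 n)) (space_block (S1 n) + D2\<phi> (t1 n) (x1 n)) \<le> 0"
    using sub jet1[of n] bound'(1) by (simp_all add: U_def P1_def Q_def w1_def coords)
  have "g (x2 n) \<le> V n \<or> 0 \<le> c (t2 n) (x2 n) * V n + (fst P2 + \<phi>t (t2 n) (x2 n))
      + hamiltonian b \<sigma> f (t2 n) (x2 n) (- (snd P2 + D\<phi> (t2 n) (x2 n))) (- (space_block (S2 n) + D2\<phi> (t2 n) (x2 n)))"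
    unfolding V_def
    by (rule supersolution_upper_jet[OF v_super \<phi>_C12 _ t'(2), of "x2 n" P2 "S2 n" C])
      (use jet2[of n] bound'(2) in \<open>simp_all add: P2_def Q_def w2_def coords\<close>)
  \<comment> \<open>The subsolution lies below the obstacle, and the gap exceeds the variation of
    \<open>g\<close>; so \<open>v\<close> is strictly below it and the differential inequality must
    hold.\<close>
  moreover have "\<not> g (x2 n) \<le> V n" using sub(1) n(3) by linarith
  ultimately have super: "0 \<le> c (t2 n) (x2 n) * V n + (fst P2 + \<phi>t (t2 n) (x2 n))
      + hamiltonian b \<sigma> f (t2 n) (x2 n) (- (snd P2 + D\<phi> (t2 n) (x2 n))) (- (space_block (S2 n) + D2\<phi> (t2 n) (x2 n)))"
    by blast
  have f_bd: "f (t2 n) (x2 n) a \<le> K * (1 + norm (x2 n) powr p')" for a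
    using f_g_growth[OF t_in(2), of n "x2 n" a] by linarith
  define b1 b2 s1 s2 where "b1 = b (t1 n) (x1 n)" and "b2 = b (t2 n) (x2 n)"
    and "s1 = \<sigma> (t1 n) (x1 n)" and "s2 = \<sigma> (t2 n) (x2 n)"
  obtain a where a: "c (t1 n) (x1 n) * U n - c (t2 n) (x2 n) * V n \<le> \<kappa> n + (fst P1 + fst P2) + (b1 a \<bullet> snd P1 + b2 a \<bullet> snd P2)
    + 1/2 * (conj_trace (s1 a) (space_block (S1 n)) + conj_trace (s2 a) (space_block (S2 n)))
    + (f (t1 n) (x1 n) a - f (t2 n) (x2 n) a)
    + (\<phi>t (t1 n) (x1 n) + b1 a \<bullet> D\<phi> (t1 n) (x1 n) + 1/2 * conj_trace (s1 a) (D2\<phi> (t1 n) (x1 n)))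
    + (\<phi>t (t2 n) (x2 n) + b2 a \<bullet> D\<phi> (t2 n) (x2 n) + 1/2 * conj_trace (s2 a) (D2\<phi> (t2 n) (x2 n)))"
    unfolding b1_def b2_def s1_def s2_def
    by (rule hamiltonian_gap[OF sub(2) super b_\<sigma>_growth[OF t_in(2)] f_bd \<kappa>(1)])
  have f_diff: "f (t1 n) (x1 n) a - f (t2 n) (x2 n) a < \<alpha> / 2"
    using \<delta>[OF t_in(1)[of n] t_in(2)[of n], of "x1 n" "x2 n" a] n(6) unfolding coords prod.collapse by linarith
  have "P1 + P2 = (z1 n + z2 n - 2 *\<^sub>R y n) /\<^sub>R \<kappa> n"
  proof -
    have "(z1 n - y n) + (z2 n - y n) = z1 n + z2 n - 2 *\<^sub>R y n" by (simp add: scaleR_2)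
    then show ?thesis by (simp only: P1_def P2_def scaleR_add_right[symmetric])
  qed
  then have P_sum: "norm (P1 + P2) = p n" using \<kappa>(1)[of n] by (simp add: p_def divide_inverse_commute)
  have proj_le: "norm (fst s) \<le> norm s" "norm (snd s) \<le> norm s" for s :: "real \<times> (real^'n)"
    using norm_fst_le[of "fst s" "snd s"] norm_snd_le[of "snd s" "fst s"] by simp_all
  have t_part: "fst P1 + fst P2 \<le> p n"
    using proj_le(1)[of "P1 + P2"] P_sum by simp
  have "norm (b1 a - b2 a) + norm (s1 a - s2 a) \<le> L * (\<bar>t1 n - t2 n\<bar> + norm (x1 n - x2 n))"
    unfolding b1_def b2_def s1_def s2_def by (rule lipschitz[OF t_in(1,2)])
  moreover define d where "d = norm (z1 n - y n) + norm (z2 n - y n)"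
  moreover have "\<bar>t1 n - t2 n\<bar> \<le> d" "norm (x1 n - x2 n) \<le> d"
  proof -
    have "norm (z1 n - z2 n) \<le> d"
      unfolding d_def using norm_triangle_ineq4[of "z1 n - y n" "z2 n - y n"] by simp
    then show "\<bar>t1 n - t2 n\<bar> \<le> d" "norm (x1 n - x2 n) \<le> d"
      using proj_le[of "z1 n - z2 n"] by (auto simp: coords)
  qed
  ultimately have "norm (b1 a - b2 a) + norm (s1 a - s2 a) \<le> L * (2 * d)"
    using L by (smt (verit) mult_left_mono)
  then have lip: "norm (b1 a - b2 a) \<le> 2 * L * d" "norm (s1 a - s2 a) \<le> 2 * L * d"
    using norm_ge_zero[of "b1 a - b2 a"] norm_ge_zero[of "s1 a - s2 a"] mult.assoc[of 2 L d] mult.left_commute[of L 2 d] by - linarith+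
  have d: "0 \<le> d" "d\<^sup>2 / \<kappa> n \<le> 2 * D n"
  proof -
    show "0 \<le> d" by (simp add: d_def)
    have "d\<^sup>2 \<le> 2 * ((norm (z1 n - y n))\<^sup>2 + (norm (z2 n - y n))\<^sup>2)"
      using sum_squares_bound[of "norm (z1 n - y n)" "norm (z2 n - y n)"] by (simp add: d_def power2_sum)
    then show "d\<^sup>2 / \<kappa> n \<le> 2 * D n" using \<kappa>(1)[of n] by (simp add: D_def divide_right_mono)
  qed
  have b_bd: "norm (b2 a) \<le> K * (1 + norm (x2 n))" "norm (s1 a) \<le> K * (1 + norm (x1 n))" "norm (s2 a) \<le> K * (1 + norm (x2 n))"
    using b_\<sigma>_growth[OF t_in(1), of n "x1 n" a] b_\<sigma>_growth[OF t_in(2), of n "x2 n" a]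
      norm_ge_zero[of "b1 a"] norm_ge_zero[of "b2 a"] norm_ge_zero[of "s1 a"] norm_ge_zero[of "s2 a"]
    unfolding b1_def b2_def s1_def s2_def by linarith+
  \<comment> \<open>The drifts differ by O(\<open>d\<close>) and the slope is at most
    \<open>d / \<kappa> n\<close>, so their product is of order
    \<open>d\<^sup>2 / \<kappa> n\<close>. The mismatch of the slopes meets the full drift, hence
    the growth factor.\<close>
  have b_part: "b1 a \<bullet> snd P1 + b2 a \<bullet> snd P2 \<le> 4 * L * D n + K * (1 + norm (x2 n)) * p n"
  proof -
    have "b1 a \<bullet> snd P1 + b2 a \<bullet> snd P2 = (b1 a - b2 a) \<bullet> snd P1 + b2 a \<bullet> snd (P1 + P2)"
      by (simp add: inner_diff_left inner_add_right)
    also have "(b1 a - b2 a) \<bullet> snd P1 \<le> 4 * L * D n"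
    proof -
      have "(b1 a - b2 a) \<bullet> snd P1 \<le> norm (b1 a - b2 a) * norm (snd P1)" by (rule norm_cauchy_schwarz)
      also have "\<dots> \<le> (2 * L * d) * (d / \<kappa> n)"
      proof (rule mult_mono)
        have "norm (snd P1) \<le> norm P1" by (rule proj_le(2))
        also have "norm P1 = norm (z1 n - y n) / \<kappa> n" using \<kappa>(1)[of n] by (simp add: P1_def divide_inverse_commute)
        also have "\<dots> \<le> d / \<kappa> n" using \<kappa>(1)[of n] by (intro divide_right_mono) (auto simp: d_def)
        finally show "norm (snd P1) \<le> d / \<kappa> n" .
      qed (use lip L d in auto)
      also have "\<dots> = 2 * L * (d\<^sup>2 / \<kappa> n)" by (simp add: power2_eq_square)
      also have "\<dots> \<le> 2 * L * (2 * D n)" using d L by (intro mult_left_mono) auto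
      finally show ?thesis by simp
    qed
    also have "b2 a \<bullet> snd (P1 + P2) \<le> K * (1 + norm (x2 n)) * p n"
    proof -
      have "b2 a \<bullet> snd (P1 + P2) \<le> norm (b2 a) * norm (snd (P1 + P2))" by (rule norm_cauchy_schwarz)
      also have "\<dots> \<le> K * (1 + norm (x2 n)) * p n"
        using b_bd(1) proj_le(2)[of "P1 + P2"] P_sum K by (intro mult_mono) auto
      finally show ?thesis .
    qed
    finally show ?thesis by simp
  qed
  have tr_part: "conj_trace (s1 a) (space_block (S1 n)) + conj_trace (s2 a) (space_block (S2 n))
      \<le> 4 * L\<^sup>2 * D n + \<kappa> n * ((K * (1 + norm (x1 n)))\<^sup>2 + (K * (1 + norm (x2 n)))\<^sup>2)"
  proof -
    have "linear (S1 n)" "linear (S2 n)" using jet1[of n] jet2[of n] by (auto simp: upper_jet_def)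
    from trace_jets_le[OF this mat, of "s1 a" "s2 a"]
    have "conj_trace (s1 a) (space_block (S1 n)) + conj_trace (s2 a) (space_block (S2 n))
      \<le> (norm (s1 a - s2 a))\<^sup>2 / (2 * \<kappa> n) + \<kappa> n * ((norm (s1 a))\<^sup>2 + (norm (s2 a))\<^sup>2)" .
    also have "\<dots> \<le> (2 * L * d)\<^sup>2 / (2 * \<kappa> n) + \<kappa> n * ((K * (1 + norm (x1 n)))\<^sup>2 + (K * (1 + norm (x2 n)))\<^sup>2)"
      using lip(2) b_bd(2,3) \<kappa>(1)[of n]
      by (intro add_mono divide_right_mono mult_left_mono power_mono) auto
    also have "(2 * L * d)\<^sup>2 / (2 * \<kappa> n) = 2 * L\<^sup>2 * (d\<^sup>2 / \<kappa> n)" by (simp add: power_mult_distrib)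
    also have "\<dots> \<le> 2 * L\<^sup>2 * (2 * D n)" using d by (intro mult_left_mono) auto
    finally show ?thesis by simp
  qed
  have \<phi>_part: "\<phi>t (t1 n) (x1 n) + b1 a \<bullet> D\<phi> (t1 n) (x1 n) + 1/2 * conj_trace (s1 a) (D2\<phi> (t1 n) (x1 n)) \<le> - \<alpha>"
    "\<phi>t (t2 n) (x2 n) + b2 a \<bullet> D\<phi> (t2 n) (x2 n) + 1/2 * conj_trace (s2 a) (D2\<phi> (t2 n) (x2 n)) \<le> - \<alpha>"
    unfolding b1_def b2_def s1_def s2_def by (rule \<phi>_super[OF t_in(1)] \<phi>_super[OF t_in(2)])+
  \<comment> \<open>The balance: -2 \<alpha> from the penalties, less than \<alpha> / 2 from
    \<open>f\<close> and less than \<alpha> / 2 from \<open>R n\<close> put the zeroth-order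
    difference below -\<alpha>, against its lower bound -\<alpha> / 2.\<close>
  have "lhs < e + p' + b' + 1/2 * tr' + \<alpha> / 2 - \<alpha> - \<alpha>"
    if "lhs \<le> e + p + b + 1/2 * tr + f + q1 + q2" "f < \<alpha> / 2" "p \<le> p'" "b \<le> b'" "tr \<le> tr'" "q1 \<le> - \<alpha>" "q2 \<le> - \<alpha>"
    for lhs e p p' b b' tr tr' f q1 q2 :: real
    using that by linarith
  from this[OF a f_diff t_part b_part tr_part \<phi>_part]
  have "c (t1 n) (x1 n) * U n - c (t2 n) (x2 n) * V n < R n + \<alpha> / 2 - \<alpha> - \<alpha>"
    unfolding R_def .
  with n(4,5) \<alpha> show False by linarith
qed

end
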